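(* Let $d$ be a positive integer, let $\mathcal M$ be a complex Hilbert space and let $\phi:\mathbb Z_+^d\times\mathbb Z_+^d\to\mathcal B(\mathcal M)$ be a $\mathcal B(\mathcal M)$-valued kernel function. Then the following are equivalent: (i) There exists a $\mathcal B(\mathcal M)$-valued semispectral measure $F$ on $\partial\mathbb B^d$ such that $$\phi(\alpha,\beta)=\int_{\partial\mathbb B^d}\zeta^\alpha\overline{\zeta}^{\beta}\,dF(\zeta),\qquad\alpha,\beta\in\mathbb Z_+^d.\qquad( * )$$ (ii) The kernel function $\phi$ is positive definite and $$\sum_{j=1}^d\phi(\alpha+\varepsilon_j,\beta+\varepsilon_j)=\phi(\alpha,\beta),\qquad\alpha,\beta\in\mathbb Z_+^d.$$ Moreover, the semispectral measure $F$ is uniquely determined by $( * )$.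
   Context: $\partial\mathbb B^d$ is the unit sphere of $\mathbb C^d$; $\mathbb Z_+$ is the set of non-negative integers; $\varepsilon_j$ is the $d$-tuple with $1$ in the $j$-th entry and zeros elsewhere; $\zeta^\alpha=\prod_j\zeta_j^{\alpha_j}$, $\overline\zeta^{\beta}=\prod_j\overline{\zeta_j}^{\beta_j}$. A $\mathcal B(\mathcal M)$-valued semispectral measure $F$ on $\partial\mathbb B^d$ is a finitely additive set function on the Borel sets of $\partial\mathbb B^d$ with values positive operators in $\mathcal B(\mathcal M)$ such that $\langle F(\cdot)x,y\rangle$ is a complex regular Borel measure for all $x,y\in\mathcal M$; integrals against $F$ are understood in the weak sense. The kernel $\phi$ is positive definite if $\sum_{\alpha,\beta\in A}\langle\phi(\alpha,\beta)x_\alpha,x_\beta\rangle\geqslant0$ for every finite $A\subseteq\mathbb Z_+^d$ and all $x_\alpha\in\mathcal M$ ($\alpha\in A$). *)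

theory Defs
  imports "HOL-Analysis.Analysis" "HOL-Library.Nonpos_Ints"
begin

section \<open>Complex Hilbert spaces and bounded operators\<close>

text \<open>
  The inner product is linear in its first argument. Completeness comes from \<^class>\<open>banach\<close>;
  the last two axioms say that the complex structure extends the given real one and that the
  norm is the one induced by the inner product. The space may be zero- or infinite-dimensional.
\<close>

class chilbert = banach +
  fixes scaleC :: "complex \<Rightarrow> 'a \<Rightarrow> 'a" (infixr \<open>*\<^sub>C\<close> 75)
    and cinner :: "'a \<Rightarrow> 'a \<Rightarrow> complex"
  assumes scaleC_add_right: "c *\<^sub>C (x + y) = c *\<^sub>C x + c *\<^sub>C y"
    and scaleC_add_left: "(b + c) *\<^sub>C x = b *\<^sub>C x + c *\<^sub>C x"
    and scaleC_scaleC: "b *\<^sub>C c *\<^sub>C x = (b * c) *\<^sub>C x"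
    and cinner_commute: "cinner x y = cnj (cinner y x)"
    and cinner_add_left: "cinner (x + y) z = cinner x z + cinner y z"
    and cinner_scaleC_left: "cinner (c *\<^sub>C x) y = c * cinner x y"
    and scaleC_of_real: "complex_of_real r *\<^sub>C x = r *\<^sub>R x"
    and cinner_self: "cinner x x = complex_of_real ((norm x)\<^sup>2)"

instantiation complex :: chilbert
begin

definition "scaleC_complex c (x :: complex) = c * x"
definition "cinner_complex (x :: complex) y = x * cnj y"

instance
  by standard
    (simp_all add: scaleC_complex_def cinner_complex_def algebra_simps scaleR_conv_of_real
      complex_norm_square del: of_real_power)

end

text \<open>
  The type \<^typ>\<open>'m \<Rightarrow>\<^sub>L 'm\<close> consists of the bounded real-linear operators;
  \<open>\<B>(\<M>)\<close> is the set of those that are complex-linear.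
\<close>

definition bounded_operators :: "('m::chilbert \<Rightarrow>\<^sub>L 'm) set" where
  "bounded_operators = {T. \<forall>c x. blinfun_apply T (c *\<^sub>C x) = c *\<^sub>C blinfun_apply T x}"

definition positive_operator :: "('m::chilbert \<Rightarrow>\<^sub>L 'm) \<Rightarrow> bool" where
  "positive_operator T \<longleftrightarrow>
     T \<in> bounded_operators \<and> (\<forall>x. cinner (blinfun_apply T x) x \<in> \<real>\<^sub>\<ge>\<^sub>0)"


section \<open>Complex measures\<close>

text \<open>
  A complex measure is given by its values on the measurable sets of a measure space whose own
  measure plays no role; values on other sets are irrelevant.
\<close>

definition complex_measure :: "'a measure \<Rightarrow> ('a set \<Rightarrow> complex) \<Rightarrow> bool" where
  "complex_measure M \<mu> \<longleftrightarrow>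
     (\<forall>A. range A \<subseteq> sets M \<longrightarrow> disjoint_family A \<longrightarrow>
        (\<lambda>n::nat. \<mu> (A n)) sums \<mu> (\<Union>n. A n))"

text \<open>
  Regularity: the condition that every measurable \<open>C \<subseteq> U - K\<close> has \<open>cmod (\<mu> C) < \<epsilon>\<close> says, up to a
  constant factor in \<open>\<epsilon>\<close>, that the total variation of \<open>\<mu>\<close> on \<open>U - K\<close> is small.
  The topology is the subspace topology of \<^term>\<open>space M\<close>.
\<close>

definition regular_complex_measure ::
    "'a::topological_space measure \<Rightarrow> ('a set \<Rightarrow> complex) \<Rightarrow> bool" where
  "regular_complex_measure M \<mu> \<longleftrightarrow>
     complex_measure M \<mu> \<and>
     (\<forall>A\<in>sets M. \<forall>\<epsilon>>0. \<exists>K U.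
        compact K \<and> openin (top_of_set (space M)) U \<and> K \<subseteq> A \<and> A \<subseteq> U \<and>
        (\<forall>C\<in>sets M. C \<subseteq> U - K \<longrightarrow> cmod (\<mu> C) < \<epsilon>))"

text \<open>
  Positive part in the Jordan decomposition of a signed measure \<open>\<nu>\<close>; since \<^const>\<open>ennreal\<close> maps
  negative reals to \<open>0\<close>, the negative part is obtained from \<open>\<lambda>A. - \<nu> A\<close>.
\<close>

definition upper_variation :: "'a measure \<Rightarrow> ('a set \<Rightarrow> real) \<Rightarrow> 'a measure" where
  "upper_variation M \<nu> =
     measure_of (space M) (sets M) (\<lambda>A. SUP B\<in>{B \<in> sets M. B \<subseteq> A}. ennreal (\<nu> B))"

definition signed_integrable ::
    "'a measure \<Rightarrow> ('a set \<Rightarrow> real) \<Rightarrow> ('a \<Rightarrow> complex) \<Rightarrow> bool" where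
  "signed_integrable M \<nu> f \<longleftrightarrow>
     integrable (upper_variation M \<nu>) f \<and> integrable (upper_variation M (\<lambda>A. - \<nu> A)) f"

definition signed_integral ::
    "'a measure \<Rightarrow> ('a set \<Rightarrow> real) \<Rightarrow> ('a \<Rightarrow> complex) \<Rightarrow> complex" where
  "signed_integral M \<nu> f =
     (\<integral>z. f z \<partial>upper_variation M \<nu>) - (\<integral>z. f z \<partial>upper_variation M (\<lambda>A. - \<nu> A))"

definition has_complex_integral ::
    "'a measure \<Rightarrow> ('a set \<Rightarrow> complex) \<Rightarrow> ('a \<Rightarrow> complex) \<Rightarrow> complex \<Rightarrow> bool" where
  "has_complex_integral M \<mu> f c \<longleftrightarrow>
     signed_integrable M (\<lambda>A. Re (\<mu> A)) f \<and> signed_integrable M (\<lambda>A. Im (\<mu> A)) f \<and>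
     c = signed_integral M (\<lambda>A. Re (\<mu> A)) f + \<i> * signed_integral M (\<lambda>A. Im (\<mu> A)) f"


section \<open>Semispectral measures\<close>

definition semispectral_measure ::
    "'a::topological_space measure \<Rightarrow> ('a set \<Rightarrow> ('m::chilbert \<Rightarrow>\<^sub>L 'm)) \<Rightarrow> bool" where
  "semispectral_measure M F \<longleftrightarrow>
     (\<forall>A\<in>sets M. positive_operator (F A)) \<and>
     (\<forall>A\<in>sets M. \<forall>B\<in>sets M. A \<inter> B = {} \<longrightarrow> F (A \<union> B) = F A + F B) \<and>
     (\<forall>x y. regular_complex_measure M (\<lambda>A. cinner (blinfun_apply (F A) x) y))"

definition has_weak_integral ::
    "'a measure \<Rightarrow> ('a set \<Rightarrow> ('m::chilbert \<Rightarrow>\<^sub>L 'm)) \<Rightarrow> ('a \<Rightarrow> complex) \<Rightarrow> ('m \<Rightarrow>\<^sub>L 'm) \<Rightarrow> bool" where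
  "has_weak_integral M F f T \<longleftrightarrow>
     (\<forall>x y. has_complex_integral M (\<lambda>A. cinner (blinfun_apply (F A) x) y) f
              (cinner (blinfun_apply T x) y))"


section \<open>Kernels on multi-indices and moments on the unit sphere\<close>

text \<open>
  With \<open>d = CARD('d)\<close>, which is automatically positive, \<open>\<complex>\<^sup>d\<close> is \<^typ>\<open>complex^'d\<close> and
  \<open>\<int>\<^sub>+\<^sup>d\<close> is \<^typ>\<open>nat^'d\<close>; addition of multi-indices is componentwise, and
  \<open>axis j 1\<close> is the multi-index \<open>\<epsilon>\<^sub>j\<close>.
\<close>

definition unit_sphere_borel :: "(complex^'d) measure" where
  "unit_sphere_borel = restrict_space borel (sphere 0 1)"

definition sphere_monomial :: "nat^'d \<Rightarrow> nat^'d \<Rightarrow> complex^'d \<Rightarrow> complex" where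
  "sphere_monomial \<alpha> \<beta> \<zeta> =
     (\<Prod>j\<in>UNIV. (\<zeta> $ j) ^ (\<alpha> $ j)) * (\<Prod>j\<in>UNIV. cnj (\<zeta> $ j) ^ (\<beta> $ j))"

definition moment_representation ::
    "((complex^'d) set \<Rightarrow> ('m::chilbert \<Rightarrow>\<^sub>L 'm)) \<Rightarrow> (nat^'d \<Rightarrow> nat^'d \<Rightarrow> ('m \<Rightarrow>\<^sub>L 'm)) \<Rightarrow> bool" where
  "moment_representation F \<phi> \<longleftrightarrow>
     (\<forall>\<alpha> \<beta>. has_weak_integral unit_sphere_borel F (sphere_monomial \<alpha> \<beta>) (\<phi> \<alpha> \<beta>))"

definition positive_definite_kernel ::
    "('i \<Rightarrow> 'i \<Rightarrow> ('m::chilbert \<Rightarrow>\<^sub>L 'm)) \<Rightarrow> bool" where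
  "positive_definite_kernel \<phi> \<longleftrightarrow>
     (\<forall>A x. finite A \<longrightarrow>
        (\<Sum>\<alpha>\<in>A. \<Sum>\<beta>\<in>A. cinner (blinfun_apply (\<phi> \<alpha> \<beta>) (x \<alpha>)) (x \<beta>)) \<in> \<real>\<^sub>\<ge>\<^sub>0)"

end

theory Submission
  imports Defs
begin

text \<open>
  Fix \<open>x\<close> and regard \<open>\<psi> \<alpha> \<beta> = \<langle>\<phi>(\<alpha>,\<beta>) x, x\<rangle>\<close> as a functional \<open>z\<^sup>\<alpha> (cnj z)\<^sup>\<beta> \<mapsto> \<psi> \<alpha> \<beta>\<close> on
  polynomials. The normalized kernels satisfying (ii) form a compact convex set. Sums of squared
  moduli of holomorphic polynomials are closed under multiplication, which forces the extreme points
  of this set to be multiplicative (as in the Kadison--Dubois theorem), that is, to be evaluations at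
  points of the sphere. Hence \<open>\<psi>\<close> is nonnegative on polynomials that are nonnegative on the sphere, and
  the Stone--Weierstrass and Riesz--Markov theorems give a measure \<open>\<mu>\<^sub>x\<close> with these moments. By
  uniqueness of measures with given moments, polarizing \<open>\<mu>\<^sub>x(A)\<close> in \<open>x\<close> gives a bounded sesquilinear
  form, whose operator is \<open>F(A)\<close>.
\<close>

section \<open>Complex Hilbert spaces\<close>

text \<open>Hypothesis (ii) yields nonnegativity only on squared moduli of holomorphic polynomials,
  whereas the Riesz--Markov theorem asks for it on every polynomial in z and its conjugate that is
  nonnegative on the sphere. Closing this gap is the core of the proof. The spherical identity
  enters it twice: it bounds every entry of \<psi> by \<psi>(0,0), which makes the normalized
  kernels compact, and it turns 4 - |1 + u z_j|^2 into a sum of squared moduli, which allows a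
  kernel to be split. The 4 is the maximum of |1 + u z_j|^2 on the sphere for |u| = 1.

  The scalar measures are obtained for one vector x at a time, with no relation between different x.
  What ties them together is a uniqueness statement for finite complex linear combinations of
  measures: every linear identity between the quadratic forms <\<phi>(\<alpha>,\<beta>) x, x> that
  holds for all indices is inherited by the measures. Additivity, homogeneity, hermitian symmetry
  and the formula on the diagonal all come from this one transfer.\<close>

lemma cinner_add_right: "cinner x (y + z) = cinner x y + cinner x (z :: 'a::chilbert)"
  by (metis cinner_add_left cinner_commute complex_cnj_add)

lemma cinner_scaleC_right: "cinner x (c *\<^sub>C y) = cnj c * cinner x (y :: 'a::chilbert)"
  by (metis cinner_commute cinner_scaleC_left complex_cnj_mult)

lemma cinner_zero_left [simp]: "cinner 0 (y :: 'a::chilbert) = 0"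
  using cinner_add_left[of 0 0 y] by simp

lemma cinner_zero_right [simp]: "cinner y (0 :: 'a::chilbert) = 0"
  using cinner_add_right[of y 0 0] by simp

lemma cinner_minus_left: "cinner (- x) y = - cinner x (y :: 'a::chilbert)"
  using cinner_add_left[of x "- x" y] by (simp add: add_eq_0_iff)

lemma cinner_diff_left: "cinner (x - y) z = cinner x z - cinner y (z :: 'a::chilbert)"
  using cinner_add_left[of x "- y" z] by (simp add: cinner_minus_left)

lemma cinner_scaleR_right: "cinner x (r *\<^sub>R y) = of_real r * cinner x (y :: 'a::chilbert)"
  by (metis cinner_scaleC_right scaleC_of_real complex_cnj_complex_of_real)

lemma cinner_sum_left: "cinner (sum f A) y = (\<Sum>i\<in>A. cinner (f i) (y :: 'a::chilbert))"
  by (induction A rule: infinite_finite_induct) (simp_all add: cinner_add_left)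

lemma cinner_sum_right: "cinner y (sum f A) = (\<Sum>i\<in>A. cinner (y :: 'a::chilbert) (f i))"
  by (induction A rule: infinite_finite_induct) (simp_all add: cinner_add_right)

lemma scaleC_sum_right: "c *\<^sub>C sum f A = (\<Sum>i\<in>A. c *\<^sub>C (f i :: 'a::chilbert))"
proof -
  have "c *\<^sub>C (0 :: 'a) = 0" using scaleC_add_right[of c 0 "0 :: 'a"] by simp
  then show ?thesis
    by (induction A rule: infinite_finite_induct) (simp_all add: scaleC_add_right)
qed

lemma norm_scaleC: "norm (c *\<^sub>C x) = cmod c * norm (x :: 'a::chilbert)"
proof -
  have "complex_of_real ((norm (c *\<^sub>C x))\<^sup>2) = (c * cnj c) * cinner x x"
    by (simp only: cinner_self[symmetric] cinner_scaleC_left cinner_scaleC_right mult.assoc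
        mult.left_commute[of c])
  also have "\<dots> = complex_of_real ((cmod c * norm x)\<^sup>2)"
    by (simp only: cinner_self complex_norm_square[symmetric] of_real_mult[symmetric]
        power_mult_distrib)
  finally have "complex_of_real ((norm (c *\<^sub>C x))\<^sup>2) = complex_of_real ((cmod c * norm x)\<^sup>2)" .
  then have "(norm (c *\<^sub>C x))\<^sup>2 = (cmod c * norm x)\<^sup>2" using of_real_eq_iff by blast
  then show ?thesis by simp
qed

lemma norm_add_square:
  "(norm (x + y))\<^sup>2 = (norm x)\<^sup>2 + (norm (y :: 'a::chilbert))\<^sup>2 + 2 * Re (cinner x y)"
proof -
  have "complex_of_real ((norm (x + y))\<^sup>2) = cinner x x + cinner y y + (cinner x y + cnj (cinner x y))"
    by (simp add: cinner_self[symmetric] cinner_add_left cinner_add_right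
        cinner_commute[of y x] del: of_real_power)
  also have "\<dots> = complex_of_real ((norm x)\<^sup>2 + (norm y)\<^sup>2 + 2 * Re (cinner x y))"
    by (simp add: cinner_self complex_add_cnj)
  finally show ?thesis using of_real_eq_iff by blast
qed

lemma cinner_eqI:
  assumes "\<And>y. cinner x y = cinner (x' :: 'a::chilbert) y"
  shows "x = x'"
proof -
  have "cinner (x - x') (x - x') = 0" using assms by (simp add: cinner_diff_left)
  then show ?thesis by (simp add: cinner_self)
qed

lemma Cauchy_Schwarz_cinner: "cmod (cinner x y) \<le> norm x * norm (y :: 'a::chilbert)"
proof (cases "norm y = 0")
  case False
  define c where "c = - cinner x y / of_real ((norm y)\<^sup>2)"
  have "0 \<le> (norm (x + c *\<^sub>C y))\<^sup>2" by simp
  also have "\<dots> = (norm x)\<^sup>2 + (cmod c * norm y)\<^sup>2 + 2 * Re (cnj c * cinner x y)"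
    by (simp add: norm_add_square norm_scaleC cinner_scaleC_right)
  also have "cnj c * cinner x y = - of_real ((cmod (cinner x y))\<^sup>2 / (norm y)\<^sup>2)"
    by (simp add: c_def complex_norm_square mult.commute del: of_real_power)
  also have "(cmod c * norm y)\<^sup>2 = (cmod (cinner x y))\<^sup>2 / (norm y)\<^sup>2"
  proof -
    have "cmod c = cmod (cinner x y) / (norm y)\<^sup>2"
      unfolding c_def norm_divide norm_minus_cancel norm_of_real by simp
    then show ?thesis using False by (simp add: field_simps power2_eq_square)
  qed
  finally have "(cmod (cinner x y))\<^sup>2 / (norm y)\<^sup>2 \<le> (norm x)\<^sup>2" by simp
  then have "(cmod (cinner x y))\<^sup>2 \<le> (norm x * norm y)\<^sup>2"
    using False by (simp add: field_simps)
  then show ?thesis by (rule power2_le_imp_le) simp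
qed simp

text \<open>Minimizes \<open>J y\<close>, that is |y|^2 - 2 Re f(y), which for the vector z sought
  equals |y - z|^2 - |z|^2. The parallelogram law makes a minimizing sequence Cauchy, and the
  vanishing first variation of \<open>J\<close> at the limit identifies the limit as the
  representing vector.\<close>

lemma frechet_riesz_chilbert:
  fixes f :: "'a::chilbert \<Rightarrow> complex"
  assumes add: "\<And>x y. f (x + y) = f x + f y" and scale: "\<And>c x. f (c *\<^sub>C x) = c * f x"
    and bound: "\<And>x. cmod (f x) \<le> C * norm x" and "0 \<le> C"
  shows "\<exists>z. norm z \<le> C \<and> (\<forall>x. f x = cinner x z)"
proof -
  define J where "J y = (norm y)\<^sup>2 - 2 * Re (f y)" for y
  define m where "m = Inf (range J)"
  have scaleR: "f (r *\<^sub>R x) = of_real r * f x" for r x by (metis scale scaleC_of_real)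
  have "bounded_linear f"
    by (rule bounded_linear_intro[where K = C])
      (use add scaleR bound in \<open>auto simp: mult.commute scaleR_conv_of_real\<close>)
  note cont [tendsto_intros] = bounded_linear.tendsto[OF this]
  have "- (C\<^sup>2) \<le> J y" for y
  proof -
    have "Re (f y) \<le> C * norm y" by (rule order_trans[OF complex_Re_le_cmod bound])
    moreover have "0 \<le> (norm y - C)\<^sup>2" by simp
    ultimately show ?thesis unfolding J_def by (simp add: power2_diff mult.commute)
  qed
  then have bdd: "bdd_below (range J)" by (intro bdd_belowI) auto
  have m_le: "m \<le> J y" for y unfolding m_def by (intro cInf_lower bdd) auto
  have "\<exists>y. J y < m + 1 / Suc n" for n
    using cInf_lessD[of "range J" "m + 1 / Suc n"] by (auto simp: m_def)
  then obtain y where y: "\<And>n. J (y n) < m + 1 / Suc n" by metis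
  have par: "(norm (a - b))\<^sup>2 \<le> 2 * J a + 2 * J b - 4 * m" for a b
  proof -
    have 1: "Re (f ((1/2) *\<^sub>R (a + b))) = (Re (f a) + Re (f b)) / 2"
      unfolding scaleR add by simp
    have 2: "(norm ((1/2) *\<^sub>R (a + b)))\<^sup>2 = (norm (a + b))\<^sup>2 / 4"
      by (simp add: power_divide del: scaleR_right_distrib scaleR_add_right)
    have 3: "Re (cinner a (- b)) = - Re (cinner a b)"
      using cinner_scaleR_right[of a "-1" b] by simp
    show ?thesis
      using m_le[of "(1/2) *\<^sub>R (a + b)"] norm_add_square[of a b] norm_add_square[of a "-b"]
      unfolding J_def 1 2 3 norm_minus_cancel add_uminus_conv_diff by (simp add: field_simps)
  qed
  have "Cauchy y"
  proof (rule metric_CauchyI)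
    fix e :: real assume "e > 0"
    then obtain N where N: "1 / Suc N < e\<^sup>2 / 4"
      using reals_Archimedean[of "e\<^sup>2 / 4"] by (auto simp: inverse_eq_divide)
    have "dist (y j) (y k) < e" if "j \<ge> N" "k \<ge> N" for j k
    proof -
      have *: "J (y i) < m + 1 / Suc N" if "i \<ge> N" for i
      proof -
        have "1 / real (Suc i) \<le> 1 / Suc N" using that by (intro divide_left_mono) simp_all
        then show ?thesis using y[of i] by linarith
      qed
      have "(norm (y j - y k))\<^sup>2 < e\<^sup>2"
        using par[of "y j" "y k"] *[OF that(1)] *[OF that(2)] N by linarith
      then show ?thesis using \<open>e > 0\<close> by (simp add: dist_norm power_less_imp_less_base)
    qed
    then show "\<exists>N. \<forall>j\<ge>N. \<forall>k\<ge>N. dist (y j) (y k) < e" by blast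
  qed
  then obtain z where z: "y \<longlonglongrightarrow> z" using Cauchy_convergent convergent_def by blast
  have "(\<lambda>n. J (y n)) \<longlonglongrightarrow> J z" unfolding J_def by (intro tendsto_intros z)
  moreover have "(\<lambda>n. m + 1 / Suc n) \<longlonglongrightarrow> m + 0"
    by (intro tendsto_intros LIMSEQ_Suc[OF lim_1_over_n])
  ultimately have Jz: "J z \<le> m + 0"
    by (rule LIMSEQ_le) (intro exI allI impI less_imp_le[OF y])
  have Re_eq: "Re (f h) = Re (cinner h z)" for h
  proof (rule ccontr)
    assume *: "Re (f h) \<noteq> Re (cinner h z)"
    \<comment> \<open>\<open>a\<close> is half the derivative of \<open>J\<close> at
      \<open>z\<close> in the direction \<open>h\<close>. The choice \<open>t = - a / n\<close>
      minimizes 2 t a + t^2 n, with value - a^2 / n; the added 1 keeps \<open>n\<close> positive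
      also for \<open>h = 0\<close>.\<close>
    define a where "a = Re (cinner h z) - Re (f h)"
    define n where "n = (norm h)\<^sup>2 + 1"
    define t where "t = - a / n"
    have "Re (cinner z h) = Re (cinner h z)" using cinner_commute[of z h] by simp
    then have "J (z + t *\<^sub>R h) = J z + 2 * t * a + t\<^sup>2 * (norm h)\<^sup>2"
      unfolding J_def by (simp add: norm_add_square cinner_scaleR_right add scaleR a_def
          power_mult_distrib algebra_simps)
    then have ge: "0 \<le> 2 * t * a + t\<^sup>2 * (norm h)\<^sup>2" using m_le[of "z + t *\<^sub>R h"] Jz by linarith
    have pos: "n > 0" by (simp add: n_def add_nonneg_pos)
    have "2 * t * a + t\<^sup>2 * (norm h)\<^sup>2 \<le> 2 * t * a + t\<^sup>2 * n"
      unfolding n_def by (intro add_left_mono mult_left_mono) auto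
    also have "\<dots> = - (a\<^sup>2 / n)"
      using pos by (simp add: t_def power2_eq_square field_simps)
    also have "\<dots> < 0" using pos * by (simp add: a_def)
    finally show False using ge by linarith
  qed
  have eq: "f h = cinner h z" for h
  proof -
    have "Im (f h) = Im (cinner h z)"
      using Re_eq[of "\<i> *\<^sub>C h"] by (simp add: scale cinner_scaleC_left)
    then show ?thesis using Re_eq[of h] by (simp add: complex_eq_iff)
  qed
  have "(norm z)\<^sup>2 \<le> C * norm z" using bound[of z] unfolding eq cinner_self
    by (simp add: norm_power)
  then have "norm z \<le> C \<or> norm z = 0" by (auto simp: power2_eq_square)
  then have "norm z \<le> C" using \<open>0 \<le> C\<close> by auto
  then show ?thesis using eq by auto
qed

text \<open>For fixed \<open>x\<close> the Riesz vector of \<open>y \<mapsto> B y x\<close> is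
  \<open>t x\<close>. Hermitian symmetry turns this into <t x, y> = B x y, so linearity of
  \<open>B\<close> in its first argument becomes linearity of \<open>t\<close>.\<close>

lemma bounded_form_operator:
  fixes B :: "'m::chilbert \<Rightarrow> 'm \<Rightarrow> complex"
  assumes add_left: "\<And>x y z. B (x + y) z = B x z + B y z"
    and scale_left: "\<And>c x y. B (c *\<^sub>C x) y = c * B x y"
    and herm: "\<And>x y. B y x = cnj (B x y)"
    and bound: "\<And>x y. cmod (B x y) \<le> K * norm x * norm y" and "0 \<le> K"
  shows "\<exists>T\<in>bounded_operators. \<forall>x y. cinner (blinfun_apply T x) y = B x y"
proof -
  have "\<exists>z. norm z \<le> K * norm x \<and> (\<forall>y. B y x = cinner y z)" for x
    by (rule frechet_riesz_chilbert)
      (use add_left scale_left bound[of _ x] \<open>0 \<le> K\<close> in \<open>auto simp: mult_ac\<close>)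
  then obtain t where t: "\<And>x. norm (t x) \<le> K * norm x" "\<And>x y. B y x = cinner y (t x)" by metis
  have t': "cinner (t x) y = B x y" for x y
    using cinner_commute[of "t x" y] herm[of y x] by (simp add: t(2)[symmetric])
  have t_add: "t (x + y) = t x + t y" for x y
    by (rule cinner_eqI) (simp add: t' add_left cinner_add_left)
  have t_scale: "t (c *\<^sub>C x) = c *\<^sub>C t x" for c x
    by (rule cinner_eqI) (simp add: t' scale_left cinner_scaleC_left)
  have "t (r *\<^sub>R x) = r *\<^sub>R t x" for r x by (metis t_scale scaleC_of_real)
  then have "bounded_linear t"
    by (intro bounded_linear_intro[where K = K]) (use t(1) t_add in \<open>simp_all add: mult.commute\<close>)
  then show ?thesis
    by (intro bexI[of _ "Blinfun t"])
      (simp_all add: bounded_operators_def bounded_linear_Blinfun_apply t' t_scale)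
qed

text \<open>Both orders of the arguments come from the same four vectors x + i^k y, with conjugate
  coefficients. This pair of formulas later yields hermitian symmetry of a form that is given only
  by its quadratic values.\<close>

lemma polarization:
  assumes "T \<in> bounded_operators"
  shows "cinner (blinfun_apply T x) y =
      (\<Sum>k<4. \<i> ^ k * cinner (blinfun_apply T (x + \<i> ^ k *\<^sub>C y)) (x + \<i> ^ k *\<^sub>C y)) / 4"
    and "cinner (blinfun_apply T y) x =
      (\<Sum>k<4. cnj (\<i> ^ k) * cinner (blinfun_apply T (x + \<i> ^ k *\<^sub>C y)) (x + \<i> ^ k *\<^sub>C y)) / 4"
proof -
  have T: "blinfun_apply T (c *\<^sub>C x) = c *\<^sub>C blinfun_apply T x" for c x
    using assms by (simp add: bounded_operators_def)
  have u: "\<i> ^ k * cnj (\<i> ^ k) = 1" for k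
    by (simp add: complex_norm_square[symmetric] norm_power del: complex_cnj_power)
  define a where "a x y = cinner (blinfun_apply T x) y" for x y
  have expand: "a (x + \<i> ^ k *\<^sub>C y) (x + \<i> ^ k *\<^sub>C y) =
      a x x + cnj (\<i> ^ k) * a x y + \<i> ^ k * a y x + a y y" for k
  proof -
    have "a (x + \<i> ^ k *\<^sub>C y) (x + \<i> ^ k *\<^sub>C y) =
        a x x + cnj (\<i> ^ k) * a x y + \<i> ^ k * a y x + (\<i> ^ k * cnj (\<i> ^ k)) * a y y"
      by (simp add: a_def blinfun.add_right T cinner_add_left cinner_add_right cinner_scaleC_left
          cinner_scaleC_right algebra_simps del: complex_cnj_power)
    then show ?thesis unfolding u by simp
  qed
  have "(\<Sum>k<4. \<i> ^ k * a (x + \<i> ^ k *\<^sub>C y) (x + \<i> ^ k *\<^sub>C y)) = 4 * a x y"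
    unfolding expand by (simp add: eval_nat_numeral algebra_simps)
  then show "cinner (blinfun_apply T x) y =
      (\<Sum>k<4. \<i> ^ k * cinner (blinfun_apply T (x + \<i> ^ k *\<^sub>C y)) (x + \<i> ^ k *\<^sub>C y)) / 4"
    by (simp add: a_def)
  have "(\<Sum>k<4. cnj (\<i> ^ k) * a (x + \<i> ^ k *\<^sub>C y) (x + \<i> ^ k *\<^sub>C y)) = 4 * a y x"
    unfolding expand by (simp add: eval_nat_numeral algebra_simps)
  then show "cinner (blinfun_apply T y) x =
      (\<Sum>k<4. cnj (\<i> ^ k) * cinner (blinfun_apply T (x + \<i> ^ k *\<^sub>C y)) (x + \<i> ^ k *\<^sub>C y)) / 4"
    by (simp add: a_def)
qed

lemma bounded_operators_eqI:
  assumes "S \<in> bounded_operators" "T \<in> bounded_operators"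
    and "\<And>x. cinner (blinfun_apply S x) x = cinner (blinfun_apply T x) x"
  shows "S = T"
proof (rule blinfun_eqI, rule cinner_eqI)
  show "cinner (blinfun_apply S x) y = cinner (blinfun_apply T x) y" for x y
    using polarization(1)[OF assms(1), of x y] polarization(1)[OF assms(2), of x y]
    by (simp only: assms(3))
qed

lemma bounded_operators_add:
  "S \<in> bounded_operators \<Longrightarrow> T \<in> bounded_operators \<Longrightarrow> S + T \<in> bounded_operators"
  by (simp add: bounded_operators_def blinfun.add_left scaleC_add_right)

lemma bounded_operators_sum:
  fixes T :: "'i \<Rightarrow> 'a::chilbert \<Rightarrow>\<^sub>L 'a"
  assumes "\<And>i. i \<in> I \<Longrightarrow> T i \<in> bounded_operators"
  shows "sum T I \<in> bounded_operators"
proof -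
  have "(0 :: 'a::chilbert \<Rightarrow>\<^sub>L 'a) \<in> bounded_operators"
    using scaleC_sum_right[of _ "\<lambda>_. 0 :: 'a" "{} :: nat set"] by (simp add: bounded_operators_def)
  with assms show ?thesis
    by (induction I rule: infinite_finite_induct) (auto intro: bounded_operators_add)
qed

section \<open>The Riesz--Markov theorem on compact metric spaces\<close>

text \<open>A layer-cake identity: the i-th summand is the part of \<open>t\<close> between the
  heights i and i + 1. Applied to N f it cuts a function into N slices with values in
  [0, 1].\<close>

lemma sum_unit_slices:
  "0 \<le> (t::real) \<Longrightarrow> (\<Sum>i<N. min 1 (max 0 (t - real i))) = min t (real N)"
  by (induction N) (auto simp: min_def max_def)

text \<open>Functions are total, but only their behaviour on \<open>X\<close> is constrained:
  applying \<open>nonneg\<close> to differences shows that \<open>L\<close> sees only the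
  restriction to \<open>X\<close> of a function continuous there.\<close>

locale positive_functional =
  fixes X :: "'a::metric_space set" and L :: "('a \<Rightarrow> real) \<Rightarrow> real"
  assumes compact: "compact X"
    and add: "continuous_on X f \<Longrightarrow> continuous_on X g \<Longrightarrow> L (\<lambda>x. f x + g x) = L f + L g"
    and scale: "continuous_on X f \<Longrightarrow> L (\<lambda>x. c * f x) = c * L f"
    and nonneg: "continuous_on X f \<Longrightarrow> (\<And>x. x \<in> X \<Longrightarrow> 0 \<le> f x) \<Longrightarrow> 0 \<le> L f"
begin

lemma zero [simp]: "L (\<lambda>x. 0) = 0"
  using scale[of "\<lambda>_. 0" 0] by simp

lemma diff:
  assumes "continuous_on X f" "continuous_on X g"
  shows "L (\<lambda>x. f x - g x) = L f - L g"
  using add[OF assms(1), of "\<lambda>x. - 1 * g x"] scale[OF assms(2), of "-1"] assms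
  by (simp add: continuous_intros)

lemma mono:
  assumes "continuous_on X f" "continuous_on X g" "\<And>x. x \<in> X \<Longrightarrow> f x \<le> g x"
  shows "L f \<le> L g"
  using nonneg[of "\<lambda>x. g x - f x"] diff[of g f] assms by (simp add: continuous_intros)

lemma const: "L (\<lambda>x. c) = c * L (\<lambda>x. 1)"
  using scale[of "\<lambda>_. 1" c] by simp

lemma sum:
  "(\<And>i. i \<in> I \<Longrightarrow> continuous_on X (f i)) \<Longrightarrow> L (\<lambda>x. \<Sum>i\<in>I. f i x) = (\<Sum>i\<in>I. L (f i))"
  by (induction I rule: infinite_finite_induct) (simp_all add: add continuous_on_sum)

section \<open>The outer measure generated by a positive functional\<close>

definition cover :: "(nat \<Rightarrow> 'a \<Rightarrow> real) \<Rightarrow> 'a set \<Rightarrow> bool" where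
  "cover f A \<longleftrightarrow> (\<forall>n. continuous_on X (f n) \<and> (\<forall>x\<in>X. 0 \<le> f n x)) \<and>
     (\<forall>x\<in>A \<inter> X. 1 \<le> (\<Sum>n. ennreal (f n x)))"

text \<open>A Daniell-type outer measure: sets are covered by series of nonnegative continuous
  functions. Countable subadditivity then amounts to rearranging a double series, and a cover can be
  cut by multiplying it with a continuous function.\<close>

definition outer :: "'a set \<Rightarrow> ennreal" where
  "outer A = (INF f\<in>{f. cover f A}. \<Sum>n. ennreal (L (f n)))"

lemma outer_le: "cover f A \<Longrightarrow> outer A \<le> (\<Sum>n. ennreal (L (f n)))"
  unfolding outer_def by (rule INF_lower) simp

lemma suminf_single: "(\<Sum>n. ennreal (if n = 0 then a else 0)) = ennreal a"
  using suminf_finite[of "{0::nat}" "\<lambda>n. ennreal (if n = 0 then a else 0)"] by simp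

lemma outer_le_single:
  assumes "continuous_on X g" "\<And>x. x \<in> X \<Longrightarrow> 0 \<le> g x" "\<And>x. x \<in> A \<inter> X \<Longrightarrow> 1 \<le> g x"
  shows "outer A \<le> ennreal (L g)"
proof -
  define f where "f = (\<lambda>(n::nat) x. if n = 0 then g x else 0)"
  have f: "f n = (if n = 0 then g else (\<lambda>x. 0))" for n by (auto simp: f_def)
  have sum_eq: "(\<Sum>n. ennreal (F (f n))) = ennreal (F g)" if "F (\<lambda>x. 0) = 0" for F
  proof -
    have "(\<lambda>n. ennreal (F (f n))) = (\<lambda>n. ennreal (if n = 0 then F g else 0))"
      by (rule ext) (simp add: f that)
    then show ?thesis by (simp only: suminf_single)
  qed
  have "cover f A"
    unfolding cover_def
  proof (intro conjI allI ballI)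
    show "continuous_on X (f n)" for n using assms(1) by (simp add: f)
    show "0 \<le> f n x" if "x \<in> X" for n x using assms(2) that by (simp add: f_def)
    show "1 \<le> (\<Sum>n. ennreal (f n x))" if "x \<in> A \<inter> X" for x
      using sum_eq[of "\<lambda>h. h x"] ennreal_leI[OF assms(3)[OF that]] by simp
  qed
  from outer_le[OF this] show ?thesis using sum_eq[of L] by simp
qed

lemma outer_finite: "outer A < top"
  using outer_le_single[of "\<lambda>_. 1" A] by (simp add: le_less_trans ennreal_less_top)

lemma outer_mono: "A \<subseteq> B \<Longrightarrow> outer A \<le> outer B"
  unfolding outer_def by (rule INF_superset_mono) (auto simp: cover_def)

lemma outer_null: "A \<inter> X = {} \<Longrightarrow> outer A = 0"
  using outer_le_single[of "\<lambda>_. 0" A] by simp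

lemma outer_countably_subadditive: "outer (\<Union>i. A i) \<le> (\<Sum>i. outer (A i))"
proof (rule ennreal_le_epsilon)
  fix e :: real assume "0 < e"
  have "\<exists>f. cover f (A i) \<and> (\<Sum>n. ennreal (L (f n))) < outer (A i) + ennreal (e * (1 / 2) ^ Suc i)" for i
  proof -
    have "0 < ennreal (e * (1 / 2) ^ Suc i)" using \<open>0 < e\<close> by simp
    then have "outer (A i) + 0 < outer (A i) + ennreal (e * (1 / 2) ^ Suc i)"
      using outer_finite[of "A i"] by (subst ennreal_add_left_cancel_less) auto
    then have "outer (A i) < outer (A i) + ennreal (e * (1 / 2) ^ Suc i)" by simp
    then show ?thesis unfolding outer_def[of "A i"] by (auto simp: INF_less_iff)
  qed
  then obtain f where f: "\<And>i. cover (f i) (A i)"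
    "\<And>i. (\<Sum>n. ennreal (L (f i n))) < outer (A i) + ennreal (e * (1 / 2) ^ Suc i)"
    by metis
  define g where "g n = (case prod_decode n of (i, j) \<Rightarrow> f i j)" for n
  have gsum: "(\<Sum>n. ennreal (F (g n))) = (\<Sum>i. \<Sum>j. ennreal (F (f i j)))" for F
    unfolding g_def
    using suminf_ennreal_2dimen[of "\<lambda>i. \<Sum>j. ennreal (F (f i j))" "\<lambda>(i, j). ennreal (F (f i j))"]
    by (simp add: case_prod_beta')
  have "cover g (\<Union>i. A i)"
    unfolding cover_def
  proof (intro conjI allI ballI)
    fix n show "continuous_on X (g n)"
      using f(1) by (auto simp: g_def cover_def split: prod.split)
  next
    fix n x assume "x \<in> X" then show "0 \<le> g n x"
      using f(1) by (auto simp: g_def cover_def split: prod.split)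
  next
    fix x assume "x \<in> (\<Union>i. A i) \<inter> X"
    then obtain i where "x \<in> A i \<inter> X" by blast
    then have "1 \<le> (\<Sum>j. ennreal (f i j x))" using f(1)[of i] by (auto simp: cover_def)
    also have "\<dots> \<le> (\<Sum>i. \<Sum>j. ennreal (f i j x))"
      using sum_le_suminf[of "\<lambda>i. \<Sum>j. ennreal (f i j x)" "{i}"] by simp
    also have "\<dots> = (\<Sum>n. ennreal (g n x))" using gsum[of "\<lambda>h. h x"] by simp
    finally show "1 \<le> (\<Sum>n. ennreal (g n x))" .
  qed
  from outer_le[OF this] have "outer (\<Union>i. A i) \<le> (\<Sum>i. \<Sum>j. ennreal (L (f i j)))"
    unfolding gsum .
  also have "\<dots> \<le> (\<Sum>i. outer (A i) + ennreal (e * (1 / 2) ^ Suc i))"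
    using f(2) by (intro suminf_le) (auto simp: less_imp_le)
  also have "\<dots> = (\<Sum>i. outer (A i)) + (\<Sum>i. ennreal (e * (1 / 2) ^ Suc i))"
    by (rule suminf_add[symmetric]) auto
  also have "(\<Sum>i. ennreal (e * (1 / 2) ^ Suc i)) = ennreal (e * 1)"
    by (rule suminf_ennreal_eq[OF _ sums_mult[OF power_half_series]]) (use \<open>0 < e\<close> in simp)
  finally show "outer (\<Union>i. A i) \<le> (\<Sum>i. outer (A i)) + ennreal e" by simp
qed

lemma outer_measure_space_outer: "outer_measure_space UNIV outer"
  unfolding outer_measure_space_def positive_def increasing_def countably_subadditive_def
  using outer_null outer_mono outer_countably_subadditive by auto

lemma outer_Un: "outer (A \<union> B) \<le> outer A + outer B"
proof -
  have "outer (\<Union>i. binaryset A B i) \<le> (\<Sum>i. outer (binaryset A B i))"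
    by (rule outer_countably_subadditive)
  then show ?thesis
    using suminf_binaryset_eq[of outer A B] outer_null[of "{}"] by (simp add: UN_binaryset_eq)
qed

text \<open>Caratheodory's criterion. A cover \<open>f\<close> of \<open>A\<close> is cut by the
  distance cutoffs \<open>h k\<close> into \<open>f * h k\<close>, which covers the part of
  \<open>A\<close> where \<open>h k = 1\<close>, and \<open>f * (1 - h k)\<close>, which covers the
  part of \<open>A\<close> outside \<open>U\<close>. What is lost is the shell of \<open>U\<close>
  where the cutoff is below 1; its outer measure tends to 0.\<close>

lemma open_in_lambda_system:
  assumes "open U"
  shows "U \<in> lambda_system UNIV UNIV outer"
proof (cases "U = UNIV")
  case True
  then show ?thesis using outer_null[of "{}"] by (simp add: lambda_system_def)
next
  case False
  \<comment> \<open>\<open>infdist\<close> to the empty set is 0 by convention, so the cutoffs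
    require a nonempty complement and \<open>U = UNIV\<close> is treated apart.\<close>
  define C where "C = - U"
  have C: "closed C" "C \<noteq> {}" using assms False by (auto simp: C_def)
  define h where "h k x = min 1 (real k * infdist x C)" for k x
  have h_cont: "continuous_on X (h k)" for k unfolding h_def by (intro continuous_intros)
  have h_range: "0 \<le> h k x" "h k x \<le> 1" for k x by (auto simp: h_def infdist_nonneg)
  have h_mono: "h k x \<le> h l x" if "k \<le> l" for k l x
    using that unfolding h_def by (intro min.mono mult_right_mono) (auto simp: infdist_nonneg)
  have h_C: "h k x = 0" if "x \<in> C" for k x using that by (simp add: h_def)
  have h_lim: "(\<lambda>k. h k x) \<longlonglongrightarrow> 1" if "x \<in> U" for x
  proof -
    have pos: "0 < infdist x C"
      using that C in_closed_iff_infdist_zero[of C x] infdist_nonneg[of x C] by (auto simp: C_def less_le)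
    obtain k0 where "1 / infdist x C < real k0" using reals_Archimedean2 by blast
    then have k0: "1 \<le> real k0 * infdist x C" using pos by (simp add: field_simps)
    have "h k x = 1" if "k \<ge> k0" for k
    proof -
      have "real k0 * infdist x C \<le> real k * infdist x C"
        using that by (intro mult_right_mono) (auto simp: infdist_nonneg)
      then show ?thesis using k0 by (simp add: h_def)
    qed
    then show ?thesis by (intro tendsto_eventually) (auto simp: eventually_sequentially)
  qed
  define a where "a k = L (h k)" for k
  have "incseq a" unfolding a_def incseq_def using mono h_cont h_mono by blast
  moreover have "bdd_above (range a)"
    unfolding a_def using mono[OF h_cont, of "\<lambda>_. 1"] h_range by (intro bdd_aboveI2) auto
  ultimately obtain b where b: "a \<longlonglongrightarrow> b" by (meson LIMSEQ_incseq_SUP)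
  have small: "outer (U - {x. h (2 * k) x = 1}) \<le> ennreal (2 * (b - a k))" for k
  proof -
    \<comment> \<open>At points of \<open>U\<close> where \<open>h (2 * k)\<close> is below 1,
      \<open>h k\<close> is at most 1/2. The telescoping series of increments from \<open>k\<close>
      on therefore sums to at least 1/2 there, and the factor 2 raises this to 1. Under
      \<open>L\<close> the same series telescopes to 2 (b - a k).\<close>
    define g where "g m x = 2 * (h (Suc m + k) x - h (m + k) x)" for m x
    have g_nonneg: "0 \<le> g m x" for m x using h_mono[of "m + k" "Suc m + k" x] by (simp add: g_def)
    have g_cont: "continuous_on X (g m)" for m
      unfolding g_def by (intro continuous_intros h_cont)
    have "cover g (U - {x. h (2 * k) x = 1})"
      unfolding cover_def
    proof (intro conjI allI ballI g_cont g_nonneg)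
      fix x assume x: "x \<in> (U - {x. h (2 * k) x = 1}) \<inter> X"
      have "(\<lambda>m. h (Suc m + k) x - h (m + k) x) sums (1 - h (0 + k) x)"
        by (rule telescope_sums) (use x h_lim in \<open>auto intro: LIMSEQ_ignore_initial_segment\<close>)
      from sums_mult[OF this, of 2] have sums: "(\<lambda>m. g m x) sums (2 * (1 - h k x))"
        by (simp add: g_def)
      have "2 * (real k * infdist x C) < 1" using x by (auto simp: h_def min_def split: if_splits)
      then have "h k x \<le> 1/2" by (simp add: h_def)
      then have "ennreal 1 \<le> ennreal (2 * (1 - h k x))" by (intro ennreal_leI) simp
      also have "\<dots> = (\<Sum>m. ennreal (g m x))"
        using sums suminf_ennreal_eq[of "\<lambda>m. g m x"] g_nonneg by metis
      finally show "1 \<le> (\<Sum>m. ennreal (g m x))" by simp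
    qed
    from outer_le[OF this]
    have le: "outer (U - {x. h (2 * k) x = 1}) \<le> (\<Sum>m. ennreal (L (g m)))" .
    have "(\<lambda>m. a (Suc m + k) - a (m + k)) sums (b - a (0 + k))"
      by (rule telescope_sums) (rule LIMSEQ_ignore_initial_segment[OF b])
    from sums_mult[OF this, of 2]
    have *: "(\<lambda>m. 2 * (a (Suc m + k) - a (m + k))) sums (2 * (b - a k))" by simp
    have "(\<lambda>m. L (g m)) sums (2 * (b - a k))"
    proof -
      have "L (g m) = 2 * (a (Suc m + k) - a (m + k))" for m
        unfolding g_def a_def by (subst scale, intro continuous_intros h_cont) (simp add: diff h_cont)
      with * show ?thesis by simp
    qed
    then have "(\<Sum>m. ennreal (L (g m))) = ennreal (2 * (b - a k))"
      using suminf_ennreal_eq nonneg[OF g_cont g_nonneg] by metis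
    with le show ?thesis by simp
  qed
  have "outer (U \<inter> A) + outer ((UNIV - U) \<inter> A) = outer A" for A
  proof (rule antisym)
    show "outer (U \<inter> A) + outer ((UNIV - U) \<inter> A) \<le> outer A"
      unfolding outer_def[of A]
    proof (rule INF_greatest, clarify)
      fix f assume f: "cover f A"
      have fc: "continuous_on X (f n)" and fn: "x \<in> X \<Longrightarrow> 0 \<le> f n x" for n x
        using f by (auto simp: cover_def)
      define s where "s = (\<Sum>n. ennreal (L (f n)))"
      have 1: "outer ({x. h k x = 1} \<inter> A) + outer (C \<inter> A) \<le> s" for k
      proof -
        define f1 where "f1 n x = f n x * h k x" for n x
        define f2 where "f2 n x = f n x * (1 - h k x)" for n x
        have c: "continuous_on X (f1 n)" "continuous_on X (f2 n)" for n
          unfolding f1_def f2_def by (intro continuous_intros fc h_cont)+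
        have nn: "0 \<le> f1 n x" "0 \<le> f2 n x" if "x \<in> X" for n x
          using fn[OF that] h_range[of k x] by (auto simp: f1_def f2_def)
        have "cover f1 ({x. h k x = 1} \<inter> A)" "cover f2 (C \<inter> A)"
          using f c nn h_C unfolding cover_def by (auto simp: f1_def f2_def)
        from add_mono[OF this[THEN outer_le]]
        have "outer ({x. h k x = 1} \<inter> A) + outer (C \<inter> A) \<le>
            (\<Sum>n. ennreal (L (f1 n))) + (\<Sum>n. ennreal (L (f2 n)))" .
        also have "\<dots> = (\<Sum>n. ennreal (L (f1 n)) + ennreal (L (f2 n)))"
          by (rule suminf_add) auto
        also have "(\<lambda>n. ennreal (L (f1 n)) + ennreal (L (f2 n))) = (\<lambda>n. ennreal (L (f n)))"
        proof
          fix n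
          have "L (f1 n) + L (f2 n) = L (\<lambda>x. f1 n x + f2 n x)" using add c by simp
          also have "(\<lambda>x. f1 n x + f2 n x) = f n" by (auto simp: f1_def f2_def algebra_simps)
          finally show "ennreal (L (f1 n)) + ennreal (L (f2 n)) = ennreal (L (f n))"
            using nonneg[OF c(1) nn(1)] nonneg[OF c(2) nn(2)] by (simp flip: ennreal_plus)
        qed
        finally show ?thesis by (simp add: s_def)
      qed
      have 2: "outer (U \<inter> A) + outer (C \<inter> A) \<le> s + ennreal (2 * (b - a k))" for k
      proof -
        have "outer (U \<inter> A) \<le> outer (({x. h (2 * k) x = 1} \<inter> A) \<union> (U - {x. h (2 * k) x = 1}))"
          by (rule outer_mono) auto
        also have "\<dots> \<le> outer ({x. h (2 * k) x = 1} \<inter> A) + ennreal (2 * (b - a k))"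
          by (rule order_trans[OF outer_Un add_left_mono[OF small]])
        finally have "outer (U \<inter> A) + outer (C \<inter> A) \<le>
            outer ({x. h (2 * k) x = 1} \<inter> A) + ennreal (2 * (b - a k)) + outer (C \<inter> A)"
          by (rule add_right_mono)
        also have "\<dots> \<le> s + ennreal (2 * (b - a k))"
          using add_right_mono[OF 1[of "2 * k"], of "ennreal (2 * (b - a k))"] by (simp add: ac_simps)
        finally show ?thesis .
      qed
      have "(\<lambda>k. s + ennreal (2 * (b - a k))) \<longlonglongrightarrow> s + ennreal (2 * (b - b))"
        by (intro tendsto_intros tendsto_ennrealI b)
      then have "outer (U \<inter> A) + outer (C \<inter> A) \<le> s + ennreal (2 * (b - b))"
        by (rule LIMSEQ_le_const) (use 2 in auto)
      then show "outer (U \<inter> A) + outer ((UNIV - U) \<inter> A) \<le> (\<Sum>n. ennreal (L (f n)))"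
        by (simp add: s_def C_def Compl_eq_Diff_UNIV)
    qed
    have "A = (U \<inter> A) \<union> ((UNIV - U) \<inter> A)" by blast
    then show "outer A \<le> outer (U \<inter> A) + outer ((UNIV - U) \<inter> A)"
      using outer_Un[of "U \<inter> A" "(UNIV - U) \<inter> A"] by simp
  qed
  then show ?thesis by (simp add: lambda_system_def)
qed

section \<open>The representing measure and its integrals\<close>

definition representing :: "'a measure" where
  "representing = restrict_space (measure_of UNIV (sets borel) outer) X"

lemma X_borel [measurable]: "X \<in> sets borel"
  using compact by (simp add: borel_closed compact_imp_closed)

lemma sets_measure_of_borel: "sets (measure_of UNIV (sets borel) \<mu>) = sets (borel :: 'a measure)"
  using sets.sigma_sets_eq[of "borel :: 'a measure"] by (simp add: sets_measure_of)

lemma sets_representing: "sets representing = sets (restrict_space borel X)"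
  unfolding representing_def by (intro sets_restrict_space_cong sets_measure_of_borel)

text \<open>The outer measure lives on all subsets of the type and vanishes off \<open>X\<close>, so
  Caratheodory's lemma is applied on the whole type and the restriction to \<open>X\<close> comes
  last. Open sets lie in the lambda system, hence all Borel sets do.\<close>

lemma emeasure_representing:
  assumes "A \<in> sets borel" "A \<subseteq> X"
  shows "emeasure representing A = outer A"
proof -
  have ms: "measure_space UNIV (lambda_system UNIV UNIV outer) outer"
    using sigma_algebra.caratheodory_lemma[OF sigma_algebra_Pow, of UNIV outer]
      outer_measure_space_outer by simp
  then have sa: "sigma_algebra UNIV (lambda_system UNIV UNIV outer)" by (simp add: measure_space_def)
  have sub: "sets borel \<subseteq> lambda_system UNIV UNIV outer"
    unfolding borel_def
    using open_in_lambda_system sigma_algebra.sigma_sets_subset[OF sa, of "{S. open S}"]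
    by (auto simp: sets_measure_of)
  have "emeasure (measure_of UNIV (sets borel) outer) A = outer A"
  proof (rule emeasure_measure_of[OF refl])
    show "sets borel \<subseteq> Pow UNIV" by simp
    show "positive (sets (measure_of UNIV (sets borel) outer)) outer"
      using outer_null[of "{}"] by (simp add: positive_def)
    have "countably_additive (sets borel) outer"
      using ms sub unfolding measure_space_def countably_additive_def by blast
    then show "countably_additive (sets (measure_of UNIV (sets borel) outer)) outer"
      by (simp only: sets_measure_of_borel)
    show "A \<in> sets (measure_of UNIV (sets borel) outer)"
      using assms(1) by (simp only: sets_measure_of_borel)
  qed
  then show ?thesis
    unfolding representing_def using assms X_borel
    by (subst emeasure_restrict_space) (auto simp: sets_measure_of_borel)
qed

lemma space_representing: "space representing = X"
  using sets_eq_imp_space_eq[OF sets_representing] by (simp add: space_restrict_space)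

text \<open>The lower bound is a Dini argument: if for every N the N-th partial sum of a cover
  dropped below 1 - e somewhere on \<open>X\<close>, such points would accumulate at a point where
  all partial sums are at most 1 - e. Control of the total mass later turns a one-sided comparison
  of integrals into equality.\<close>

lemma outer_total: "outer X = ennreal (L (\<lambda>_. 1))"
proof (rule antisym)
  show "outer X \<le> ennreal (L (\<lambda>_. 1))" by (rule outer_le_single) auto
  show "ennreal (L (\<lambda>_. 1)) \<le> outer X"
    unfolding outer_def
  proof (rule INF_greatest, clarify)
    fix f assume f: "cover f X"
    have fc: "continuous_on X (f n)" and fn: "x \<in> X \<Longrightarrow> 0 \<le> f n x" for n x
      using f by (auto simp: cover_def)
    have Lf: "0 \<le> L (f n)" for n by (rule nonneg[OF fc fn])
    define s where "s = (\<Sum>n. ennreal (L (f n)))"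
    have partial: "ennreal (L (\<lambda>x. \<Sum>n<N. f n x)) \<le> s" for N
    proof -
      have "ennreal (L (\<lambda>x. \<Sum>n<N. f n x)) = (\<Sum>n<N. ennreal (L (f n)))"
        by (simp add: sum fc Lf)
      also have "\<dots> \<le> s" unfolding s_def by (intro sum_le_suminf) auto
      finally show ?thesis .
    qed
    have key: "ennreal ((1 - e) * L (\<lambda>_. 1)) \<le> s" if "0 < e" for e
    proof -
      have "\<exists>N. \<forall>x\<in>X. 1 - e \<le> (\<Sum>n<N. f n x)"
      proof (rule ccontr)
        assume "\<nexists>N. \<forall>x\<in>X. 1 - e \<le> (\<Sum>n<N. f n x)"
        then have "\<forall>N. \<exists>x\<in>X. (\<Sum>n<N. f n x) < 1 - e" by (simp add: not_le)
        then obtain y where y: "\<And>N. y N \<in> X" "\<And>N. (\<Sum>n<N. f n (y N)) < 1 - e" by metis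
        obtain x r where x: "x \<in> X" "strict_mono (r :: nat \<Rightarrow> nat)" "(y \<circ> r) \<longlonglongrightarrow> x"
          using compact y(1) unfolding compact_def by metis
        have le: "(\<Sum>n<M. f n x) \<le> 1 - e" for M
        proof (rule LIMSEQ_le_const2)
          show "(\<lambda>i. \<Sum>n<M. f n ((y \<circ> r) i)) \<longlonglongrightarrow> (\<Sum>n<M. f n x)"
            by (intro tendsto_sum continuous_on_tendsto_compose[OF fc x(3) x(1)]) (simp add: y)
          show "\<exists>N. \<forall>i\<ge>N. (\<Sum>n<M. f n ((y \<circ> r) i)) \<le> 1 - e"
          proof (intro exI[of _ M] allI impI)
            fix i assume "M \<le> i"
            then have "M \<le> r i" using seq_suble[OF x(2), of i] by linarith
            then have "(\<Sum>n<M. f n (y (r i))) \<le> (\<Sum>n<r i. f n (y (r i)))"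
              by (intro sum_mono2) (auto intro: fn y)
            with y(2)[of "r i"] show "(\<Sum>n<M. f n ((y \<circ> r) i)) \<le> 1 - e" by simp
          qed
        qed
        have "(\<Sum>n. ennreal (f n x)) \<le> ennreal (1 - e)"
        proof (rule suminf_le_const)
          show "(\<Sum>n<M. ennreal (f n x)) \<le> ennreal (1 - e)" for M
            using ennreal_leI[OF le[of M]] fn[OF x(1)] by simp
        qed simp
        also have "\<dots> < 1" using that by (simp add: ennreal_less_one_iff)
        finally show False using f x(1) by (auto simp: cover_def not_le)
      qed
      then obtain N where N: "\<And>x. x \<in> X \<Longrightarrow> 1 - e \<le> (\<Sum>n<N. f n x)" by blast
      have "L (\<lambda>_. 1 - e) \<le> L (\<lambda>x. \<Sum>n<N. f n x)"
        by (rule mono) (auto intro!: continuous_intros fc N)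
      then have "ennreal ((1 - e) * L (\<lambda>_. 1)) \<le> ennreal (L (\<lambda>x. \<Sum>n<N. f n x))"
        using const[of "1 - e"] by (intro ennreal_leI) simp
      also have "\<dots> \<le> s" by (rule partial)
      finally show ?thesis .
    qed
    have "(\<lambda>i. ennreal ((1 - 1 / real (Suc i)) * L (\<lambda>_. 1))) \<longlonglongrightarrow> ennreal ((1 - 0) * L (\<lambda>_. 1))"
      by (intro tendsto_ennrealI tendsto_intros LIMSEQ_Suc[OF lim_1_over_n])
    then have "ennreal ((1 - 0) * L (\<lambda>_. 1)) \<le> s"
      by (rule LIMSEQ_le_const2) (intro exI[of _ 0] allI impI key, simp)
    then show "ennreal (L (\<lambda>_. 1)) \<le> (\<Sum>n. ennreal (L (f n)))" by (simp add: s_def)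
  qed
qed

lemma finite_measure_representing: "finite_measure representing"
  by (rule finite_measureI)
    (simp add: space_representing emeasure_representing outer_total)

lemma measure_representing: "measure representing X = L (\<lambda>_. 1)"
  using emeasure_representing[of X] nonneg[of "\<lambda>_. 1"] by (simp add: measure_def outer_total)

lemma measurable_representing:
  assumes "continuous_on X f"
  shows "f \<in> borel_measurable representing"
  using borel_measurable_continuous_on_restrict[OF assms] measurable_cong_sets[OF sets_representing refl]
  by blast

lemma integrable_representing:
  fixes f :: "'a \<Rightarrow> real"
  assumes "continuous_on X f"
  shows "integrable representing f"
proof -
  interpret finite_measure representing by (rule finite_measure_representing)
  obtain B where "\<And>x. x \<in> X \<Longrightarrow> norm (f x) \<le> B"
    using compact_imp_bounded[OF compact_continuous_image[OF assms compact]]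
    by (auto simp: bounded_iff)
  then show ?thesis
    by (intro integrable_const_bound[where B = B] measurable_representing assms)
      (auto simp: space_representing)
qed

text \<open>The i-th slice \<open>g i\<close> of N f equals 1 on \<open>E i\<close>, so
  \<open>E i\<close> has measure at most \<open>L (g i)\<close>, while N f - 1 is at most the number
  of sets \<open>E i\<close> containing the point. Summation gives the claim for N f up to the error
  \<open>m\<close>, which is independent of N and disappears after division by N.\<close>

lemma integral_representing_le:
  assumes f: "continuous_on X f" and range: "\<And>x. x \<in> X \<Longrightarrow> 0 \<le> f x" "\<And>x. x \<in> X \<Longrightarrow> f x \<le> 1"
  shows "(\<integral>x. f x \<partial>representing) \<le> L f"
proof -
  interpret finite_measure representing by (rule finite_measure_representing)
  define m where "m = measure representing X"
  have step: "real N * (\<integral>x. f x \<partial>representing) - m \<le> real N * L f" for N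
  proof -
    define g where "g i x = min 1 (max 0 (real N * f x - real i))" for i x
    define E where "E i = {x \<in> X. real (Suc i) \<le> real N * f x}" for i
    have g_cont: "continuous_on X (g i)" for i
      unfolding g_def by (intro continuous_intros f)
    have g_sum: "(\<Sum>i<N. g i x) = real N * f x" if "x \<in> X" for x
    proof -
      have "real N * f x \<le> real N * 1" using range(2)[OF that] by (intro mult_left_mono) auto
      then show ?thesis unfolding g_def by (subst sum_unit_slices) (simp_all add: range that)
    qed
    have E_sets: "E i \<in> sets borel" for i
    proof -
      have "closed (X \<inter> (\<lambda>x. real N * f x) -` {real (Suc i)..})"
        by (intro continuous_closed_preimage compact_imp_closed[OF compact] continuous_intros f)
      moreover have "E i = X \<inter> (\<lambda>x. real N * f x) -` {real (Suc i)..}" by (auto simp: E_def)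
      ultimately show ?thesis by (simp add: borel_closed)
    qed
    have E_sets': "E i \<in> sets representing" for i
      using E_sets by (auto simp: sets_representing sets_restrict_space E_def intro!: image_eqI[of _ _ "E i"])
    have intE: "integrable representing (indicat_real (E i))" for i
      by (rule integrable_real_indicator[OF E_sets']) (simp add: emeasure_eq_measure)
    have mE: "measure representing (E i) \<le> L (g i)" for i
    proof -
      have "emeasure representing (E i) = outer (E i)"
        by (rule emeasure_representing[OF E_sets]) (auto simp: E_def)
      also have "\<dots> \<le> ennreal (L (g i))"
        by (rule outer_le_single[OF g_cont]) (auto simp: g_def E_def)
      finally show ?thesis
        using nonneg[OF g_cont, of i] by (simp add: emeasure_eq_measure g_def)
    qed
    have "real N * (\<integral>x. f x \<partial>representing) - m = (\<integral>x. real N * f x - 1 \<partial>representing)"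
      using integrable_representing[OF f] by (simp add: space_representing m_def)
    also have "\<dots> \<le> (\<integral>x. (\<Sum>i<N. indicat_real (E i) x) \<partial>representing)"
    proof (rule integral_mono)
      fix x assume "x \<in> space representing"
      then have x: "x \<in> X" by (simp add: space_representing)
      have "real N * f x \<le> (\<Sum>i<Suc N. g i x)"
        using g_sum[OF x] by (simp add: g_def)
      also have "\<dots> = g 0 x + (\<Sum>i<N. g (Suc i) x)" by (rule sum.lessThan_Suc_shift)
      \<comment> \<open>Slice 0 is at most 1, which is the 1 subtracted from N f; slice i + 1 is
        positive only on \<open>E i\<close>.\<close>
      also have "\<dots> \<le> 1 + (\<Sum>i<N. indicat_real (E i) x)"
        using x by (intro add_mono sum_mono) (auto simp: g_def E_def indicator_def)
      finally show "real N * f x - 1 \<le> (\<Sum>i<N. indicat_real (E i) x)" by simp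
    qed (use integrable_representing[OF f] intE in simp_all)
    also have "\<dots> = (\<Sum>i<N. measure representing (E i))"
      using E_sets' by (subst Bochner_Integration.integral_sum) (simp_all add: intE sets.Int_space_eq2)
    also have "\<dots> \<le> (\<Sum>i<N. L (g i))" by (intro sum_mono mE)
    also have "\<dots> = L (\<lambda>x. \<Sum>i<N. g i x)" by (rule sum[symmetric]) (rule g_cont)
    also have "\<dots> \<le> L (\<lambda>x. real N * f x)"
      by (rule mono) (auto intro!: continuous_intros g_cont f simp: g_sum)
    also have "\<dots> = real N * L f" by (rule scale[OF f])
    finally show ?thesis .
  qed
  show ?thesis
  proof (rule ccontr)
    assume "\<not> ?thesis"
    then have "0 < (\<integral>x. f x \<partial>representing) - L f" by simp
    then obtain N where "m < real N * ((\<integral>x. f x \<partial>representing) - L f)"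
      using ex_less_of_nat_mult by blast
    with step[of N] show False by (simp add: algebra_simps)
  qed
qed

text \<open>The one-sided inequality for both \<open>g\<close> and \<open>1 - g\<close>, combined
  with equality of the total masses, settles functions with values in [0, 1]; an affine rescaling
  reaches the general case.\<close>

theorem integral_representing:
  assumes f: "continuous_on X f"
  shows "(\<integral>x. f x \<partial>representing) = L f"
proof -
  interpret finite_measure representing by (rule finite_measure_representing)
  have unit: "(\<integral>x. g x \<partial>representing) = L g"
    if g: "continuous_on X g" and "\<And>x. x \<in> X \<Longrightarrow> 0 \<le> g x" "\<And>x. x \<in> X \<Longrightarrow> g x \<le> 1" for g
  proof (rule antisym)
    show "(\<integral>x. g x \<partial>representing) \<le> L g" using that by (rule integral_representing_le)
    have "(\<integral>x. 1 - g x \<partial>representing) \<le> L (\<lambda>x. 1 - g x)"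
      by (rule integral_representing_le) (use that in \<open>auto intro!: continuous_intros\<close>)
    then show "L g \<le> (\<integral>x. g x \<partial>representing)"
      using integrable_representing[OF g] diff[of "\<lambda>_. 1" g] g
      by (simp add: space_representing measure_representing)
  qed
  obtain B where B: "0 < B" "\<And>x. x \<in> X \<Longrightarrow> norm (f x) \<le> B"
    using compact_imp_bounded[OF compact_continuous_image[OF f compact]]
    by (auto simp: bounded_pos)
  define g where "g x = 1 / (2 * B) * (f x + B)" for x
  have g: "continuous_on X g" unfolding g_def by (intro continuous_intros f)
  have "0 \<le> g x \<and> g x \<le> 1" if "x \<in> X" for x
    using B(1) B(2)[OF that] by (simp add: g_def field_simps abs_le_iff)
  then have "(\<integral>x. g x \<partial>representing) = L g" by (intro unit g) auto
  moreover have "(\<integral>x. g x \<partial>representing) = 1 / (2 * B) * ((\<integral>x. f x \<partial>representing) + B * L (\<lambda>_. 1))"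
    unfolding g_def using integrable_representing[OF f]
    by (simp add: space_representing measure_representing)
  moreover have "L g = 1 / (2 * B) * (L f + B * L (\<lambda>_. 1))"
    unfolding g_def by (subst scale) (use f const[of B] in \<open>simp_all add: add continuous_intros\<close>)
  ultimately show ?thesis using B(1) by simp
qed

end

section \<open>The scalar moment problem on the sphere\<close>

type_synonym 'd kernel = "nat^'d \<Rightarrow> nat^'d \<Rightarrow> complex"

text \<open>For multi-indices this is nonnegativity of the associated functional on the squared
  modulus of the holomorphic polynomial with coefficients \<open>c\<close>.\<close>

definition psd_kernel :: "('i \<Rightarrow> 'i \<Rightarrow> complex) \<Rightarrow> bool" where
  "psd_kernel \<psi> \<longleftrightarrow> (\<forall>A c. finite A \<longrightarrow>
     (\<Sum>\<alpha>\<in>A. \<Sum>\<beta>\<in>A. \<psi> \<alpha> \<beta> * c \<alpha> * cnj (c \<beta>)) \<in> \<real>\<^sub>\<ge>\<^sub>0)"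

text \<open>On functionals this is multiplication by |z_j|^2, so \<open>spherical\<close> expresses
  invariance under multiplication by the sum of all |z_j|^2.\<close>

definition shift :: "'d \<Rightarrow> 'd::finite kernel \<Rightarrow> 'd kernel" where
  "shift j \<psi> \<alpha> \<beta> = \<psi> (\<alpha> + axis j 1) (\<beta> + axis j 1)"

definition spherical :: "'d::finite kernel \<Rightarrow> bool" where
  "spherical \<psi> \<longleftrightarrow> (\<forall>\<alpha> \<beta>. (\<Sum>j\<in>UNIV. shift j \<psi> \<alpha> \<beta>) = \<psi> \<alpha> \<beta>)"

text \<open>If \<open>\<psi>\<close> is viewed as the functional \<open>z\<^sup>\<alpha> (cnj z)\<^sup>\<beta> \<mapsto> \<psi> \<alpha> \<beta>\<close> then \<open>bump j u \<psi>\<close> is its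
  product with \<open>\<bar>1 + u z\<^sub>j\<bar>\<^sup>2\<close>.\<close>

definition bump :: "'d \<Rightarrow> complex \<Rightarrow> 'd::finite kernel \<Rightarrow> 'd kernel" where
  "bump j u \<psi> \<alpha> \<beta> = \<psi> \<alpha> \<beta> + u * \<psi> (\<alpha> + axis j 1) \<beta> + cnj u * \<psi> \<alpha> (\<beta> + axis j 1)
     + u * cnj u * \<psi> (\<alpha> + axis j 1) (\<beta> + axis j 1)"

lemma psd_kernelD:
  "psd_kernel \<psi> \<Longrightarrow> finite A \<Longrightarrow> (\<Sum>\<alpha>\<in>A. \<Sum>\<beta>\<in>A. \<psi> \<alpha> \<beta> * c \<alpha> * cnj (c \<beta>)) \<in> \<real>\<^sub>\<ge>\<^sub>0"
  by (simp add: psd_kernel_def)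

text \<open>\<open>g\<close> may repeat values: coefficients with a common index are added up in
  \<open>C\<close>. A product of polynomials can thus be tested before equal monomials are
  collected.\<close>

lemma psd_kernel_family:
  assumes "psd_kernel \<psi>" "finite I"
  shows "(\<Sum>i\<in>I. \<Sum>k\<in>I. \<psi> (g i) (g k) * c i * cnj (c k)) \<in> \<real>\<^sub>\<ge>\<^sub>0"
proof -
  define C where "C \<alpha> = (\<Sum>i\<in>{i\<in>I. g i = \<alpha>}. c i)" for \<alpha>
  have "(\<Sum>i\<in>I. \<Sum>k\<in>I. \<psi> (g i) (g k) * c i * cnj (c k)) =
      (\<Sum>\<alpha>\<in>g ` I. \<Sum>i\<in>{i\<in>I. g i = \<alpha>}. \<Sum>\<beta>\<in>g ` I. \<Sum>k\<in>{k\<in>I. g k = \<beta>}. \<psi> (g i) (g k) * c i * cnj (c k))"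
    by (simp only: sum.image_gen[OF assms(2), of _ g, symmetric])
  also have "\<dots> = (\<Sum>\<alpha>\<in>g ` I. \<Sum>i\<in>{i\<in>I. g i = \<alpha>}. \<Sum>\<beta>\<in>g ` I. \<psi> \<alpha> \<beta> * c i * cnj (C \<beta>))"
    by (intro sum.cong refl) (auto simp: C_def sum_distrib_left)
  also have "\<dots> = (\<Sum>\<alpha>\<in>g ` I. \<Sum>\<beta>\<in>g ` I. \<Sum>i\<in>{i\<in>I. g i = \<alpha>}. \<psi> \<alpha> \<beta> * c i * cnj (C \<beta>))"
    by (intro sum.cong refl sum.swap)
  also have "\<dots> = (\<Sum>\<alpha>\<in>g ` I. \<Sum>\<beta>\<in>g ` I. \<psi> \<alpha> \<beta> * C \<alpha> * cnj (C \<beta>))"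
    by (simp only: C_def sum_distrib_left sum_distrib_right)
  finally show ?thesis using psd_kernelD[OF assms(1) finite_imageI[OF assms(2)]] by simp
qed

lemma psd_kernel_add: "psd_kernel \<psi> \<Longrightarrow> psd_kernel \<rho> \<Longrightarrow> psd_kernel (\<lambda>\<alpha> \<beta>. \<psi> \<alpha> \<beta> + \<rho> \<alpha> \<beta>)"
  unfolding psd_kernel_def by (simp add: distrib_right sum.distrib nonneg_Reals_add_I)

lemma psd_kernel_scale: "psd_kernel \<psi> \<Longrightarrow> 0 \<le> r \<Longrightarrow> psd_kernel (\<lambda>\<alpha> \<beta>. of_real r * \<psi> \<alpha> \<beta>)"
  unfolding psd_kernel_def
  by (simp add: mult.assoc sum_distrib_left[symmetric] nonneg_Reals_mult_I)

lemma psd_kernel_sum: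
  "(\<And>i. i \<in> I \<Longrightarrow> psd_kernel (\<psi> i)) \<Longrightarrow> psd_kernel (\<lambda>\<alpha> \<beta>. \<Sum>i\<in>I. \<psi> i \<alpha> \<beta>)"
  by (induction I rule: infinite_finite_induct) (auto intro: psd_kernel_add simp: psd_kernel_def[of "\<lambda>_ _. 0"])

lemma psd_kernel_shift: "psd_kernel \<psi> \<Longrightarrow> psd_kernel (shift j \<psi>)"
  unfolding psd_kernel_def[of "shift j \<psi>"] shift_def
  by (intro allI impI psd_kernel_family[where g = "\<lambda>\<alpha>. \<alpha> + axis j 1"])

text \<open>Multiplying |p|^2 by |1 + u z_j|^2 gives the squared modulus of (1 + u z_j) p. Its
  coefficients are indexed by pairs, the flag telling whether the term 1 or the term u z_j was
  taken.\<close>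

lemma psd_kernel_bump:
  fixes \<psi> :: "'d::finite kernel"
  assumes "psd_kernel \<psi>"
  shows "psd_kernel (bump j u \<psi>)"
  unfolding psd_kernel_def
proof (intro allI impI)
  fix A :: "(nat^'d) set" and c :: "nat^'d \<Rightarrow> complex" assume "finite A"
  define g where "g = (\<lambda>(\<alpha> :: nat^'d, b). if b then \<alpha> + axis j 1 else \<alpha>)"
  define C where "C = (\<lambda>(\<alpha>, b). if b then u * c \<alpha> else c \<alpha>)"
  have split: "(\<Sum>p\<in>A \<times> UNIV. F p) = (\<Sum>\<alpha>\<in>A. F (\<alpha>, False) + F (\<alpha>, True))" for F :: "_ \<Rightarrow> complex"
    using sum.cartesian_product[of "\<lambda>\<alpha> b. F (\<alpha>, b)" UNIV A] by (simp add: UNIV_bool)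
  have "(\<Sum>\<alpha>\<in>A. \<Sum>\<beta>\<in>A. bump j u \<psi> \<alpha> \<beta> * c \<alpha> * cnj (c \<beta>)) =
     (\<Sum>p\<in>A \<times> UNIV. \<Sum>q\<in>A \<times> UNIV. \<psi> (g p) (g q) * C p * cnj (C q))"
    by (simp add: split g_def C_def bump_def algebra_simps sum.distrib)
  also have "\<dots> \<in> \<real>\<^sub>\<ge>\<^sub>0" by (rule psd_kernel_family[OF assms]) (use \<open>finite A\<close> in simp)
  finally show "(\<Sum>\<alpha>\<in>A. \<Sum>\<beta>\<in>A. bump j u \<psi> \<alpha> \<beta> * c \<alpha> * cnj (c \<beta>)) \<in> \<real>\<^sub>\<ge>\<^sub>0" .
qed

lemma psd_kernel_diag: "psd_kernel \<psi> \<Longrightarrow> \<psi> \<alpha> \<alpha> \<in> \<real>\<^sub>\<ge>\<^sub>0"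
  using psd_kernelD[of \<psi> "{\<alpha>}" "\<lambda>_. 1"] by simp

lemma psd_kernel_pair:
  assumes "psd_kernel \<psi>"
  shows "\<psi> \<alpha> \<alpha> + cnj u * \<psi> \<alpha> \<beta> + u * \<psi> \<beta> \<alpha> + u * cnj u * \<psi> \<beta> \<beta> \<in> \<real>\<^sub>\<ge>\<^sub>0"
  using psd_kernel_family[OF assms, of "UNIV :: bool set" "\<lambda>b. if b then \<beta> else \<alpha>" "\<lambda>b. if b then u else 1"]
  by (simp add: UNIV_bool algebra_simps)

lemma psd_kernel_hermitian:
  assumes "psd_kernel \<psi>"
  shows "\<psi> \<beta> \<alpha> = cnj (\<psi> \<alpha> \<beta>)"
proof -
  have d: "Im (\<psi> \<alpha> \<alpha>) = 0" "Im (\<psi> \<beta> \<beta>) = 0"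
    using psd_kernel_diag[OF assms] by (auto simp: complex_nonneg_Reals_iff)
  have "Im (\<psi> \<alpha> \<beta> + \<psi> \<beta> \<alpha>) = 0" "Re (\<psi> \<beta> \<alpha>) - Re (\<psi> \<alpha> \<beta>) = 0"
    using psd_kernel_pair[OF assms, of \<alpha> 1 \<beta>] psd_kernel_pair[OF assms, of \<alpha> \<i> \<beta>] d
    by (simp_all add: complex_nonneg_Reals_iff)
  then show ?thesis by (simp add: complex_eq_iff)
qed

lemma psd_kernel_bound:
  assumes "psd_kernel \<psi>" "Re (\<psi> \<alpha> \<alpha>) \<le> m" "Re (\<psi> \<beta> \<beta>) \<le> m"
  shows "cmod (\<psi> \<alpha> \<beta>) \<le> m"
proof (cases "\<psi> \<alpha> \<beta> = 0")
  case True
  then show ?thesis using psd_kernel_diag[OF assms(1), of \<alpha>] assms(2) by (auto simp: complex_nonneg_Reals_iff)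
next
  case False
  \<comment> \<open>This phase turns each cross term of \<open>psd_kernel_pair\<close> into minus
    the modulus of the entry, so twice the modulus is at most the sum of the two diagonal
    entries.\<close>
  define u where "u = - \<psi> \<alpha> \<beta> / of_real (cmod (\<psi> \<alpha> \<beta>))"
  have u: "cnj u * \<psi> \<alpha> \<beta> = - of_real (cmod (\<psi> \<alpha> \<beta>))" "u * cnj u = 1"
    using False by (simp_all add: u_def complex_norm_square[symmetric] power2_eq_square field_simps)
  have "u * \<psi> \<beta> \<alpha> = cnj (cnj u * \<psi> \<alpha> \<beta>)"
    using psd_kernel_hermitian[OF assms(1), of \<alpha> \<beta>] by simp
  then show ?thesis
    using psd_kernel_pair[OF assms(1), of \<alpha> u \<beta>] u assms(2,3) by (simp add: complex_nonneg_Reals_iff)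
qed

lemma multi_index_induct [case_names zero step]:
  fixes \<alpha> :: "nat^'d::finite"
  assumes "P 0" "\<And>\<alpha> j. P \<alpha> \<Longrightarrow> P (\<alpha> + axis j 1)"
  shows "P \<alpha>"
proof (induction "\<Sum>j\<in>UNIV. \<alpha> $ j" arbitrary: \<alpha>)
  case 0
  then have "\<alpha> = 0" by (simp add: vec_eq_iff)
  then show ?case using assms(1) by simp
next
  case (Suc n)
  then have "(\<Sum>j\<in>UNIV. \<alpha> $ j) \<noteq> 0" by linarith
  then obtain j where j: "\<alpha> $ j \<noteq> 0" by (meson sum.neutral)
  define \<alpha>' where "\<alpha>' = (\<chi> i. if i = j then \<alpha> $ j - 1 else \<alpha> $ i)"
  have eq: "\<alpha> = \<alpha>' + axis j 1" using j by (auto simp: \<alpha>'_def vec_eq_iff axis_def)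
  have "(\<Sum>i\<in>UNIV. (\<alpha>' + axis j 1) $ i) = (\<Sum>i\<in>UNIV. \<alpha>' $ i) + 1"
    by (simp add: sum.distrib axis_def)
  then have "(\<Sum>i\<in>UNIV. \<alpha> $ i) = (\<Sum>i\<in>UNIV. \<alpha>' $ i) + 1" by (simp only: eq[symmetric])
  with Suc(2) have "P \<alpha>'" by (intro Suc(1)) simp
  with assms(2) eq show ?case by simp
qed

text \<open>The diagonal terms of the spherical identity are nonnegative, so no single shifted entry
  exceeds their total. This is the source of boundedness, and hence of compactness of the normalized
  kernels.\<close>

lemma spherical_diag_le:
  assumes "psd_kernel \<psi>" "spherical \<psi>"
  shows "Re (\<psi> \<alpha> \<alpha>) \<le> Re (\<psi> 0 0)"
proof (induction \<alpha> rule: multi_index_induct)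
  case (step \<alpha> j)
  have "Re (shift j \<psi> \<alpha> \<alpha>) \<le> (\<Sum>i\<in>UNIV. Re (shift i \<psi> \<alpha> \<alpha>))"
    using psd_kernel_diag[OF psd_kernel_shift[OF assms(1)]]
    by (intro member_le_sum) (auto simp: complex_nonneg_Reals_iff)
  also have "\<dots> = Re (\<psi> \<alpha> \<alpha>)" using assms(2) by (metis Re_sum spherical_def)
  finally show ?case using step by (simp add: shift_def)
qed simp

lemma spherical_bound:
  "psd_kernel \<psi> \<Longrightarrow> spherical \<psi> \<Longrightarrow> cmod (\<psi> \<alpha> \<beta>) \<le> Re (\<psi> 0 0)"
  by (intro psd_kernel_bound spherical_diag_le)

lemma spherical_bump: "spherical \<psi> \<Longrightarrow> spherical (bump j u \<psi>)"
proof -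
  assume \<psi>: "spherical \<psi>"
  have eq: "(\<Sum>i\<in>UNIV. \<psi> (\<alpha> + axis i 1) (\<beta> + axis i 1)) = \<psi> \<alpha> \<beta>" for \<alpha> \<beta>
    using \<psi> by (simp add: spherical_def shift_def)
  have "shift i (bump j u \<psi>) \<alpha> \<beta> = \<psi> (\<alpha> + axis i 1) (\<beta> + axis i 1)
      + u * \<psi> ((\<alpha> + axis j 1) + axis i 1) (\<beta> + axis i 1)
      + cnj u * \<psi> (\<alpha> + axis i 1) ((\<beta> + axis j 1) + axis i 1)
      + u * cnj u * \<psi> ((\<alpha> + axis j 1) + axis i 1) ((\<beta> + axis j 1) + axis i 1)" for i \<alpha> \<beta>
    by (simp add: shift_def bump_def add_ac)
  then show "spherical (bump j u \<psi>)"
    unfolding spherical_def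
    by (simp only: sum.distrib sum_distrib_left[symmetric] eq) (simp add: bump_def)
qed

lemma spherical_lincomb:
  "spherical \<psi> \<Longrightarrow> spherical \<rho> \<Longrightarrow> spherical (\<lambda>\<alpha> \<beta>. a * \<psi> \<alpha> \<beta> + b * \<rho> \<alpha> \<beta>)"
  unfolding spherical_def shift_def by (simp add: sum.distrib sum_distrib_left[symmetric])

text \<open>For |u| = 1 the parallelogram law gives 4 - |1 + u z_j|^2 = |1 - u z_j|^2 + 2 (1 -
  |z_j|^2), and the spherical identity replaces 1 - |z_j|^2 by the sum of the other |z_i|^2.\<close>

lemma psd_kernel_bump_compl:
  assumes "psd_kernel \<psi>" "spherical \<psi>" "cmod u = 1"
  shows "psd_kernel (\<lambda>\<alpha> \<beta>. 4 * \<psi> \<alpha> \<beta> - bump j u \<psi> \<alpha> \<beta>)"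
proof -
  have u: "u * cnj u = 1" using assms(3) by (simp add: complex_norm_square[symmetric])
  have eq: "4 * \<psi> \<alpha> \<beta> - bump j u \<psi> \<alpha> \<beta> =
      bump j (-u) \<psi> \<alpha> \<beta> + of_real 2 * (\<Sum>i\<in>UNIV - {j}. shift i \<psi> \<alpha> \<beta>)" for \<alpha> \<beta>
  proof -
    have "\<psi> \<alpha> \<beta> = shift j \<psi> \<alpha> \<beta> + (\<Sum>i\<in>UNIV - {j}. shift i \<psi> \<alpha> \<beta>)"
      using assms(2) sum.remove[of UNIV j "\<lambda>i. shift i \<psi> \<alpha> \<beta>"] by (simp add: spherical_def)
    then show ?thesis using u by (simp add: bump_def shift_def)
  qed
  show ?thesis
    unfolding eq
    by (intro psd_kernel_add psd_kernel_bump psd_kernel_scale psd_kernel_sum psd_kernel_shift assms) simp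
qed

section \<open>The compact set of normalized spherical kernels\<close>

definition states :: "'d::finite kernel set" where
  "states = {\<psi>. psd_kernel \<psi> \<and> spherical \<psi> \<and> \<psi> 0 0 = 1}"

lemma states_bound: "\<psi> \<in> states \<Longrightarrow> cmod (\<psi> \<alpha> \<beta>) \<le> 1"
  using spherical_bound[of \<psi> \<alpha> \<beta>] by (simp add: states_def)

lemma normalize_state:
  assumes "psd_kernel \<psi>" "spherical \<psi>" "\<psi> 0 0 \<noteq> 0"
  shows "(\<lambda>\<alpha> \<beta>. \<psi> \<alpha> \<beta> / \<psi> 0 0) \<in> states"
proof -
  have r: "\<psi> 0 0 = of_real (Re (\<psi> 0 0))" "0 < Re (\<psi> 0 0)"
    using psd_kernel_diag[OF assms(1), of 0] assms(3)
    by (auto simp: complex_nonneg_Reals_iff complex_eq_iff)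
  have "(\<lambda>\<alpha> \<beta>. \<psi> \<alpha> \<beta> / \<psi> 0 0) = (\<lambda>\<alpha> \<beta>. of_real (1 / Re (\<psi> 0 0)) * \<psi> \<alpha> \<beta>)"
    by (subst r(1)) simp
  moreover have "psd_kernel (\<lambda>\<alpha> \<beta>. of_real (1 / Re (\<psi> 0 0)) * \<psi> \<alpha> \<beta>)"
    using r by (intro psd_kernel_scale assms) simp
  moreover have "spherical (\<lambda>\<alpha> \<beta>. of_real (1 / Re (\<psi> 0 0)) * \<psi> \<alpha> \<beta>)"
    using spherical_lincomb[OF assms(2,2), of "of_real (1 / Re (\<psi> 0 0))" 0] by simp
  ultimately have "psd_kernel (\<lambda>\<alpha> \<beta>. \<psi> \<alpha> \<beta> / \<psi> 0 0)" "spherical (\<lambda>\<alpha> \<beta>. \<psi> \<alpha> \<beta> / \<psi> 0 0)"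
    by (simp_all only:)
  then show ?thesis using assms(3) by (simp add: states_def)
qed

lemma continuous_on_kernel_entry: "continuous_on UNIV (\<lambda>\<psi> :: 'i \<Rightarrow> 'j \<Rightarrow> complex. \<psi> \<alpha> \<beta>)"
  by (rule continuous_on_product_then_coordinatewise) simp

lemma compact_Pi: "(\<And>i. compact (S i)) \<Longrightarrow> compact {f :: 'i \<Rightarrow> 'b::topological_space. \<forall>i. f i \<in> S i}"
  using compactin_PiE[of "\<lambda>_. euclidean :: 'b topology" UNIV S]
  by (simp add: euclidean_product_topology PiE_UNIV_domain Pi_def)

text \<open>The defining conditions are closed under pointwise convergence and
  \<open>states_bound\<close> puts every entry into the closed unit disc, so Tychonoff's theorem
  applies; it is used twice because kernels are curried.\<close>

lemma compact_states: "compact (states :: 'd::finite kernel set)"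
proof -
  note [continuous_intros] = continuous_on_subset[OF continuous_on_kernel_entry subset_UNIV]
  have nonneg: "closed {\<psi> :: 'd kernel. f \<psi> \<in> \<real>\<^sub>\<ge>\<^sub>0}" if "continuous_on UNIV f" for f :: "'d kernel \<Rightarrow> complex"
    using closed_vimage[OF closed_nonneg_Reals_complex that] by (simp add: vimage_def)
  have "closed {\<psi> :: 'd kernel. psd_kernel \<psi>}"
    unfolding psd_kernel_def
    by (intro closed_Collect_all closed_Collect_imp open_Collect_const nonneg continuous_intros)
  moreover have "closed {\<psi> :: 'd kernel. spherical \<psi>}"
    unfolding spherical_def shift_def by (intro closed_Collect_all closed_Collect_eq continuous_intros)
  moreover have "closed {\<psi> :: 'd kernel. \<psi> 0 0 = 1}"
    by (intro closed_Collect_eq continuous_intros)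
  ultimately have "closed (states :: 'd kernel set)"
    unfolding states_def Collect_conj_eq by (intro closed_Int)
  moreover have "compact {\<psi> :: 'd kernel. \<forall>\<alpha>. \<psi> \<alpha> \<in> {f. \<forall>\<beta>. f \<beta> \<in> cball 0 1}}"
    by (intro compact_Pi compact_cball)
  ultimately have "compact ({\<psi> :: 'd kernel. \<forall>\<alpha>. \<psi> \<alpha> \<in> {f. \<forall>\<beta>. f \<beta> \<in> cball 0 1}} \<inter> states)"
    by (rule compact_Int_closed[rotated])
  moreover have "{\<psi> :: 'd kernel. \<forall>\<alpha>. \<psi> \<alpha> \<in> {f. \<forall>\<beta>. f \<beta> \<in> cball 0 1}} \<inter> states = states"
    using states_bound by auto
  ultimately show ?thesis by simp
qed

text \<open>A strictly convex continuous function on the set of states; its maximiser over a compact face is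
  an extreme point, which replaces an appeal to the Krein--Milman theorem.\<close>

definition energy :: "'d::finite kernel \<Rightarrow> real" where
  "energy \<psi> = (\<Sum>n. (1 / 2) ^ n * (cmod (case_prod \<psi> (from_nat n)))\<^sup>2)"

lemma states_bound_square: "\<psi> \<in> states \<Longrightarrow> (cmod (case p of (\<alpha>, \<beta>) \<Rightarrow> \<psi> \<alpha> \<beta>))\<^sup>2 \<le> 1"
  by (cases p) (simp add: states_bound power_le_one)

lemma continuous_on_energy: "continuous_on states energy"
proof -
  have "uniform_limit states (\<lambda>N \<psi>. \<Sum>n<N. (1 / 2) ^ n * (cmod (case_prod \<psi> (from_nat n)))\<^sup>2)
      (\<lambda>\<psi>. \<Sum>n. (1 / 2) ^ n * (cmod (case_prod \<psi> (from_nat n)))\<^sup>2) sequentially"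
    by (rule Weierstrass_m_test[where M = "\<lambda>n. (1 / 2) ^ n"])
       (auto intro!: states_bound_square summable_geometric)
  moreover have "continuous_on states (\<lambda>\<psi>. \<Sum>n<N. (1 / 2) ^ n * (cmod (case_prod \<psi> (from_nat n)))\<^sup>2)" for N
    unfolding case_prod_beta
    by (intro continuous_intros continuous_on_subset[OF continuous_on_kernel_entry subset_UNIV])
  ultimately show ?thesis
    unfolding energy_def by (intro uniform_limit_theorem[OF always_eventually]) auto
qed

lemma cmod_convex_square:
  "(cmod (of_real t * a + of_real (1 - t) * b))\<^sup>2 =
     t * (cmod a)\<^sup>2 + (1 - t) * (cmod b)\<^sup>2 - t * (1 - t) * (cmod (a - b))\<^sup>2"
  unfolding cmod_power2 by (simp add: power2_eq_square algebra_simps)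

text \<open>\<open>cmod_convex_square\<close> gives the exact convexity defect t (1 - t) |a - b|^2
  of each entry. If the mixture has at least the energy of both components, the weighted sum of
  these defects is at most 0, so all entries agree; \<open>from_nat\<close> reaches every pair of
  multi-indices.\<close>

lemma energy_strictly_convex:
  assumes \<psi>: "\<psi>1 \<in> states" "\<psi>2 \<in> states" and t: "0 < t" "t < 1"
    and le: "energy \<psi>1 \<le> energy \<psi>" "energy \<psi>2 \<le> energy \<psi>"
    and eq: "\<And>\<alpha> \<beta>. \<psi> \<alpha> \<beta> = of_real t * \<psi>1 \<alpha> \<beta> + of_real (1 - t) * \<psi>2 \<alpha> \<beta>"
  shows "\<psi>1 = \<psi>2"
proof -
  define w where "w n \<rho> = (1 / 2) ^ n * (cmod (case_prod \<rho> (from_nat n)))\<^sup>2" for n and \<rho> :: "'a kernel"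
  define \<delta> where "\<delta> \<alpha> \<beta> = \<psi>1 \<alpha> \<beta> - \<psi>2 \<alpha> \<beta>" for \<alpha> \<beta>
  have s: "summable (\<lambda>n. w n \<psi>1)" "summable (\<lambda>n. w n \<psi>2)"
    unfolding w_def using \<psi>
    by (auto intro!: summable_comparison_test'[OF summable_geometric[of "1/2 :: real"]] states_bound_square)
  have w: "w n \<psi> = t * w n \<psi>1 + (1 - t) * w n \<psi>2 - t * (1 - t) * w n \<delta>" for n
    unfolding w_def case_prod_beta eq \<delta>_def cmod_convex_square by (simp add: algebra_simps)
  have d: "w n \<delta> = (t * w n \<psi>1 + (1 - t) * w n \<psi>2 - w n \<psi>) / (t * (1 - t))" for n
    using t by (simp add: w)
  have "w n \<psi> \<le> t * w n \<psi>1 + (1 - t) * w n \<psi>2" for n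
    unfolding w using t by (simp add: w_def)
  then have "summable (\<lambda>n. w n \<psi>)"
    by (intro summable_comparison_test'[OF summable_add[OF summable_mult[OF s(1)] summable_mult[OF s(2)]]])
       (simp add: w_def)
  then have sums: "(\<lambda>n. w n \<delta>) sums ((t * energy \<psi>1 + (1 - t) * energy \<psi>2 - energy \<psi>) / (t * (1 - t)))"
    unfolding d energy_def w_def[symmetric]
    by (intro sums_divide sums_diff sums_add sums_mult summable_sums s)
  have "t * energy \<psi>1 + (1 - t) * energy \<psi>2 \<le> t * energy \<psi> + (1 - t) * energy \<psi>"
    using le t by (intro add_mono mult_left_mono) auto
  then have "suminf (\<lambda>n. w n \<delta>) \<le> 0"
    using sums t by (simp add: sums_iff divide_le_0_iff mult_pos_pos algebra_simps)
  moreover have "0 \<le> w n \<delta>" for n by (simp add: w_def)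
  ultimately have "w n \<delta> = 0" for n
    using suminf_eq_zero_iff[of "\<lambda>n. w n \<delta>"] sums suminf_nonneg[of "\<lambda>n. w n \<delta>"]
    by (auto simp: sums_iff intro: antisym)
  then have "case_prod \<delta> (from_nat n) = 0" for n by (simp add: w_def)
  then have "case_prod \<delta> (\<alpha>, \<beta>) = 0" for \<alpha> \<beta> by (metis from_nat_to_nat)
  then show ?thesis by (auto simp: \<delta>_def fun_eq_iff)
qed

section \<open>Monomials on the sphere and extreme states\<close>

lemma sphere_monomial_0 [simp]: "sphere_monomial 0 0 z = 1"
  by (simp add: sphere_monomial_def)

lemma prod_power_axis: "(\<Prod>i\<in>UNIV. (f i :: complex) ^ ((\<alpha> + axis j 1) $ i)) = f j * (\<Prod>i\<in>UNIV. f i ^ (\<alpha> $ i))"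
  for \<alpha> :: "nat^'d::finite"
proof -
  have "(\<Prod>i\<in>UNIV. f i ^ (axis j 1 $ i)) = f j"
    by (simp add: axis_def if_distrib cong: if_cong)
  then show ?thesis by (simp add: power_add prod.distrib mult.commute)
qed

lemma sphere_monomial_Suc:
  "sphere_monomial (\<alpha> + axis j 1) \<beta> z = z $ j * sphere_monomial \<alpha> \<beta> z"
  "sphere_monomial \<alpha> (\<beta> + axis j 1) z = cnj (z $ j) * sphere_monomial \<alpha> \<beta> z"
  unfolding sphere_monomial_def prod_power_axis by simp_all

lemma sphere_monomial_add:
  "sphere_monomial (\<alpha> + \<alpha>') (\<beta> + \<beta>') z = sphere_monomial \<alpha> \<beta> z * sphere_monomial \<alpha>' \<beta>' z"
  by (simp add: sphere_monomial_def power_add prod.distrib)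

text \<open>An extreme state is multiplicative: \<open>\<bar>1 + u z\<^sub>j\<bar>\<^sup>2\<close> and \<open>4 - \<bar>1 + u z\<^sub>j\<bar>\<^sup>2\<close> (for \<open>\<bar>u\<bar> = 1\<close>) are both
  sums of squared moduli of holomorphic polynomials on the sphere, so multiplying by them splits the
  state into a convex combination of two states.\<close>

lemma extreme_state_evaluation:
  assumes \<psi>: "\<psi> \<in> states"
    and extreme: "\<And>\<psi>1 \<psi>2 t. \<lbrakk>\<psi>1 \<in> states; \<psi>2 \<in> states; 0 < t; t < 1;
      \<And>\<alpha> \<beta>. \<psi> \<alpha> \<beta> = of_real t * \<psi>1 \<alpha> \<beta> + of_real (1 - t) * \<psi>2 \<alpha> \<beta>\<rbrakk> \<Longrightarrow> \<psi>1 = \<psi>2"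
  shows "\<exists>z\<in>sphere 0 1. \<forall>\<alpha> \<beta>. \<psi> \<alpha> \<beta> = sphere_monomial \<alpha> \<beta> z"
proof -
  have p: "psd_kernel \<psi>" "spherical \<psi>" "\<psi> 0 0 = 1" using \<psi> by (auto simp: states_def)
  have mult: "bump j u \<psi> \<alpha> \<beta> = bump j u \<psi> 0 0 * \<psi> \<alpha> \<beta>" if u: "cmod u = 1" for j u \<alpha> \<beta>
  proof -
    define \<psi>1 where "\<psi>1 = bump j u \<psi>"
    define \<psi>2 where "\<psi>2 = (\<lambda>\<alpha> \<beta>. 4 * \<psi> \<alpha> \<beta> - bump j u \<psi> \<alpha> \<beta>)"
    have p1: "psd_kernel \<psi>1" "spherical \<psi>1"
      unfolding \<psi>1_def by (intro psd_kernel_bump spherical_bump p)+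
    have p2: "psd_kernel \<psi>2" "spherical \<psi>2"
      unfolding \<psi>2_def using psd_kernel_bump_compl[OF p(1,2) u]
        spherical_lincomb[OF p(2) spherical_bump[OF p(2)], of 4 "-1"] by simp_all
    have zero: "\<rho> \<alpha> \<beta> = 0" if "psd_kernel \<rho>" "spherical \<rho>" "\<rho> 0 0 = 0" for \<rho> :: "'a kernel" and \<alpha> \<beta>
      using spherical_bound[OF that(1,2), of \<alpha> \<beta>] that(3) by simp
    have sum: "4 * \<psi> \<alpha> \<beta> = \<psi>1 \<alpha> \<beta> + \<psi>2 \<alpha> \<beta>" for \<alpha> \<beta> by (simp add: \<psi>1_def \<psi>2_def)
    \<comment> \<open>The share of \<psi>1 in the total mass 4 of 4 \<psi>, that is, the weight with
      which \<psi> is a mixture of the two normalized kernels. For \<open>t = 0\<close> or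
      \<open>t = 1\<close> one of the kernels has no mass and vanishes by
      \<open>spherical_bound\<close>.\<close>
    define t where "t = Re (\<psi>1 0 0) / 4"
    have t1: "\<psi>1 0 0 = of_real (4 * t)" and "0 \<le> t"
      using psd_kernel_diag[OF p1(1), of 0] by (auto simp: t_def complex_nonneg_Reals_iff complex_eq_iff)
    have t2: "\<psi>2 0 0 = of_real (4 * (1 - t))" using t1 by (simp add: \<psi>1_def \<psi>2_def p(3))
    have "t \<le> 1"
      using psd_kernel_diag[OF p2(1), of 0] unfolding t2 by (simp add: complex_nonneg_Reals_iff)
    consider "t = 0" | "t = 1" | "0 < t" "t < 1" using \<open>0 \<le> t\<close> \<open>t \<le> 1\<close> by linarith
    then have "\<psi>1 \<alpha> \<beta> = of_real (4 * t) * \<psi> \<alpha> \<beta>"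
    proof cases
      case 1
      then show ?thesis using zero[OF p1] t1 by simp
    next
      case 2
      then show ?thesis using zero[OF p2] t2 sum[of \<alpha> \<beta>] by simp
    next
      case 3
      have "(\<lambda>\<alpha> \<beta>. \<psi>1 \<alpha> \<beta> / \<psi>1 0 0) = (\<lambda>\<alpha> \<beta>. \<psi>2 \<alpha> \<beta> / \<psi>2 0 0)"
      proof (rule extreme[OF normalize_state[OF p1] normalize_state[OF p2] 3])
        show "\<psi>1 0 0 \<noteq> 0" "\<psi>2 0 0 \<noteq> 0" using 3 by (simp_all add: t1 t2)
        show "\<psi> \<alpha> \<beta> = of_real t * (\<psi>1 \<alpha> \<beta> / \<psi>1 0 0) + of_real (1 - t) * (\<psi>2 \<alpha> \<beta> / \<psi>2 0 0)" for \<alpha> \<beta>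
        proof -
          have "of_real t * (\<psi>1 \<alpha> \<beta> / \<psi>1 0 0) = \<psi>1 \<alpha> \<beta> / 4"
            "of_real (1 - t) * (\<psi>2 \<alpha> \<beta> / \<psi>2 0 0) = \<psi>2 \<alpha> \<beta> / 4"
            using 3 unfolding t1 t2 of_real_mult by (simp_all del: of_real_diff)
          then show ?thesis using sum[of \<alpha> \<beta>] by (simp only: add_divide_distrib[symmetric]) (simp add: mult.commute)
        qed
      qed
      then have "\<psi>1 \<alpha> \<beta> / \<psi>1 0 0 = \<psi>2 \<alpha> \<beta> / \<psi>2 0 0" by meson
      then have e: "\<psi>2 \<alpha> \<beta> * of_real t = \<psi>1 \<alpha> \<beta> * of_real (1 - t)"
        using 3 unfolding t1 t2 of_real_mult by (simp add: field_simps del: of_real_diff)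
      then have "\<psi>1 \<alpha> \<beta> = of_real t * (\<psi>1 \<alpha> \<beta> + \<psi>2 \<alpha> \<beta>)"
        by (simp add: algebra_simps)
      then show ?thesis unfolding sum[symmetric] by simp
    qed
    then show ?thesis using t1 by (simp add: \<psi>1_def)
  qed
  \<comment> \<open>Comparing u with -u cancels the constant and the |z_j|^2 terms of
    \<open>bump\<close> and leaves twice the two mixed terms.\<close>
  have half: "u * \<psi> (\<alpha> + axis j 1) \<beta> + cnj u * \<psi> \<alpha> (\<beta> + axis j 1) =
      (u * \<psi> (axis j 1) 0 + cnj u * \<psi> 0 (axis j 1)) * \<psi> \<alpha> \<beta>" if u: "cmod u = 1" for u j \<alpha> \<beta>
  proof -
    have "bump j u \<psi> \<alpha> \<beta> - bump j (-u) \<psi> \<alpha> \<beta> = (bump j u \<psi> 0 0 - bump j (-u) \<psi> 0 0) * \<psi> \<alpha> \<beta>"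
      using mult[of u j \<alpha> \<beta>] mult[of "-u" j \<alpha> \<beta>] u by (simp add: algebra_simps)
    then have "2 * (u * \<psi> (\<alpha> + axis j 1) \<beta> + cnj u * \<psi> \<alpha> (\<beta> + axis j 1)) =
        2 * ((u * \<psi> (axis j 1) 0 + cnj u * \<psi> 0 (axis j 1)) * \<psi> \<alpha> \<beta>)"
      by (simp add: bump_def algebra_simps)
    then show ?thesis by (rule mult_left_cancel[THEN iffD1, rotated]) simp
  qed
  \<comment> \<open>u = 1 gives the sum of the two terms and u = i gives i times their difference,
    which separates them.\<close>
  have step: "\<psi> (\<alpha> + axis j 1) \<beta> = \<psi> (axis j 1) 0 * \<psi> \<alpha> \<beta>"
    "\<psi> \<alpha> (\<beta> + axis j 1) = \<psi> 0 (axis j 1) * \<psi> \<alpha> \<beta>" for \<alpha> \<beta> j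
    using half[of 1 \<alpha> j \<beta>] half[of \<i> \<alpha> j \<beta>]
    by (auto simp: algebra_simps complex_eq_iff)
  define z where "z = (\<chi> j. \<psi> (axis j 1) 0)"
  have z: "\<psi> \<alpha> \<beta> = sphere_monomial \<alpha> \<beta> z" for \<alpha> \<beta>
  proof (induction \<beta> rule: multi_index_induct)
    case zero
    show ?case
    proof (induction \<alpha> rule: multi_index_induct)
      case (step \<alpha> j)
      then show ?case by (simp add: \<open>\<And>\<alpha> \<beta> j. \<psi> (\<alpha> + axis j 1) \<beta> = _\<close> sphere_monomial_Suc z_def del: One_nat_def)
    qed (simp add: p(3))
  next
    case (step \<beta> j)
    then show ?case
      using psd_kernel_hermitian[OF p(1), of 0 "axis j 1"]
      by (simp add: \<open>\<And>\<alpha> \<beta> j. \<psi> \<alpha> (\<beta> + axis j 1) = _\<close> sphere_monomial_Suc z_def del: One_nat_def)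
  qed
  have "(\<Sum>j\<in>UNIV. shift j \<psi> 0 0) = 1" using p by (simp add: spherical_def)
  then have "(\<Sum>j\<in>UNIV. complex_of_real ((cmod (z $ j))\<^sup>2)) = 1"
    unfolding shift_def z sphere_monomial_Suc complex_norm_square by (simp add: mult.commute)
  then have "(\<Sum>j\<in>UNIV. (cmod (z $ j))\<^sup>2) = 1"
    unfolding of_real_sum[symmetric] using of_real_eq_1_iff by blast
  then have "z \<in> sphere 0 1" by (simp add: norm_vec_def L2_set_def)
  with z show ?thesis by blast
qed

text \<open>The second argument maps a kernel, viewed as a functional, to its value on the polynomial. It is
  carried along so that the uniqueness of the coefficients of a polynomial function is never needed.\<close>

inductive mpoly :: "(complex^'d \<Rightarrow> complex) \<Rightarrow> ('d::finite kernel \<Rightarrow> complex) \<Rightarrow> bool" where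
  monomial: "mpoly (sphere_monomial \<alpha> \<beta>) (\<lambda>\<psi>. \<psi> \<alpha> \<beta>)"
| add: "mpoly f \<Lambda> \<Longrightarrow> mpoly g \<Gamma> \<Longrightarrow> mpoly (\<lambda>z. f z + g z) (\<lambda>\<psi>. \<Lambda> \<psi> + \<Gamma> \<psi>)"
| scale: "mpoly f \<Lambda> \<Longrightarrow> mpoly (\<lambda>z. c * f z) (\<lambda>\<psi>. c * \<Lambda> \<psi>)"

lemma mpoly_const: "mpoly (\<lambda>z. c) (\<lambda>\<psi>. c * \<psi> 0 0)"
  using mpoly.scale[OF mpoly.monomial[of 0 0], of c] by simp

lemma mpoly_add_const: "mpoly f \<Lambda> \<Longrightarrow> mpoly (\<lambda>z. f z + c) (\<lambda>\<psi>. \<Lambda> \<psi> + c * \<psi> 0 0)"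
  by (intro mpoly.add mpoly_const)

lemma mpoly_diff: "mpoly f \<Lambda> \<Longrightarrow> mpoly g \<Gamma> \<Longrightarrow> mpoly (\<lambda>z. f z - g z) (\<lambda>\<psi>. \<Lambda> \<psi> - \<Gamma> \<psi>)"
  using mpoly.add[of f \<Lambda> "\<lambda>z. -1 * g z" "\<lambda>\<psi>. -1 * \<Gamma> \<psi>"] mpoly.scale[of g \<Gamma> "-1"] by simp

text \<open>The functional of the product is left unspecified: products occur only while
  approximating polynomials are built, and whichever functional accompanies the result is used from
  then on.\<close>

lemma mpoly_mult:
  assumes "mpoly f \<Lambda>" "mpoly g \<Gamma>"
  shows "\<exists>\<Delta>. mpoly (\<lambda>z. f z * g z) \<Delta>"
  using assms(1)
proof induction
  case (monomial \<alpha> \<beta>)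
  from assms(2) show ?case
  proof induction
    case (monomial \<alpha>' \<beta>')
    show ?case
      using mpoly.monomial[of "\<alpha> + \<alpha>'" "\<beta> + \<beta>'"] unfolding sphere_monomial_add[abs_def] by blast
  next
    case (add f \<Lambda> g \<Gamma>)
    then show ?case by (auto simp: distrib_left intro: mpoly.add)
  next
    case (scale f \<Lambda> c)
    then show ?case by (auto simp: mult.left_commute[of _ c] intro: mpoly.scale)
  qed
next
  case (add f \<Lambda> g \<Gamma>)
  then show ?case by (auto simp: distrib_right intro: mpoly.add)
next
  case (scale f \<Lambda> c)
  then show ?case by (auto simp: mult.assoc intro: mpoly.scale)
qed

lemma mpoly_sum:
  "(\<And>i. i \<in> I \<Longrightarrow> \<exists>\<Lambda>. mpoly (f i) \<Lambda>) \<Longrightarrow> \<exists>\<Lambda>. mpoly (\<lambda>z. \<Sum>i\<in>I. f i z) \<Lambda>"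
proof (induction I rule: infinite_finite_induct)
  case (insert i I)
  then obtain \<Lambda> \<Gamma> where "mpoly (f i) \<Lambda>" "mpoly (\<lambda>z. \<Sum>i\<in>I. f i z) \<Gamma>" by blast
  then show ?case using insert(1,2) mpoly.add by fastforce
qed (use mpoly_const[of 0] in auto)

lemma mpoly_coordinate: "\<exists>\<Lambda>. mpoly (\<lambda>z. z $ j) \<Lambda>" "\<exists>\<Lambda>. mpoly (\<lambda>z. cnj (z $ j)) \<Lambda>"
  using mpoly.monomial[of "0 + axis j 1" 0] mpoly.monomial[of 0 "0 + axis j 1"]
  unfolding sphere_monomial_Suc[abs_def] by auto

lemma mpoly_of_real_polynomial:
  assumes "real_polynomial_function p"
  shows "\<exists>\<Lambda>. mpoly (\<lambda>z :: complex^'d. of_real (p z)) \<Lambda>"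
  using assms
proof induction
  case (linear f)
  interpret bounded_linear f by fact
  \<comment> \<open>Real and imaginary part of a coordinate are (z_j + cnj z_j) / 2 and (z_j - cnj
    z_j) / (2 i), so a real-linear functional is a polynomial of degree at most one in z and its
    conjugate.\<close>
  have expand: "complex_of_real (f z) = (\<Sum>j\<in>UNIV. of_real (f (axis j 1)) / 2 * (z $ j + cnj (z $ j))
      + of_real (f (axis j \<i>)) / (2 * \<i>) * (z $ j - cnj (z $ j)))" for z
  proof -
    have "z = (\<Sum>j\<in>UNIV. Re (z $ j) *\<^sub>R axis j 1 + Im (z $ j) *\<^sub>R axis j \<i>)"
      by (simp add: vec_eq_iff axis_def if_distrib sum.distrib complex_eq_iff cong: if_cong)
    from arg_cong[OF this, of f]
    have "f z = (\<Sum>j\<in>UNIV. Re (z $ j) * f (axis j 1) + Im (z $ j) * f (axis j \<i>))"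
      by (simp only: sum add scaleR real_scaleR_def)
    then show ?thesis
      by (simp add: complex_add_cnj complex_diff_cnj mult.commute)
  qed
  have "\<exists>\<Lambda>. mpoly (\<lambda>z. \<Sum>j\<in>UNIV. of_real (f (axis j 1)) / 2 * (z $ j + cnj (z $ j))
      + of_real (f (axis j \<i>)) / (2 * \<i>) * (z $ j - cnj (z $ j))) \<Lambda>"
  proof (rule mpoly_sum)
    fix j :: 'd
    obtain \<Lambda> \<Gamma> where j: "mpoly (\<lambda>z. z $ j) \<Lambda>" "mpoly (\<lambda>z. cnj (z $ j)) \<Gamma>"
      using mpoly_coordinate by blast
    show "\<exists>\<Lambda>. mpoly (\<lambda>z. of_real (f (axis j 1)) / 2 * (z $ j + cnj (z $ j))
        + of_real (f (axis j \<i>)) / (2 * \<i>) * (z $ j - cnj (z $ j))) \<Lambda>"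
      by (rule exI, rule mpoly.add[OF mpoly.scale[OF mpoly.add[OF j]] mpoly.scale[OF mpoly_diff[OF j]]])
  qed
  then show ?case by (subst ext[of "\<lambda>z. of_real (f z)", OF expand])
next
  case (const c)
  show ?case using mpoly_const by blast
next
  case (add f g)
  then show ?case by (auto intro: mpoly.add)
next
  case (mult f g)
  then show ?case by (auto dest: mpoly_mult)
qed

section \<open>Approximation and positivity of polynomials on the sphere\<close>

lemma mpoly_dense:
  fixes f :: "complex^'d \<Rightarrow> real"
  assumes "compact S" "continuous_on S f" "0 < e"
  obtains g \<Lambda> where "mpoly g \<Lambda>" "\<And>z. z \<in> S \<Longrightarrow> \<bar>f z - Re (g z)\<bar> < e" "\<And>z. Im (g z) = 0"
proof -
  obtain p where p: "real_polynomial_function p" "\<And>x. x \<in> S \<Longrightarrow> \<bar>f x - p x\<bar> < e"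
    using Stone_Weierstrass_real_polynomial_function[OF assms] by blast
  obtain \<Lambda> where "mpoly (\<lambda>z. of_real (p z)) \<Lambda>" using mpoly_of_real_polynomial[OF p(1)] by blast
  then show ?thesis by (rule that) (use p(2) in auto)
qed

lemma continuous_on_sphere_monomial [continuous_intros]: "continuous_on S (sphere_monomial \<alpha> \<beta>)"
  unfolding sphere_monomial_def[abs_def] by (intro continuous_intros)

lemma mpoly_continuous: "mpoly f \<Lambda> \<Longrightarrow> continuous_on S f"
  by (induction rule: mpoly.induct) (auto intro: continuous_intros)

lemma mpoly_functional_continuous: "mpoly f \<Lambda> \<Longrightarrow> continuous_on S \<Lambda>"
  by (induction rule: mpoly.induct)
    (auto intro: continuous_intros continuous_on_subset[OF continuous_on_kernel_entry])

lemma mpoly_functional_linear: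
  "mpoly f \<Lambda> \<Longrightarrow> \<Lambda> (\<lambda>\<alpha> \<beta>. a * \<psi> \<alpha> \<beta> + b * \<rho> \<alpha> \<beta>) = a * \<Lambda> \<psi> + b * \<Lambda> \<rho>"
  by (induction rule: mpoly.induct) (auto simp: algebra_simps)

lemma mpoly_evaluation: "mpoly f \<Lambda> \<Longrightarrow> \<Lambda> (\<lambda>\<alpha> \<beta>. sphere_monomial \<alpha> \<beta> z) = f z"
  by (induction rule: mpoly.induct) auto

text \<open>The states minimizing \<open>Re (\<Lambda> \<rho>)\<close> form a compact face
  \<open>F\<close>. A maximizer of the strictly convex \<open>energy\<close> on \<open>F\<close> is
  extreme in \<open>F\<close>, hence among all states, hence a point evaluation. So the minimum over
  all states is a value of Re f on the sphere.\<close>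

lemma mpoly_positive_state:
  fixes \<psi> :: "'d::finite kernel"
  assumes f: "mpoly f \<Lambda>" and pos: "\<And>z. z \<in> sphere 0 1 \<Longrightarrow> 0 \<le> Re (f z)" and \<psi>: "\<psi> \<in> states"
  shows "0 \<le> Re (\<Lambda> \<psi>)"
proof -
  have cont: "continuous_on states (\<lambda>\<psi>. Re (\<Lambda> \<psi>))"
    by (intro continuous_intros mpoly_functional_continuous[OF f])
  obtain \<psi>0 where \<psi>0: "\<psi>0 \<in> states" "\<And>\<rho>. \<rho> \<in> states \<Longrightarrow> Re (\<Lambda> \<psi>0) \<le> Re (\<Lambda> \<rho>)"
    using continuous_attains_inf[OF compact_states _ cont] \<psi> by auto
  define F where "F = states \<inter> {\<rho>. Re (\<Lambda> \<rho>) = Re (\<Lambda> \<psi>0)}"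
  have "closed {\<rho> :: 'd kernel. Re (\<Lambda> \<rho>) = Re (\<Lambda> \<psi>0)}"
    by (intro closed_Collect_eq continuous_intros mpoly_functional_continuous[OF f])
  then have "compact F" unfolding F_def by (rule compact_Int_closed[OF compact_states])
  moreover have "continuous_on F energy"
    by (rule continuous_on_subset[OF continuous_on_energy]) (auto simp: F_def)
  moreover have "F \<noteq> {}" using \<psi>0(1) by (auto simp: F_def)
  ultimately obtain \<psi>' where \<psi>': "\<psi>' \<in> F" "\<And>\<rho>. \<rho> \<in> F \<Longrightarrow> energy \<rho> \<le> energy \<psi>'"
    using continuous_attains_sup[of F energy] by auto
  have "\<exists>z\<in>sphere 0 1. \<forall>\<alpha> \<beta>. \<psi>' \<alpha> \<beta> = sphere_monomial \<alpha> \<beta> z"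
  proof (rule extreme_state_evaluation)
    show "\<psi>' \<in> states" using \<psi>'(1) by (simp add: F_def)
  next
    fix \<psi>1 \<psi>2 t
    assume s: "\<psi>1 \<in> states" "\<psi>2 \<in> states" and t: "0 < t" "t < (1 :: real)"
      and eq: "\<And>\<alpha> \<beta>. \<psi>' \<alpha> \<beta> = of_real t * \<psi>1 \<alpha> \<beta> + of_real (1 - t) * \<psi>2 \<alpha> \<beta>"
    have "\<psi>' = (\<lambda>\<alpha> \<beta>. of_real t * \<psi>1 \<alpha> \<beta> + of_real (1 - t) * \<psi>2 \<alpha> \<beta>)" using eq by blast
    then have "\<Lambda> \<psi>' = of_real t * \<Lambda> \<psi>1 + of_real (1 - t) * \<Lambda> \<psi>2"
      using mpoly_functional_linear[OF f, of "of_real t" \<psi>1 "of_real (1 - t)" \<psi>2] by (simp only:)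
    then have lin: "Re (\<Lambda> \<psi>0) = t * Re (\<Lambda> \<psi>1) + (1 - t) * Re (\<Lambda> \<psi>2)"
      using \<psi>'(1) by (simp add: F_def)
    \<comment> \<open>The face property: both terms are nonnegative by minimality and add up to 0,
      so both components attain the minimum.\<close>
    have g: "0 \<le> t * (Re (\<Lambda> \<psi>1) - Re (\<Lambda> \<psi>0))" "0 \<le> (1 - t) * (Re (\<Lambda> \<psi>2) - Re (\<Lambda> \<psi>0))"
      using \<psi>0(2)[OF s(1)] \<psi>0(2)[OF s(2)] t by simp_all
    have "t * (Re (\<Lambda> \<psi>1) - Re (\<Lambda> \<psi>0)) + (1 - t) * (Re (\<Lambda> \<psi>2) - Re (\<Lambda> \<psi>0)) = 0"
      unfolding lin by (simp add: algebra_simps)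
    with g have "t * (Re (\<Lambda> \<psi>1) - Re (\<Lambda> \<psi>0)) = 0" "(1 - t) * (Re (\<Lambda> \<psi>2) - Re (\<Lambda> \<psi>0)) = 0"
      by linarith+
    then have "\<psi>1 \<in> F" "\<psi>2 \<in> F" using t s by (auto simp: F_def)
    then show "\<psi>1 = \<psi>2" by (intro energy_strictly_convex[OF s t _ _ eq] \<psi>')
  qed
  then obtain z where z: "z \<in> sphere 0 1" "\<psi>' = (\<lambda>\<alpha> \<beta>. sphere_monomial \<alpha> \<beta> z)" by blast
  have "0 \<le> Re (\<Lambda> \<psi>')" unfolding z(2) mpoly_evaluation[OF f] by (rule pos[OF z(1)])
  also have "\<dots> = Re (\<Lambda> \<psi>0)" using \<psi>'(1) by (simp add: F_def)
  also have "\<dots> \<le> Re (\<Lambda> \<psi>)" by (rule \<psi>0(2)[OF \<psi>])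
  finally show ?thesis .
qed

lemma mpoly_positive:
  fixes \<psi> :: "'d::finite kernel"
  assumes f: "mpoly f \<Lambda>" and pos: "\<And>z. z \<in> sphere 0 1 \<Longrightarrow> 0 \<le> Re (f z)"
    and \<psi>: "psd_kernel \<psi>" "spherical \<psi>"
  shows "0 \<le> Re (\<Lambda> \<psi>)"
proof (cases "\<psi> 0 0 = 0")
  case True
  then have "\<psi> = (\<lambda>\<alpha> \<beta>. 0 * \<psi> \<alpha> \<beta> + 0 * \<psi> \<alpha> \<beta>)" using spherical_bound[OF \<psi>] by (auto simp: fun_eq_iff)
  then have "\<Lambda> \<psi> = 0" using mpoly_functional_linear[OF f, of 0 \<psi> 0 \<psi>] by simp
  then show ?thesis by simp
next
  case False
  define r where "r = Re (\<psi> 0 0)"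
  have r: "\<psi> 0 0 = of_real r" "0 \<le> r"
    using psd_kernel_diag[OF \<psi>(1), of 0] by (auto simp: r_def complex_nonneg_Reals_iff complex_eq_iff)
  have "\<psi> = (\<lambda>\<alpha> \<beta>. \<psi> 0 0 * (\<psi> \<alpha> \<beta> / \<psi> 0 0) + 0 * \<psi> \<alpha> \<beta>)" using False by simp
  then have "\<Lambda> \<psi> = \<psi> 0 0 * \<Lambda> (\<lambda>\<alpha> \<beta>. \<psi> \<alpha> \<beta> / \<psi> 0 0)"
    using mpoly_functional_linear[OF f, of "\<psi> 0 0" "\<lambda>\<alpha> \<beta>. \<psi> \<alpha> \<beta> / \<psi> 0 0" 0 \<psi>] by simp
  then have "Re (\<Lambda> \<psi>) = r * Re (\<Lambda> (\<lambda>\<alpha> \<beta>. \<psi> \<alpha> \<beta> / \<psi> 0 0))" unfolding r(1) by simp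
  also have "0 \<le> \<dots>"
    using r(2) by (intro mult_nonneg_nonneg mpoly_positive_state[OF f pos] normalize_state \<psi> False)
  finally show ?thesis .
qed

lemma sphere_measure_sets: "sets unit_sphere_borel = sets (restrict_space borel (sphere 0 1))"
  by (simp add: unit_sphere_borel_def)

lemma space_unit_sphere_borel [simp]: "space unit_sphere_borel = sphere 0 1"
  by (simp add: unit_sphere_borel_def space_restrict_space)

theorem scalar_moment_problem:
  fixes \<psi> :: "'d::finite kernel"
  assumes \<psi>: "psd_kernel \<psi>" "spherical \<psi>"
  obtains \<mu> where "finite_measure \<mu>" "sets \<mu> = sets unit_sphere_borel"
    "\<And>\<alpha> \<beta>. (\<integral>z. sphere_monomial \<alpha> \<beta> z \<partial>\<mu>) = \<psi> \<alpha> \<beta>"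
proof -
  define S where "S = (sphere 0 1 :: (complex^'d) set)"
  have S: "compact S" by (simp add: S_def)
  define m where "m = Re (\<psi> 0 0)"
  have "0 \<le> m" using psd_kernel_diag[OF \<psi>(1), of 0] by (auto simp: m_def complex_nonneg_Reals_iff)
  \<comment> \<open>\<open>L f\<close> is the infimum of the values of \<psi> on polynomials
    dominating \<open>f\<close> on the sphere. The estimate proved next shows that an approximation
    of \<open>f\<close> within \<open>e\<close> determines \<open>L f\<close> up to
    \<open>e * m\<close>, which gives linearity as well as exactness on polynomials.\<close>
  define U where "U f = {Re (\<Lambda> \<psi>) | \<Lambda> g. mpoly g \<Lambda> \<and> (\<forall>z\<in>S. f z \<le> Re (g z))}" for f
  define L where "L f = Inf (U f)" for f
  have pos: "Re (\<Lambda> \<psi>) \<le> Re (\<Gamma> \<psi>) + e * m"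
    if "mpoly f \<Lambda>" "mpoly g \<Gamma>" "\<And>z. z \<in> S \<Longrightarrow> Re (f z) \<le> Re (g z) + e" for f g \<Lambda> \<Gamma> e
    using mpoly_positive[OF mpoly_diff[OF mpoly_add_const[OF that(2), of "of_real e"] that(1)] _ \<psi>] that(3)
    by (simp add: S_def m_def)
  have L: "\<bar>L f - Re (\<Lambda> \<psi>)\<bar> \<le> e * m"
    if "mpoly g \<Lambda>" "\<And>z. z \<in> S \<Longrightarrow> \<bar>f z - Re (g z)\<bar> \<le> e" for f g \<Lambda> e
  proof -
    have lower: "Re (\<Lambda> \<psi>) - e * m \<le> u" if u: "u \<in> U f" for u
    proof -
      obtain \<Gamma> h where h: "u = Re (\<Gamma> \<psi>)" "mpoly h \<Gamma>" "\<And>z. z \<in> S \<Longrightarrow> f z \<le> Re (h z)"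
        using u by (auto simp: U_def)
      have "Re (\<Lambda> \<psi>) \<le> Re (\<Gamma> \<psi>) + e * m"
      proof (rule pos[OF \<open>mpoly g \<Lambda>\<close> h(2)])
        fix z assume "z \<in> S"
        from \<open>\<And>z. z \<in> S \<Longrightarrow> \<bar>f z - Re (g z)\<bar> \<le> e\<close>[OF this] h(3)[OF this]
        show "Re (g z) \<le> Re (h z) + e" by linarith
      qed
      then show ?thesis by (simp add: h(1))
    qed
    have upper: "Re (\<Lambda> \<psi>) + e * m \<in> U f"
      unfolding U_def
    proof (rule CollectI, intro exI conjI ballI)
      show "mpoly (\<lambda>z. g z + of_real e) (\<lambda>\<psi>. \<Lambda> \<psi> + of_real e * \<psi> 0 0)" by (rule mpoly_add_const[OF that(1)])
      show "Re (\<Lambda> \<psi>) + e * m = Re (\<Lambda> \<psi> + of_real e * \<psi> 0 0)" by (simp add: m_def)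
      show "f z \<le> Re (g z + of_real e)" if "z \<in> S" for z
        using \<open>\<And>z. z \<in> S \<Longrightarrow> \<bar>f z - Re (g z)\<bar> \<le> e\<close>[OF that] by simp
    qed
    have "L f \<le> Re (\<Lambda> \<psi>) + e * m"
      unfolding L_def using lower by (intro cInf_lower[OF upper] bdd_belowI) auto
    moreover have "Re (\<Lambda> \<psi>) - e * m \<le> L f"
      unfolding L_def using lower upper by (intro cInf_greatest) auto
    ultimately show ?thesis by linarith
  qed
  have approx: "\<exists>g \<Lambda>. mpoly g \<Lambda> \<and> (\<forall>z\<in>S. \<bar>f z - Re (g z)\<bar> \<le> e)" if "continuous_on S f" "0 < e" for f e
    using mpoly_dense[OF S that] by (metis less_imp_le)
  have small_zero: "a = 0" if "\<And>e. 0 < e \<Longrightarrow> \<bar>a\<bar> \<le> C * e * m" for a C :: real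
  proof (rule ccontr)
    assume "a \<noteq> 0"
    define e where "e = \<bar>a\<bar> / (2 * (\<bar>C * m\<bar> + 1))"
    have "0 < e" using \<open>a \<noteq> 0\<close> by (simp add: e_def)
    have "C * e * m \<le> \<bar>C * m\<bar> * e" using \<open>0 < e\<close> by (simp add: mult.commute mult.left_commute mult_left_mono)
    also have "\<dots> \<le> (\<bar>C * m\<bar> + 1) * e" using \<open>0 < e\<close> by (intro mult_right_mono) auto
    also have "\<dots> = \<bar>a\<bar> / 2" by (simp add: e_def field_simps)
    finally show False using that[OF \<open>0 < e\<close>] \<open>a \<noteq> 0\<close> by simp
  qed
  interpret positive_functional S L
  proof
    show "compact S" by (rule S)
  next
    fix f g :: "complex^'d \<Rightarrow> real" assume fg: "continuous_on S f" "continuous_on S g"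
    have "L (\<lambda>x. f x + g x) - (L f + L g) = 0"
    proof (rule small_zero)
      fix e :: real assume "0 < e"
      obtain f' \<Lambda> where f': "mpoly f' \<Lambda>" "\<And>z. z \<in> S \<Longrightarrow> \<bar>f z - Re (f' z)\<bar> \<le> e"
        using approx[OF fg(1) \<open>0 < e\<close>] by blast
      obtain g' \<Gamma> where g': "mpoly g' \<Gamma>" "\<And>z. z \<in> S \<Longrightarrow> \<bar>g z - Re (g' z)\<bar> \<le> e"
        using approx[OF fg(2) \<open>0 < e\<close>] by blast
      have "\<bar>L (\<lambda>x. f x + g x) - Re (\<Lambda> \<psi> + \<Gamma> \<psi>)\<bar> \<le> 2 * e * m"
      proof (rule L[OF mpoly.add[OF f'(1) g'(1)]])
        fix z assume "z \<in> S"
        show "\<bar>f z + g z - Re (f' z + g' z)\<bar> \<le> 2 * e"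
          using f'(2)[OF \<open>z \<in> S\<close>] g'(2)[OF \<open>z \<in> S\<close>] by (simp add: abs_le_iff)
      qed
      then show "\<bar>L (\<lambda>x. f x + g x) - (L f + L g)\<bar> \<le> 4 * e * m"
        using L[OF f'] L[OF g'] by (simp add: abs_le_iff)
    qed
    then show "L (\<lambda>x. f x + g x) = L f + L g" by simp
  next
    fix f :: "complex^'d \<Rightarrow> real" and c :: real assume f: "continuous_on S f"
    have "L (\<lambda>x. c * f x) - c * L f = 0"
    proof (rule small_zero)
      fix e :: real assume "0 < e"
      obtain f' \<Lambda> where f': "mpoly f' \<Lambda>" "\<And>z. z \<in> S \<Longrightarrow> \<bar>f z - Re (f' z)\<bar> \<le> e"
        using approx[OF f \<open>0 < e\<close>] by blast
      have "\<bar>L (\<lambda>x. c * f x) - Re (of_real c * \<Lambda> \<psi>)\<bar> \<le> \<bar>c\<bar> * e * m"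
      proof (rule L[OF mpoly.scale[OF f'(1)]])
        fix z assume "z \<in> S"
        have "\<bar>c * f z - Re (of_real c * f' z)\<bar> = \<bar>c\<bar> * \<bar>f z - Re (f' z)\<bar>"
          by (simp add: right_diff_distrib[symmetric] abs_mult)
        also have "\<dots> \<le> \<bar>c\<bar> * e" using f'(2)[OF \<open>z \<in> S\<close>] by (intro mult_left_mono) auto
        finally show "\<bar>c * f z - Re (of_real c * f' z)\<bar> \<le> \<bar>c\<bar> * e" .
      qed
      moreover have "\<bar>c * L f - Re (of_real c * \<Lambda> \<psi>)\<bar> \<le> \<bar>c\<bar> * e * m"
      proof -
        have "\<bar>c * L f - Re (of_real c * \<Lambda> \<psi>)\<bar> = \<bar>c\<bar> * \<bar>L f - Re (\<Lambda> \<psi>)\<bar>"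
          by (simp add: right_diff_distrib[symmetric] abs_mult)
        also have "\<dots> \<le> \<bar>c\<bar> * (e * m)" using L[OF f'] by (intro mult_left_mono) auto
        finally show ?thesis by (simp add: mult.assoc)
      qed
      ultimately show "\<bar>L (\<lambda>x. c * f x) - c * L f\<bar> \<le> (2 * \<bar>c\<bar>) * e * m"
        by (simp add: abs_le_iff mult.assoc)
    qed
    then show "L (\<lambda>x. c * f x) = c * L f" by simp
  next
    fix f :: "complex^'d \<Rightarrow> real" assume f: "continuous_on S f" "\<And>x. x \<in> S \<Longrightarrow> 0 \<le> f x"
    have "0 \<le> u" if u: "u \<in> U f" for u
    proof -
      obtain \<Gamma> h where h: "u = Re (\<Gamma> \<psi>)" "mpoly h \<Gamma>" "\<And>z. z \<in> S \<Longrightarrow> f z \<le> Re (h z)"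
        using u by (auto simp: U_def)
      show ?thesis
        unfolding h(1) using f(2) h(3) by (intro mpoly_positive[OF h(2) _ \<psi>]) (force simp: S_def)
    qed
    moreover have "U f \<noteq> {}"
    proof -
      obtain g \<Lambda> where g: "mpoly g \<Lambda>" "\<forall>z\<in>S. \<bar>f z - Re (g z)\<bar> \<le> 1"
        using approx[OF f(1), of 1] by auto
      have "\<forall>z\<in>S. f z \<le> Re (g z + 1)" using g(2) by (auto simp: abs_le_iff algebra_simps)
      with mpoly_add_const[OF g(1), of 1]
      have "mpoly (\<lambda>z. g z + 1) (\<lambda>\<psi>. \<Lambda> \<psi> + 1 * \<psi> 0 0)" "\<forall>z\<in>S. f z \<le> Re (g z + 1)"
        by blast+
      then show ?thesis unfolding U_def by blast
    qed
    ultimately show "0 \<le> L f" unfolding L_def by (intro cInf_greatest) auto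
  qed
  \<comment> \<open>The estimate with error 0. The imaginary part of a monomial is reached below as
    the real part of -i times the monomial.\<close>
  have L_exact: "L (\<lambda>z. Re (g z)) = Re (\<Lambda> \<psi>)" if "mpoly g \<Lambda>" for g \<Lambda>
    using L[OF that, of "\<lambda>z. Re (g z)" 0] by simp
  show ?thesis
  proof (rule that)
    show "finite_measure representing" by (rule finite_measure_representing)
    show "sets representing = sets unit_sphere_borel"
      using sets_representing by (simp add: sphere_measure_sets S_def)
    fix \<alpha> \<beta> :: "nat^'d"
    let ?f = "sphere_monomial \<alpha> \<beta>"
    have c: "continuous_on S (\<lambda>z. Re (?f z))" "continuous_on S (\<lambda>z. Im (?f z))"
      by (intro continuous_intros)+
    have "?f = (\<lambda>z. of_real (Re (?f z)) + \<i> * of_real (Im (?f z)))" by (simp add: complex_eq[symmetric])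
    from arg_cong[OF this, of "integral\<^sup>L representing"] have "(\<integral>z. ?f z \<partial>representing) =
        (\<integral>z. of_real (Re (?f z)) + \<i> * of_real (Im (?f z)) \<partial>representing)" .
    also have "\<dots> = of_real (L (\<lambda>z. Re (?f z))) + \<i> * of_real (L (\<lambda>z. Im (?f z)))"
      using integrable_representing[OF c(1)] integrable_representing[OF c(2)]
      by (simp add: integral_representing[OF c(1)] integral_representing[OF c(2)] integrable_of_real)
    also have "L (\<lambda>z. Im (?f z)) = Im (\<psi> \<alpha> \<beta>)"
      using L_exact[OF mpoly.scale[OF mpoly.monomial], of "-\<i>" \<alpha> \<beta>] by simp
    also have "L (\<lambda>z. Re (?f z)) = Re (\<psi> \<alpha> \<beta>)" by (rule L_exact[OF mpoly.monomial])
    finally show "(\<integral>z. ?f z \<partial>representing) = \<psi> \<alpha> \<beta>" by (simp add: complex_eq[symmetric])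
  qed
qed

section \<open>Linear combinations of finite measures\<close>

lemma integral_simple_function_compose:
  fixes g :: "'b \<Rightarrow> complex"
  assumes "finite_measure \<mu>" and s: "simple_function \<mu> s"
  shows "(\<integral>x. g (s x) \<partial>\<mu>) = (\<Sum>v\<in>s ` space \<mu>. g v * measure \<mu> (s -` {v} \<inter> space \<mu>))"
proof -
  interpret finite_measure \<mu> by fact
  define E where "E v = s -` {v} \<inter> space \<mu>" for v
  have fin: "finite (s ` space \<mu>)" using s by (rule simple_functionD)
  have E [measurable]: "E v \<in> sets \<mu>" for v unfolding E_def using s by (rule simple_functionD)
  have "(\<integral>x. g (s x) \<partial>\<mu>) = (\<integral>x. (\<Sum>v\<in>s ` space \<mu>. indicat_real (E v) x *\<^sub>R g v) \<partial>\<mu>)"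
  proof (rule Bochner_Integration.integral_cong[OF refl])
    fix x assume x: "x \<in> space \<mu>"
    have "(\<Sum>v\<in>s ` space \<mu>. indicat_real (E v) x *\<^sub>R g v) = (\<Sum>v\<in>{s x}. indicat_real (E v) x *\<^sub>R g v)"
      using x fin by (intro sum.mono_neutral_right) (auto simp: E_def indicator_def)
    also have "\<dots> = g (s x)" using x by (simp add: E_def)
    finally show "g (s x) = (\<Sum>v\<in>s ` space \<mu>. indicat_real (E v) x *\<^sub>R g v)" by simp
  qed
  also have "\<dots> = (\<Sum>v\<in>s ` space \<mu>. measure \<mu> (E v) *\<^sub>R g v)"
    by (subst Bochner_Integration.integral_sum) (auto simp: less_top[symmetric])
  finally show ?thesis by (simp add: E_def scaleR_conv_of_real mult.commute)
qed

lemma simple_function_cong_sets: "sets M = sets N \<Longrightarrow> simple_function M s \<longleftrightarrow> simple_function N s"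
  unfolding simple_function_def using sets_eq_imp_space_eq[of M N] by simp

lemma integrable_bounded_finite_measure:
  fixes f :: "'a \<Rightarrow> complex"
  assumes "finite_measure \<mu>" "sets \<mu> = sets M" "f \<in> borel_measurable M"
    and "\<And>x. x \<in> space M \<Longrightarrow> norm (f x) \<le> B"
  shows "integrable \<mu> f"
proof -
  interpret finite_measure \<mu> by fact
  show ?thesis
    using assms(3,4) sets_eq_imp_space_eq[OF assms(2)] measurable_cong_sets[OF assms(2) refl]
    by (intro integrable_const_bound[where B = B]) auto
qed

text \<open>For simple functions the relation between the measures is applied on each level set;
  dominated convergence does the rest. Writing relations as vanishing finite sums keeps all the
  measures involved positive.\<close>

lemma lincomb_integral_eq_zero:
  fixes f :: "'a \<Rightarrow> complex" and c :: "'i \<Rightarrow> complex"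
  assumes \<mu>: "\<And>i. i \<in> I \<Longrightarrow> finite_measure (\<mu> i)" "\<And>i. i \<in> I \<Longrightarrow> sets (\<mu> i) = sets M"
    and zero: "\<And>A. A \<in> sets M \<Longrightarrow> (\<Sum>i\<in>I. c i * measure (\<mu> i) A) = 0"
    and f: "f \<in> borel_measurable M" and B: "\<And>x. x \<in> space M \<Longrightarrow> norm (f x) \<le> B"
  shows "(\<Sum>i\<in>I. c i * (\<integral>x. f x \<partial>\<mu> i)) = 0"
proof -
  obtain s where "\<forall>n. simple_function M (s n)" "\<forall>x\<in>space M. (\<lambda>n. s n x) \<longlonglongrightarrow> f x"
    "\<forall>n. \<forall>x\<in>space M. norm (s n x) \<le> 2 * norm (f x)"
    using borel_measurable_implies_sequence_metric[OF f, of 0] by auto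
  then have s: "\<And>n. simple_function M (s n)" "\<And>x. x \<in> space M \<Longrightarrow> (\<lambda>n. s n x) \<longlonglongrightarrow> f x"
    "\<And>n x. x \<in> space M \<Longrightarrow> norm (s n x) \<le> 2 * norm (f x)"
    by auto
  have space: "space (\<mu> i) = space M" if "i \<in> I" for i by (rule sets_eq_imp_space_eq[OF \<mu>(2)[OF that]])
  have lim: "(\<lambda>n. \<integral>x. s n x \<partial>\<mu> i) \<longlonglongrightarrow> (\<integral>x. f x \<partial>\<mu> i)" if i: "i \<in> I" for i
  proof (rule integral_dominated_convergence[where w = "\<lambda>_. 2 * B"])
    interpret finite_measure "\<mu> i" by (rule \<mu>(1)[OF i])
    show "integrable (\<mu> i) (\<lambda>_. 2 * B)" by simp
    show "f \<in> borel_measurable (\<mu> i)" using f measurable_cong_sets[OF \<mu>(2)[OF i] refl] by blast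
    show "s n \<in> borel_measurable (\<mu> i)" for n
      using borel_measurable_simple_function[OF s(1)] measurable_cong_sets[OF \<mu>(2)[OF i] refl] by blast
    show "AE x in \<mu> i. (\<lambda>n. s n x) \<longlonglongrightarrow> f x" using s(2) by (intro AE_I2) (simp add: space[OF i])
    show "AE x in \<mu> i. norm (s n x) \<le> 2 * B" for n
    proof (rule AE_I2)
      fix x assume "x \<in> space (\<mu> i)"
      then have x: "x \<in> space M" by (simp add: space[OF i])
      show "norm (s n x) \<le> 2 * B" using s(3)[OF x, of n] B[OF x] by linarith
    qed
  qed
  have "(\<Sum>i\<in>I. c i * (\<integral>x. s n x \<partial>\<mu> i)) = 0" for n
  proof -
    have "(\<Sum>i\<in>I. c i * (\<integral>x. s n x \<partial>\<mu> i)) =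
        (\<Sum>i\<in>I. \<Sum>v\<in>s n ` space M. v * (c i * measure (\<mu> i) (s n -` {v} \<inter> space M)))"
    proof (rule sum.cong[OF refl])
      fix i assume i: "i \<in> I"
      have "simple_function (\<mu> i) (s n)" using s(1) simple_function_cong_sets[OF \<mu>(2)[OF i]] by blast
      from integral_simple_function_compose[OF \<mu>(1)[OF i] this, of "\<lambda>v. v"]
      show "c i * (\<integral>x. s n x \<partial>\<mu> i) = (\<Sum>v\<in>s n ` space M. v * (c i * measure (\<mu> i) (s n -` {v} \<inter> space M)))"
        by (simp add: space[OF i] sum_distrib_left mult.left_commute)
    qed
    also have "\<dots> = (\<Sum>v\<in>s n ` space M. v * (\<Sum>i\<in>I. c i * measure (\<mu> i) (s n -` {v} \<inter> space M)))"
      by (subst sum.swap) (simp add: sum_distrib_left)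
    also have "\<dots> = 0" using zero simple_functionD(2)[OF s(1)] by simp
    finally show ?thesis .
  qed
  moreover have "(\<lambda>n. \<Sum>i\<in>I. c i * (\<integral>x. s n x \<partial>\<mu> i)) \<longlonglongrightarrow> (\<Sum>i\<in>I. c i * (\<integral>x. f x \<partial>\<mu> i))"
    by (intro tendsto_intros lim)
  ultimately have "(\<lambda>n. 0) \<longlonglongrightarrow> (\<Sum>i\<in>I. c i * (\<integral>x. f x \<partial>\<mu> i))" by simp
  then show ?thesis by (rule LIMSEQ_unique[OF _ tendsto_const])
qed

section \<open>Integration against complex measures\<close>

text \<open>\<open>Y\<close> is a positive set of a Hahn decomposition for \<open>p\<close> and
  \<open>q\<close>, so the supremum defining the variation of \<open>A\<close> is attained at
  \<open>A \<inter> Y\<close>. The scale \<open>r\<close> accommodates the factor 1/4 of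
  polarization.\<close>

lemma upper_variation_diff:
  fixes \<nu> :: "'a set \<Rightarrow> real"
  assumes p: "finite_measure p" "sets p = sets M" and q: "finite_measure q" "sets q = sets M"
    and \<nu>: "\<And>A. A \<in> sets M \<Longrightarrow> \<nu> A = r * (measure p A - measure q A)" and "0 \<le> r"
    and Y: "Y \<in> sets M" "\<And>A. A \<in> sets M \<Longrightarrow> A \<subseteq> Y \<Longrightarrow> measure q A \<le> measure p A"
      "\<And>A. A \<in> sets M \<Longrightarrow> A \<inter> Y = {} \<Longrightarrow> measure p A \<le> measure q A"
  shows "finite_measure (upper_variation M \<nu>)" "sets (upper_variation M \<nu>) = sets M"
    "\<And>A. A \<in> sets M \<Longrightarrow> measure (upper_variation M \<nu>) A = \<nu> (A \<inter> Y)"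
proof -
  interpret p: finite_measure p by fact
  interpret q: finite_measure q by fact
  have pos: "0 \<le> \<nu> A" if "A \<in> sets M" "A \<subseteq> Y" for A
    using \<nu>[OF that(1)] Y(2)[OF that] \<open>0 \<le> r\<close> by simp
  have neg: "\<nu> A \<le> 0" if "A \<in> sets M" "A \<inter> Y = {}" for A
    using \<nu>[OF that(1)] Y(3)[OF that] \<open>0 \<le> r\<close> by (simp add: mult_nonneg_nonpos)
  have split: "\<nu> A = \<nu> (A \<inter> B) + \<nu> (A - B)" if "A \<in> sets M" "B \<in> sets M" for A B
  proof -
    have "A \<inter> B \<in> sets M" "A - B \<in> sets M" using that by auto
    moreover have "measure p A = measure p (A \<inter> B) + measure p (A - B)"
      using that p.finite_measure_Union[of "A \<inter> B" "A - B"] by (auto simp: p(2) Int_Diff_Un)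
    moreover have "measure q A = measure q (A \<inter> B) + measure q (A - B)"
      using that q.finite_measure_Union[of "A \<inter> B" "A - B"] by (auto simp: q(2) Int_Diff_Un)
    ultimately show ?thesis using that by (simp add: \<nu> algebra_simps)
  qed
  have sup: "(SUP B\<in>{B \<in> sets M. B \<subseteq> A}. ennreal (\<nu> B)) = ennreal (\<nu> (A \<inter> Y))" if A: "A \<in> sets M" for A
  proof (rule antisym)
    show "(SUP B\<in>{B \<in> sets M. B \<subseteq> A}. ennreal (\<nu> B)) \<le> ennreal (\<nu> (A \<inter> Y))"
    proof (rule SUP_least, clarify, rule ennreal_leI)
      fix B assume B: "B \<in> sets M" "B \<subseteq> A"
      have "\<nu> B = \<nu> (B \<inter> Y) + \<nu> (B - Y)" by (rule split[OF B(1) Y(1)])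
      also have "\<dots> \<le> \<nu> (B \<inter> Y)" using neg[of "B - Y"] B Y(1) by auto
      also have "\<dots> \<le> \<nu> (B \<inter> Y) + \<nu> (A \<inter> Y - B)" using pos[of "A \<inter> Y - B"] A B Y(1) by auto
      also have "B \<inter> Y = A \<inter> Y \<inter> B" using B(2) by auto
      also have "\<nu> (A \<inter> Y \<inter> B) + \<nu> (A \<inter> Y - B) = \<nu> (A \<inter> Y)"
        using split[of "A \<inter> Y" B] A B(1) Y(1) by simp
      finally show "\<nu> B \<le> \<nu> (A \<inter> Y)" .
    qed
    show "ennreal (\<nu> (A \<inter> Y)) \<le> (SUP B\<in>{B \<in> sets M. B \<subseteq> A}. ennreal (\<nu> B))"
      using A Y(1) by (intro SUP_upper) auto
  qed
  have eq: "upper_variation M \<nu> = measure_of (space M) (sets M) (\<lambda>A. ennreal (\<nu> (A \<inter> Y)))"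
    unfolding upper_variation_def
    by (rule measure_of_eq[OF sets.space_closed]) (simp add: sup sets.sigma_sets_eq)
  show sets: "sets (upper_variation M \<nu>) = sets M" unfolding eq by simp
  have em: "emeasure (upper_variation M \<nu>) A = ennreal (\<nu> (A \<inter> Y))" if "A \<in> sets M" for A
  proof (rule emeasure_measure_of[OF eq sets.space_closed])
    show "positive (sets (upper_variation M \<nu>)) (\<lambda>A. ennreal (\<nu> (A \<inter> Y)))"
      unfolding sets by (simp add: positive_def \<nu>)
    show "countably_additive (sets (upper_variation M \<nu>)) (\<lambda>A. ennreal (\<nu> (A \<inter> Y)))"
      unfolding countably_additive_def sets
    proof (intro allI impI)
      fix A :: "nat \<Rightarrow> 'a set"
      assume A: "range A \<subseteq> sets M" "disjoint_family A" "(\<Union>i. A i) \<in> sets M"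
      have AY: "A i \<inter> Y \<in> sets M" for i using A(1) Y(1) by auto
      have d: "disjoint_family (\<lambda>i. A i \<inter> Y)" using A(2) by (auto simp: disjoint_family_on_def)
      have "(\<lambda>i. measure p (A i \<inter> Y)) sums measure p (\<Union>i. A i \<inter> Y)"
        using AY d by (intro p.finite_measure_UNION) (auto simp: p(2))
      moreover have "(\<lambda>i. measure q (A i \<inter> Y)) sums measure q (\<Union>i. A i \<inter> Y)"
        using AY d by (intro q.finite_measure_UNION) (auto simp: q(2))
      ultimately have "(\<lambda>i. r * (measure p (A i \<inter> Y) - measure q (A i \<inter> Y))) sums
          (r * (measure p (\<Union>i. A i \<inter> Y) - measure q (\<Union>i. A i \<inter> Y)))"
        by (intro sums_mult sums_diff)
      moreover have "(\<Union>i. A i \<inter> Y) = (\<Union>i. A i) \<inter> Y" by blast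
      ultimately have "(\<lambda>i. \<nu> (A i \<inter> Y)) sums \<nu> ((\<Union>i. A i) \<inter> Y)"
        using AY A(3) Y(1) by (simp add: \<nu>)
      then show "(\<Sum>i. ennreal (\<nu> (A i \<inter> Y))) = ennreal (\<nu> ((\<Union>i. A i) \<inter> Y))"
        by (rule suminf_ennreal_eq[rotated]) (rule pos[OF AY], blast)
    qed
    show "A \<in> sets (upper_variation M \<nu>)" using that by (simp add: sets)
  qed
  show "finite_measure (upper_variation M \<nu>)"
    using sets_eq_imp_space_eq[OF sets] by (intro finite_measureI) (simp add: em)
  show "measure (upper_variation M \<nu>) A = \<nu> (A \<inter> Y)" if "A \<in> sets M" for A
    using em[OF that] pos[of "A \<inter> Y"] that Y(1) by (simp add: measure_def)
qed

text \<open>Any representation of \<nu> as a multiple of a difference of finite measures computes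
  the integral, not just the Jordan decomposition: the two variations, \<open>p\<close> and
  \<open>q\<close> satisfy a linear relation to which \<open>lincomb_integral_eq_zero\<close>
  applies.\<close>

lemma signed_integral_diff:
  fixes \<nu> :: "'a set \<Rightarrow> real" and f :: "'a \<Rightarrow> complex"
  assumes p: "finite_measure p" "sets p = sets M" and q: "finite_measure q" "sets q = sets M"
    and \<nu>: "\<And>A. A \<in> sets M \<Longrightarrow> \<nu> A = r * (measure p A - measure q A)" and "0 \<le> r"
    and f: "f \<in> borel_measurable M" "\<And>x. x \<in> space M \<Longrightarrow> norm (f x) \<le> B"
  shows "signed_integrable M \<nu> f"
    "signed_integral M \<nu> f = of_real r * ((\<integral>x. f x \<partial>p) - (\<integral>x. f x \<partial>q))"
proof -
  interpret p: finite_measure p by fact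
  interpret q: finite_measure q by fact
  obtain Y where Y: "Y \<in> sets M" "\<And>A. A \<in> sets M \<Longrightarrow> A \<subseteq> Y \<Longrightarrow> measure q A \<le> measure p A"
      "\<And>A. A \<in> sets M \<Longrightarrow> A \<inter> Y = {} \<Longrightarrow> measure p A \<le> measure q A"
    using finite_unsigned_Hahn_decomposition[OF p(1) q(1)] unfolding p(2) q(2)
    by (auto simp: p.emeasure_eq_measure q.emeasure_eq_measure)
  define Y' where "Y' = space M - Y"
  have Y': "Y' \<in> sets M" "\<And>A. A \<in> sets M \<Longrightarrow> A \<subseteq> Y' \<Longrightarrow> measure p A \<le> measure q A"
      "\<And>A. A \<in> sets M \<Longrightarrow> A \<inter> Y' = {} \<Longrightarrow> measure q A \<le> measure p A"
  proof -
    show "Y' \<in> sets M" using Y(1) by (simp add: Y'_def)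
    show "measure p A \<le> measure q A" if "A \<in> sets M" "A \<subseteq> Y'" for A
      using that by (intro Y(3)) (auto simp: Y'_def)
    show "measure q A \<le> measure p A" if "A \<in> sets M" "A \<inter> Y' = {}" for A
      using that sets.sets_into_space[OF that(1)] by (intro Y(2)) (auto simp: Y'_def)
  qed
  have \<nu>': "- \<nu> A = r * (measure q A - measure p A)" if "A \<in> sets M" for A
    using \<nu>[OF that] by (simp add: algebra_simps)
  note P = upper_variation_diff[of p M q \<nu> r Y, OF p q \<nu> \<open>0 \<le> r\<close> Y]
  note N = upper_variation_diff[of q M p "\<lambda>A. - \<nu> A" r Y', OF q p \<nu>' \<open>0 \<le> r\<close> Y']
  show "signed_integrable M \<nu> f"
    unfolding signed_integrable_def
    by (rule conjI[OF integrable_bounded_finite_measure[OF P(1,2) f]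
          integrable_bounded_finite_measure[OF N(1,2) f]])
  have P3: "measure (upper_variation M \<nu>) A = \<nu> (A \<inter> Y)" if "A \<in> sets M" for A
    by (rule P(3)) (simp_all add: that)
  have N3: "measure (upper_variation M (\<lambda>A. - \<nu> A)) A = - \<nu> (A \<inter> Y')" if "A \<in> sets M" for A
    by (rule N(3)) (simp_all add: that)
  define \<mu> where "\<mu> = (!) [upper_variation M \<nu>, upper_variation M (\<lambda>A. - \<nu> A), p, q]"
  define c where "c = (!) [1, - 1, - complex_of_real r, of_real r]"
  have \<mu>: "\<mu> 0 = upper_variation M \<nu>" "\<mu> 1 = upper_variation M (\<lambda>A. - \<nu> A)" "\<mu> 2 = p" "\<mu> 3 = q"
    and c: "c 0 = 1" "c 1 = - 1" "c 2 = - complex_of_real r" "c 3 = of_real r"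
    by (simp_all add: \<mu>_def c_def)
  have sum4: "(\<Sum>i<4. g i) = g 0 + g 1 + g 2 + g 3" for g :: "nat \<Rightarrow> complex"
    by (simp add: eval_nat_numeral)
  have "(\<Sum>i<4. c i * (\<integral>x. f x \<partial>\<mu> i)) = 0"
  proof (rule lincomb_integral_eq_zero[of "{..<4}" \<mu> M c f B, OF _ _ _ f])
    have "finite_measure (\<mu> i) \<and> sets (\<mu> i) = sets M" if i: "i \<in> {..<4}" for i
    proof -
      consider "i = 0" | "i = 1" | "i = 2" | "i = 3" using i by fastforce
      then show ?thesis
        by cases (simp_all only: \<mu> P(1,2) N(1,2) p q simp_thms)
    qed
    then show "finite_measure (\<mu> i)" "sets (\<mu> i) = sets M" if "i \<in> {..<4}" for i using that by blast+
    show "(\<Sum>i<4. c i * measure (\<mu> i) A) = 0" if A: "A \<in> sets M" for A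
    proof -
      have "\<nu> A = \<nu> (A \<inter> Y) + \<nu> (A \<inter> Y')"
      proof -
        have d: "A = (A \<inter> Y) \<union> (A \<inter> Y')" "(A \<inter> Y) \<inter> (A \<inter> Y') = {}" "A \<inter> Y \<in> sets M" "A \<inter> Y' \<in> sets M"
          using sets.sets_into_space[OF A] A Y(1) Y'(1) by (auto simp: Y'_def)
        have "measure p A = measure p (A \<inter> Y) + measure p (A \<inter> Y')"
          using p.finite_measure_Union[of "A \<inter> Y" "A \<inter> Y'"] d by (simp add: p(2))
        moreover have "measure q A = measure q (A \<inter> Y) + measure q (A \<inter> Y')"
          using q.finite_measure_Union[of "A \<inter> Y" "A \<inter> Y'"] d by (simp add: q(2))
        ultimately show ?thesis using A d(3,4) by (simp add: \<nu> algebra_simps)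
      qed
      then have "complex_of_real (measure (upper_variation M \<nu>) A - measure (upper_variation M (\<lambda>A. - \<nu> A)) A
          - r * measure p A + r * measure q A) = 0"
        using P3[OF A] N3[OF A] \<nu>[OF A] by (simp only: of_real_eq_0_iff right_diff_distrib)
      then show ?thesis unfolding sum4 \<mu> c by (simp add: algebra_simps)
    qed
  qed
  then show "signed_integral M \<nu> f = of_real r * ((\<integral>x. f x \<partial>p) - (\<integral>x. f x \<partial>q))"
    unfolding sum4 \<mu> c signed_integral_def by (simp add: algebra_simps)
qed

text \<open>The powers of i sort the four measures: k = 0, 2 make up the real part and k = 1, 3 the
  imaginary part, each as 1/4 of a difference of finite measures.\<close>

lemma has_complex_integral_polar:
  fixes f :: "'a \<Rightarrow> complex"
  assumes m: "\<And>k. finite_measure (m k)" "\<And>k. sets (m k) = sets M"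
    and \<mu>: "\<And>A. A \<in> sets M \<Longrightarrow> \<mu> A = (\<Sum>k<4. \<i> ^ k * measure (m k) A) / 4"
    and f: "f \<in> borel_measurable M" "\<And>x. x \<in> space M \<Longrightarrow> norm (f x) \<le> B"
  shows "has_complex_integral M \<mu> f c \<longleftrightarrow> c = (\<Sum>k<4. \<i> ^ k * (\<integral>x. f x \<partial>m k)) / 4"
proof -
  have Re: "Re (\<mu> A) = 1/4 * (measure (m 0) A - measure (m 2) A)"
    and Im: "Im (\<mu> A) = 1/4 * (measure (m 1) A - measure (m 3) A)" if "A \<in> sets M" for A
    unfolding \<mu>[OF that] by (simp_all add: eval_nat_numeral)
  have "(0 :: real) \<le> 1/4" by simp
  note R = signed_integral_diff[of "m 0" M "m 2" "\<lambda>A. Re (\<mu> A)" "1/4" f B, OF m m Re this f] and I = signed_integral_diff[of "m 1" M "m 3" "\<lambda>A. Im (\<mu> A)" "1/4" f B, OF m m Im this f]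
  have "signed_integral M (\<lambda>A. Re (\<mu> A)) f + \<i> * signed_integral M (\<lambda>A. Im (\<mu> A)) f =
      (\<Sum>k<4. \<i> ^ k * (\<integral>x. f x \<partial>m k)) / 4"
    by (simp only: R(2) I(2)) (simp add: eval_nat_numeral field_simps)
  then show ?thesis unfolding has_complex_integral_def using R(1) I(1) by (simp only: simp_thms)
qed

section \<open>Finite measures on the sphere are determined by their moments\<close>

lemma integrable_sphere:
  fixes f :: "complex^'d \<Rightarrow> complex"
  assumes \<mu>: "finite_measure \<mu>" "sets \<mu> = sets unit_sphere_borel" and f: "continuous_on (sphere 0 1) f"
  shows "integrable \<mu> f"
proof -
  have "compact (f ` sphere 0 1)" by (intro compact_continuous_image f) simp
  then obtain B where "\<And>x. x \<in> sphere 0 1 \<Longrightarrow> norm (f x) \<le> B"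
    using compact_imp_bounded by (fastforce simp: bounded_iff)
  then show ?thesis
    by (intro integrable_bounded_finite_measure[OF \<mu>])
      (auto simp: unit_sphere_borel_def space_restrict_space intro: borel_measurable_continuous_on_restrict f)
qed

text \<open>The relation passes from polynomials to continuous functions by density, to closed sets
  by cutoff functions and to Borel sets by Dynkin's theorem. Finite families with complex
  coefficients are allowed so that one statement serves both uniqueness and the algebraic identities
  of the operators to be built.\<close>

lemma lincomb_measure_eq_zero:
  fixes \<mu> :: "'i \<Rightarrow> (complex^'d) measure" and c :: "'i \<Rightarrow> complex"
  assumes "finite I"
    and \<mu>: "\<And>i. i \<in> I \<Longrightarrow> finite_measure (\<mu> i)" "\<And>i. i \<in> I \<Longrightarrow> sets (\<mu> i) = sets unit_sphere_borel"
    and moments: "\<And>\<alpha> \<beta>. (\<Sum>i\<in>I. c i * (\<integral>z. sphere_monomial \<alpha> \<beta> z \<partial>\<mu> i)) = 0"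
    and A: "A \<in> sets unit_sphere_borel"
  shows "(\<Sum>i\<in>I. c i * measure (\<mu> i) A) = 0"
proof -
  define S where "S = (sphere 0 1 :: (complex^'d) set)"
  have S: "compact S" "closed S" by (simp_all add: S_def)
  have space: "space (\<mu> i) = S" if "i \<in> I" for i
    using sets_eq_imp_space_eq[OF \<mu>(2)[OF that]] by (simp add: S_def)
  have int: "integrable (\<mu> i) f" if "i \<in> I" "continuous_on S f" for i and f :: "complex^'d \<Rightarrow> complex"
    using that integrable_sphere[OF \<mu>] by (simp add: S_def)
  have poly: "(\<Sum>i\<in>I. c i * (\<integral>z. f z \<partial>\<mu> i)) = 0" if "mpoly f \<Lambda>" for f \<Lambda>
    using that
  proof induction
    case (monomial \<alpha> \<beta>)
    show ?case by (rule moments)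
  next
    case (add f \<Lambda> g \<Gamma>)
    have "(\<Sum>i\<in>I. c i * (\<integral>z. f z + g z \<partial>\<mu> i)) = (\<Sum>i\<in>I. c i * (\<integral>z. f z \<partial>\<mu> i) + c i * (\<integral>z. g z \<partial>\<mu> i))"
      using int mpoly_continuous[OF add(1)] mpoly_continuous[OF add(2)]
      by (intro sum.cong refl) (simp add: distrib_left)
    then show ?case using add by (simp add: sum.distrib)
  next
    case (scale f \<Lambda> a)
    have "(\<Sum>i\<in>I. c i * (\<integral>z. a * f z \<partial>\<mu> i)) = a * (\<Sum>i\<in>I. c i * (\<integral>z. f z \<partial>\<mu> i))"
      by (simp add: sum_distrib_left mult.left_commute)
    then show ?case using scale by simp
  qed
  have cont: "(\<Sum>i\<in>I. c i * (\<integral>z. of_real (f z) \<partial>\<mu> i)) = 0" if f: "continuous_on S f" for f :: "complex^'d \<Rightarrow> real"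
  proof -
    define C where "C = (\<Sum>i\<in>I. cmod (c i) * measure (\<mu> i) S)"
    have "0 \<le> C" unfolding C_def by (intro sum_nonneg) simp
    have le: "cmod (\<Sum>i\<in>I. c i * (\<integral>z. of_real (f z) \<partial>\<mu> i)) \<le> C * e" if "0 < e" for e
    proof -
      obtain g \<Lambda> where g: "mpoly g \<Lambda>" "\<And>z. z \<in> S \<Longrightarrow> \<bar>f z - Re (g z)\<bar> < e" "\<And>z. Im (g z) = 0"
        using mpoly_dense[OF S(1) f \<open>0 < e\<close>] by blast
      have g': "g z = of_real (Re (g z))" for z using g(3) by (simp add: complex_eq_iff)
      have fc: "continuous_on S (\<lambda>z. complex_of_real (f z))" by (intro continuous_intros f)
      have gc: "continuous_on S g" by (rule mpoly_continuous[OF g(1)])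
      have "(\<Sum>i\<in>I. c i * (\<integral>z. of_real (f z) \<partial>\<mu> i)) =
          (\<Sum>i\<in>I. c i * (\<integral>z. of_real (f z) \<partial>\<mu> i)) - (\<Sum>i\<in>I. c i * (\<integral>z. g z \<partial>\<mu> i))"
        using poly[OF g(1)] by simp
      also have "\<dots> = (\<Sum>i\<in>I. c i * (\<integral>z. of_real (f z) - g z \<partial>\<mu> i))"
        unfolding sum_subtractf[symmetric] right_diff_distrib[symmetric]
        by (intro sum.cong refl arg_cong2[where f = "(*)"]
            Bochner_Integration.integral_diff[symmetric] int fc gc)
      also have "cmod \<dots> \<le> (\<Sum>i\<in>I. cmod (c i * (\<integral>z. of_real (f z) - g z \<partial>\<mu> i)))" by (rule norm_sum)
      also have "\<dots> \<le> (\<Sum>i\<in>I. cmod (c i) * (e * measure (\<mu> i) S))"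
      proof (rule sum_mono)
        fix i assume i: "i \<in> I"
        interpret finite_measure "\<mu> i" by (rule \<mu>(1)[OF i])
        have "cmod (\<integral>z. of_real (f z) - g z \<partial>\<mu> i) \<le> (\<integral>z. cmod (of_real (f z) - g z) \<partial>\<mu> i)"
          by (rule integral_norm_bound)
        also have "\<dots> \<le> (\<integral>z. e \<partial>\<mu> i)"
        proof (rule integral_mono)
          show "integrable (\<mu> i) (\<lambda>z. cmod (of_real (f z) - g z))"
            by (intro integrable_norm int[OF i] continuous_intros fc gc)
          show "cmod (of_real (f z) - g z) \<le> e" if "z \<in> space (\<mu> i)" for z
          proof -
            have "cmod (of_real (f z) - g z) = \<bar>f z - Re (g z)\<bar>"
              by (subst g') (simp only: of_real_diff[symmetric] norm_of_real)
            then show ?thesis using g(2)[of z] that space[OF i] by (simp add: less_imp_le)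
          qed
        qed simp
        also have "\<dots> = e * measure (\<mu> i) S" by (simp add: space[OF i] mult.commute)
        finally show "cmod (c i * (\<integral>z. of_real (f z) - g z \<partial>\<mu> i)) \<le> cmod (c i) * (e * measure (\<mu> i) S)"
          unfolding norm_mult by (intro mult_left_mono) auto
      qed
      also have "\<dots> = C * e" by (simp add: C_def sum_distrib_left sum_distrib_right mult_ac)
      finally show ?thesis .
    qed
    have "cmod (\<Sum>i\<in>I. c i * (\<integral>z. of_real (f z) \<partial>\<mu> i)) \<le> 0"
    proof (rule field_le_epsilon)
      fix e :: real assume "0 < e"
      have "cmod (\<Sum>i\<in>I. c i * (\<integral>z. of_real (f z) \<partial>\<mu> i)) \<le> C * (e / (C + 1))"
        using \<open>0 < e\<close> \<open>0 \<le> C\<close> by (intro le) simp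
      also have "\<dots> \<le> e" using \<open>0 < e\<close> \<open>0 \<le> C\<close> by (simp add: field_simps)
      finally show "cmod (\<Sum>i\<in>I. c i * (\<integral>z. of_real (f z) \<partial>\<mu> i)) \<le> 0 + e" by simp
    qed
    then show ?thesis by simp
  qed
  have sets: "B \<inter> S \<in> sets (\<mu> i)" if "B \<in> sets borel" "i \<in> I" for B i
    using that by (auto simp: \<mu>(2) unit_sphere_borel_def sets_restrict_space S_def)
  have closed: "(\<Sum>i\<in>I. c i * measure (\<mu> i) (B \<inter> S)) = 0" if B: "closed B" for B
  proof (cases "B \<inter> S = {}")
    case False
    \<comment> \<open>Continuous functions equal to 1 on \<open>B \<inter> S\<close> and tending to
      0 off it; nonemptiness matters because \<open>infdist\<close> to the empty set is 0.\<close>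
    define h where "h n z = max 0 (1 - real n * infdist z (B \<inter> S))" for n z
    have h_cont: "continuous_on S (h n)" for n unfolding h_def by (intro continuous_intros)
    have h_range: "0 \<le> h n z" "h n z \<le> 1" for n z by (auto simp: h_def infdist_nonneg)
    have h_lim: "(\<lambda>n. h n z) \<longlonglongrightarrow> indicat_real (B \<inter> S) z" for z
    proof (cases "z \<in> B \<inter> S")
      case True
      then show ?thesis by (simp add: h_def)
    next
      case z: False
      have pos: "0 < infdist z (B \<inter> S)"
        using z in_closed_iff_infdist_zero[of "B \<inter> S" z] False infdist_nonneg[of z "B \<inter> S"] B S(2)
        by (auto simp: less_le closed_Int)
      obtain n0 where "1 / infdist z (B \<inter> S) < real n0" using reals_Archimedean2 by blast
      then have n0: "1 \<le> real n0 * infdist z (B \<inter> S)" using pos by (simp add: field_simps)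
      have "h n z = 0" if "n \<ge> n0" for n
      proof -
        have "real n0 * infdist z (B \<inter> S) \<le> real n * infdist z (B \<inter> S)"
          using that by (intro mult_right_mono) (auto simp: infdist_nonneg)
        then show ?thesis using n0 by (simp add: h_def)
      qed
      then show ?thesis using z by (intro tendsto_eventually) (auto simp: eventually_sequentially)
    qed
    have "(\<lambda>n. \<integral>z. of_real (h n z) \<partial>\<mu> i) \<longlonglongrightarrow> (\<integral>z. complex_of_real (indicat_real (B \<inter> S) z) \<partial>\<mu> i)"
      if i: "i \<in> I" for i
    proof (rule integral_dominated_convergence[where w = "\<lambda>_. 1"])
      interpret finite_measure "\<mu> i" by (rule \<mu>(1)[OF i])
      show "integrable (\<mu> i) (\<lambda>_. 1 :: real)" by simp
      show "(\<lambda>z. complex_of_real (indicat_real (B \<inter> S) z)) \<in> borel_measurable (\<mu> i)"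
        using sets[OF borel_closed[OF B] i] by measurable
      show "(\<lambda>z. complex_of_real (h n z)) \<in> borel_measurable (\<mu> i)" for n
        by (rule borel_measurable_integrable[OF int[OF i]]) (intro continuous_intros h_cont)
      show "AE z in \<mu> i. (\<lambda>n. complex_of_real (h n z)) \<longlonglongrightarrow> complex_of_real (indicat_real (B \<inter> S) z)"
        by (intro AE_I2 tendsto_of_real h_lim)
      show "AE z in \<mu> i. norm (complex_of_real (h n z)) \<le> 1" for n
        using h_range by (intro AE_I2) simp
    qed
    then have "(\<lambda>n. \<Sum>i\<in>I. c i * (\<integral>z. of_real (h n z) \<partial>\<mu> i)) \<longlonglongrightarrow>
        (\<Sum>i\<in>I. c i * (\<integral>z. complex_of_real (indicat_real (B \<inter> S) z) \<partial>\<mu> i))"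
      by (intro tendsto_sum tendsto_mult_left)
    then have "(\<lambda>n. 0) \<longlonglongrightarrow> (\<Sum>i\<in>I. c i * (\<integral>z. complex_of_real (indicat_real (B \<inter> S) z) \<partial>\<mu> i))"
      by (simp only: cont[OF h_cont])
    then have "(\<Sum>i\<in>I. c i * (\<integral>z. complex_of_real (indicat_real (B \<inter> S) z) \<partial>\<mu> i)) = 0"
      by (rule LIMSEQ_unique[OF _ tendsto_const])
    moreover have "(\<integral>z. complex_of_real (indicat_real (B \<inter> S) z) \<partial>\<mu> i) = measure (\<mu> i) (B \<inter> S)" if i: "i \<in> I" for i
    proof -
      interpret finite_measure "\<mu> i" by (rule \<mu>(1)[OF i])
      show ?thesis
        using sets[OF borel_closed[OF B] i] by (simp add: integral_complex_of_real space[OF i] Int_assoc)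
    qed
    ultimately show ?thesis by simp
  qed simp
  have borel: "(\<Sum>i\<in>I. c i * measure (\<mu> i) (B \<inter> S)) = 0" if "B \<in> sets borel" for B
  proof -
    \<comment> \<open>The relation is linear in the set function, so it survives complements and
      disjoint unions; closed sets form a generator stable under intersection.\<close>
    have "Int_stable (Collect closed :: (complex^'d) set set)" by (auto simp: Int_stable_def)
    moreover have "Collect closed \<subseteq> Pow (UNIV :: (complex^'d) set)" by simp
    moreover have "B \<in> sigma_sets UNIV (Collect closed)"
      using that by (simp add: borel_eq_closed)
    ultimately show ?thesis
    proof (induction rule: sigma_sets_induct_disjoint)
      case (basic B)
      then show ?case using closed by simp
    next
      case (compl B)
      have B: "B \<in> sets borel" using compl(1) by (simp add: borel_eq_closed)
      have "measure (\<mu> i) ((UNIV - B) \<inter> S) = measure (\<mu> i) (UNIV \<inter> S) - measure (\<mu> i) (B \<inter> S)" if i: "i \<in> I" for i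
      proof -
        interpret finite_measure "\<mu> i" by (rule \<mu>(1)[OF i])
        have "(UNIV - B) \<inter> S = UNIV \<inter> S - B \<inter> S" by blast
        then show ?thesis
          using finite_measure_Diff[OF sets[OF _ i] sets[OF B i], of UNIV] by auto
      qed
      then have "(\<Sum>i\<in>I. c i * measure (\<mu> i) ((UNIV - B) \<inter> S)) =
          (\<Sum>i\<in>I. c i * measure (\<mu> i) (UNIV \<inter> S) - c i * measure (\<mu> i) (B \<inter> S))"
        by (intro sum.cong refl) (simp add: right_diff_distrib)
      then show ?case using compl(2) closed[of UNIV] by (simp add: sum_subtractf)
    next
      case (union F)
      have F: "F n \<in> sets borel" for n using union(2) by (auto simp: borel_eq_closed)
      have "(\<lambda>n. \<Sum>i\<in>I. c i * measure (\<mu> i) (F n \<inter> S)) sums (\<Sum>i\<in>I. c i * measure (\<mu> i) (\<Union>n. F n \<inter> S))"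
      proof (intro sums_sum sums_mult sums_of_real)
        fix i assume i: "i \<in> I"
        interpret finite_measure "\<mu> i" by (rule \<mu>(1)[OF i])
        show "(\<lambda>n. measure (\<mu> i) (F n \<inter> S)) sums measure (\<mu> i) (\<Union>n. F n \<inter> S)"
          using sets[OF F i] union(1) by (intro finite_measure_UNION) (auto simp: disjoint_family_on_def)
      qed
      then have "(\<lambda>n. 0) sums (\<Sum>i\<in>I. c i * measure (\<mu> i) (\<Union>n. F n \<inter> S))"
        using union(3) by simp
      then have "(\<Sum>i\<in>I. c i * measure (\<mu> i) (\<Union>n. F n \<inter> S)) = 0" using sums_unique2 sums_zero by blast
      moreover have "(\<Union>n. F n \<inter> S) = (\<Union>n. F n) \<inter> S" by blast
      ultimately show ?case by simp
    qed simp
  qed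
  obtain B where "B \<in> sets borel" "A = B \<inter> S"
    using A by (auto simp: unit_sphere_borel_def sets_restrict_space S_def)
  then show ?thesis using borel by simp
qed

text \<open>The measure is pushed forward to the ambient space, where finite Borel measures are
  inner regular by compact sets and outer regular by open sets; each approximation spends e / 2.
  Intersection with the sphere makes the open set relatively open.\<close>

lemma regular_finite_measure:
  fixes m :: "(complex^'d) measure"
  assumes m: "finite_measure m" "sets m = sets unit_sphere_borel"
    and A: "A \<in> sets unit_sphere_borel" and "0 < e"
  shows "\<exists>K U. compact K \<and> openin (top_of_set (sphere 0 1)) U \<and> K \<subseteq> A \<and> A \<subseteq> U \<and>
    (\<forall>C\<in>sets unit_sphere_borel. C \<subseteq> U - K \<longrightarrow> measure m C < e)"
proof -
  interpret finite_measure m by (rule m)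
  define S where "S = (sphere 0 1 :: (complex^'d) set)"
  have space: "space m = S" using sets_eq_imp_space_eq[OF m(2)] by (simp add: S_def)
  have id: "(\<lambda>z. z) \<in> measurable m borel"
    unfolding measurable_cong_sets[OF m(2) refl] unit_sphere_borel_def by (rule measurable_restrict_space1) simp
  define M where "M = distr m borel (\<lambda>z. z)"
  have sM: "sets M = sets borel" by (simp add: M_def)
  have fM: "emeasure M (space M) \<noteq> \<infinity>"
    unfolding M_def by (subst emeasure_distr[OF id]) auto
  have eM: "emeasure M B = ennreal (measure m (B \<inter> S))" if "B \<in> sets borel" for B
    unfolding M_def using emeasure_distr[OF id that] by (simp add: space emeasure_eq_measure)
  obtain B where B: "B \<in> sets borel" "A = B \<inter> S"
    using A by (auto simp: unit_sphere_borel_def sets_restrict_space S_def)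
  have AS: "A \<subseteq> S" "A \<in> sets borel" using B by (auto simp: S_def)
  have KS: "K \<inter> S = K" if "K \<subseteq> A" for K using that AS(1) by auto
  have "\<exists>K. compact K \<and> K \<subseteq> A \<and> measure m A < measure m K + e / 2"
  proof (rule ccontr)
    assume contra: "\<not> ?thesis"
    have le: "measure m K \<le> measure m A - e / 2" if "compact K" "K \<subseteq> A" for K
    proof -
      have "\<not> measure m A < measure m K + e / 2" using contra that by blast
      then show ?thesis by simp
    qed
    have "emeasure M A \<le> ennreal (measure m A - e / 2)"
      unfolding inner_regular[OF sM fM AS(2)]
    proof (rule SUP_least, clarify)
      fix K assume K: "K \<subseteq> A" "compact K"
      show "emeasure M K \<le> ennreal (measure m A - e / 2)"
        using le[OF K(2,1)] by (simp add: eM borel_closed compact_imp_closed K KS ennreal_leI)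
    qed
    \<comment> \<open>The empty compact set shows that \<open>measure m A - e / 2\<close> is
      nonnegative, so \<open>ennreal\<close> does not truncate it to 0.\<close>
    then show False
      using le[of "{}"] \<open>0 < e\<close> by (simp add: eM AS KS ennreal_le_iff)
  qed
  then obtain K where K: "compact K" "K \<subseteq> A" and 1: "measure m A < measure m K + e / 2" by blast
  have "\<exists>U. open U \<and> A \<subseteq> U \<and> measure m (U \<inter> S) < measure m A + e / 2"
  proof (rule ccontr)
    assume contra: "\<not> ?thesis"
    have ge: "measure m A + e / 2 \<le> measure m (U \<inter> S)" if "open U" "A \<subseteq> U" for U
    proof -
      have "\<not> measure m (U \<inter> S) < measure m A + e / 2" using contra that by blast
      then show ?thesis by simp
    qed
    have "ennreal (measure m A + e / 2) \<le> emeasure M A"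
      unfolding outer_regular[OF sM fM AS(2)]
    proof (rule INF_greatest, clarify)
      fix U assume U: "A \<subseteq> U" "open U"
      show "ennreal (measure m A + e / 2) \<le> emeasure M U"
        using ge[OF U(2,1)] U(2) by (simp add: eM ennreal_leI)
    qed
    then show False
      using \<open>0 < e\<close> by (simp add: eM AS KS ennreal_le_iff)
  qed
  then obtain U where U: "open U" "A \<subseteq> U" and 2: "measure m (U \<inter> S) < measure m A + e / 2" by blast
  have meas: "K \<in> sets m" "U \<inter> S \<in> sets m" "A \<in> sets m"
  proof -
    have *: "B \<inter> S \<in> sets m" if "B \<in> sets borel" for B
      using that by (auto simp: m(2) unit_sphere_borel_def sets_restrict_space S_def)
    show "K \<in> sets m" using *[of K] compact_imp_closed[OF K(1)] KS[OF K(2)] by (simp add: borel_closed)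
    show "U \<inter> S \<in> sets m" using *[of U] U(1) by simp
    show "A \<in> sets m" using A by (simp add: m(2))
  qed
  have "measure m C < e" if C: "C \<in> sets unit_sphere_borel" "C \<subseteq> (S \<inter> U) - K" for C
  proof -
    have "measure m C \<le> measure m (U \<inter> S - K)"
      using C meas by (intro finite_measure_mono) (auto simp: m(2))
    also have "\<dots> = measure m (U \<inter> S) - measure m K"
      using meas K(2) U(2) AS(1) by (intro finite_measure_Diff) auto
    finally show ?thesis using 1 2 by linarith
  qed
  moreover have "openin (top_of_set S) (S \<inter> U)" using U(1) by (rule openin_open_Int)
  ultimately show ?thesis
    using K(1,2) U(2) AS(1) unfolding S_def by (intro exI[of _ K] exI[of _ "S \<inter> U"]) (auto simp: S_def)
qed

section \<open>Semispectral measures and their diagonal measures\<close>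

definition diagonal_measure :: "'a measure \<Rightarrow> ('a set \<Rightarrow> ('m::chilbert \<Rightarrow>\<^sub>L 'm)) \<Rightarrow> 'm \<Rightarrow> 'a measure" where
  "diagonal_measure M F x =
     measure_of (space M) (sets M) (\<lambda>A. ennreal (Re (cinner (blinfun_apply (F A) x) x)))"

lemma sets_diagonal_measure [simp]: "sets (diagonal_measure M F x) = sets M"
  by (simp add: diagonal_measure_def)

context
  fixes M :: "'a::topological_space measure" and F :: "'a set \<Rightarrow> ('m::chilbert \<Rightarrow>\<^sub>L 'm)"
  assumes F: "semispectral_measure M F"
begin

lemma semispectral_bounded_operator: "A \<in> sets M \<Longrightarrow> F A \<in> bounded_operators"
  using F by (simp add: semispectral_measure_def positive_operator_def)

lemma semispectral_nonneg: "A \<in> sets M \<Longrightarrow> cinner (blinfun_apply (F A) x) x \<in> \<real>\<^sub>\<ge>\<^sub>0"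
  using F by (simp add: semispectral_measure_def positive_operator_def)

lemma semispectral_empty: "F {} = 0"
proof -
  have "F ({} \<union> {}) = F {} + F {}" using F unfolding semispectral_measure_def by blast
  then show ?thesis by simp
qed

lemma emeasure_diagonal_measure:
  assumes "A \<in> sets M"
  shows "emeasure (diagonal_measure M F x) A = ennreal (Re (cinner (blinfun_apply (F A) x) x))"
proof (rule emeasure_measure_of[OF diagonal_measure_def sets.space_closed])
  show "positive (sets (diagonal_measure M F x)) (\<lambda>A. ennreal (Re (cinner (blinfun_apply (F A) x) x)))"
    by (simp add: positive_def semispectral_empty)
  show "countably_additive (sets (diagonal_measure M F x)) (\<lambda>A. ennreal (Re (cinner (blinfun_apply (F A) x) x)))"
    unfolding countably_additive_def sets_diagonal_measure
  proof (intro allI impI)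
    fix A :: "nat \<Rightarrow> 'a set"
    assume A: "range A \<subseteq> sets M" "disjoint_family A"
    have "(\<lambda>n. cinner (blinfun_apply (F (A n)) x) x) sums cinner (blinfun_apply (F (\<Union>n. A n)) x) x"
      using F A unfolding semispectral_measure_def regular_complex_measure_def complex_measure_def by blast
    then show "(\<Sum>i. ennreal (Re (cinner (blinfun_apply (F (A i)) x) x))) =
        ennreal (Re (cinner (blinfun_apply (F (\<Union>i. A i)) x) x))"
      using A(1) semispectral_nonneg
      by (intro suminf_ennreal_eq sums_Re) (auto simp: complex_nonneg_Reals_iff)
  qed
  show "A \<in> sets (diagonal_measure M F x)" using assms by simp
qed

lemma finite_diagonal_measure: "finite_measure (diagonal_measure M F x)"
  using sets_eq_imp_space_eq[OF sets_diagonal_measure[of M F x]]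
  by (intro finite_measureI) (simp add: emeasure_diagonal_measure)

lemma measure_diagonal_measure:
  assumes "A \<in> sets M"
  shows "complex_of_real (measure (diagonal_measure M F x) A) = cinner (blinfun_apply (F A) x) x"
  using emeasure_diagonal_measure[OF assms, of x] semispectral_nonneg[OF assms, of x]
  by (simp add: measure_def complex_nonneg_Reals_iff complex_eq_iff)

text \<open>Polarization expresses each complex measure <F(.) x, y> by four diagonal measures, so
  the diagonal decides. To recover the diagonal from the weak integral, polarization at the pair (x,
  x) is read as a linear relation between the measures of x + i^k x and the measure of x.\<close>

lemma has_weak_integral_iff:
  assumes T: "T \<in> bounded_operators"
    and f: "f \<in> borel_measurable M" "\<And>x. x \<in> space M \<Longrightarrow> norm (f x) \<le> B"
  shows "has_weak_integral M F f T \<longleftrightarrow>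
    (\<forall>x. cinner (blinfun_apply T x) x = (\<integral>z. f z \<partial>diagonal_measure M F x))"
proof -
  define D where "D x = diagonal_measure M F x" for x
  have polar: "has_complex_integral M (\<lambda>A. cinner (blinfun_apply (F A) x) y) f c \<longleftrightarrow>
      c = (\<Sum>k<4. \<i> ^ k * (\<integral>z. f z \<partial>D (x + \<i> ^ k *\<^sub>C y))) / 4" for x y c
  proof (rule has_complex_integral_polar[OF _ _ _ f])
    show "finite_measure (D (x + \<i> ^ k *\<^sub>C y))" "sets (D (x + \<i> ^ k *\<^sub>C y)) = sets M" for k
      by (simp_all add: D_def finite_diagonal_measure)
    show "cinner (blinfun_apply (F A) x) y = (\<Sum>k<4. \<i> ^ k * measure (D (x + \<i> ^ k *\<^sub>C y)) A) / 4"
      if A: "A \<in> sets M" for A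
      unfolding D_def measure_diagonal_measure[OF A]
      by (rule polarization(1)[OF semispectral_bounded_operator[OF A]])
  qed
  show ?thesis
    unfolding D_def[symmetric]
  proof
    assume L: "has_weak_integral M F f T"
    show "\<forall>x. cinner (blinfun_apply T x) x = (\<integral>z. f z \<partial>D x)"
    proof
      fix x
      \<comment> \<open>Indices 0 to 3 carry the polarization measures, index 4 the measure of
        \<open>x\<close> with coefficient - 4.\<close>
      define \<mu> where "\<mu> k = (if k < 4 then D (x + \<i> ^ k *\<^sub>C x) else D x)" for k :: nat
      define c where "c k = (if k < 4 then \<i> ^ k else - 4)" for k :: nat
      have "(\<Sum>k<Suc 4. c k * (\<integral>z. f z \<partial>\<mu> k)) = 0"
      proof (rule lincomb_integral_eq_zero[OF _ _ _ f])
        show "finite_measure (\<mu> k)" "sets (\<mu> k) = sets M" for k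
          by (simp_all add: \<mu>_def D_def finite_diagonal_measure)
        show "(\<Sum>k<Suc 4. c k * measure (\<mu> k) A) = 0" if A: "A \<in> sets M" for A
        proof -
          have "(\<Sum>k<4. c k * measure (\<mu> k) A) = 4 * complex_of_real (measure (D x) A)"
            unfolding D_def measure_diagonal_measure[OF A]
            using polarization(1)[OF semispectral_bounded_operator[OF A], of x x]
            by (simp add: c_def \<mu>_def D_def measure_diagonal_measure[OF A] mult.commute)
          then show ?thesis unfolding sum.lessThan_Suc by (simp add: c_def \<mu>_def)
        qed
      qed
      then have "(\<Sum>k<4. c k * (\<integral>z. f z \<partial>\<mu> k)) = 4 * (\<integral>z. f z \<partial>D x)"
        unfolding sum.lessThan_Suc by (simp add: c_def \<mu>_def)
      moreover have "cinner (blinfun_apply T x) x = (\<Sum>k<4. \<i> ^ k * (\<integral>z. f z \<partial>D (x + \<i> ^ k *\<^sub>C x))) / 4"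
        using L polar unfolding has_weak_integral_def by blast
      ultimately show "cinner (blinfun_apply T x) x = (\<integral>z. f z \<partial>D x)"
        by (simp add: c_def \<mu>_def)
    qed
  next
    assume R: "\<forall>x. cinner (blinfun_apply T x) x = (\<integral>z. f z \<partial>D x)"
    show "has_weak_integral M F f T"
      unfolding has_weak_integral_def polar
      using polarization(1)[OF T] by (simp add: R)
  qed
qed

end

lemma sphere_monomial_measurable: "sphere_monomial \<alpha> \<beta> \<in> borel_measurable unit_sphere_borel"
  unfolding unit_sphere_borel_def
  by (intro borel_measurable_continuous_on_restrict continuous_on_sphere_monomial)

lemma sphere_monomial_bound:
  fixes \<alpha> \<beta> :: "nat^'d::finite"
  shows "\<exists>B. \<forall>z\<in>cball 0 r. norm (sphere_monomial \<alpha> \<beta> z) \<le> B"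
proof -
  have "compact (sphere_monomial \<alpha> \<beta> ` cball 0 r)"
    by (intro compact_continuous_image continuous_on_sphere_monomial compact_cball)
  then show ?thesis using compact_imp_bounded by (fastforce simp: bounded_iff)
qed

lemma moment_representation_iff:
  fixes \<phi> :: "nat^'d \<Rightarrow> nat^'d \<Rightarrow> ('m::chilbert \<Rightarrow>\<^sub>L 'm)"
  assumes "semispectral_measure unit_sphere_borel F" and "\<And>\<alpha> \<beta>. \<phi> \<alpha> \<beta> \<in> bounded_operators"
  shows "moment_representation F \<phi> \<longleftrightarrow> (\<forall>\<alpha> \<beta> x. cinner (blinfun_apply (\<phi> \<alpha> \<beta>) x) x =
    (\<integral>z. sphere_monomial \<alpha> \<beta> z \<partial>diagonal_measure unit_sphere_borel F x))"
proof -
  have "has_weak_integral unit_sphere_borel F (sphere_monomial \<alpha> \<beta>) (\<phi> \<alpha> \<beta>) \<longleftrightarrow>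
    (\<forall>x. cinner (blinfun_apply (\<phi> \<alpha> \<beta>) x) x =
      (\<integral>z. sphere_monomial \<alpha> \<beta> z \<partial>diagonal_measure unit_sphere_borel F x))" for \<alpha> \<beta>
  proof -
    obtain B where "\<forall>z\<in>cball 0 1. norm (sphere_monomial \<alpha> \<beta> z) \<le> B"
      using sphere_monomial_bound by blast
    then show ?thesis
      by (intro has_weak_integral_iff[where B = B] assms sphere_monomial_measurable) auto
  qed
  then show ?thesis unfolding moment_representation_def by blast
qed

section \<open>Necessity and uniqueness\<close>

lemma sum_in_nonneg_Reals: "(\<And>i. i \<in> I \<Longrightarrow> (f i :: complex) \<in> \<real>\<^sub>\<ge>\<^sub>0) \<Longrightarrow> sum f I \<in> \<real>\<^sub>\<ge>\<^sub>0"
  by (induction I rule: infinite_finite_induct) (auto intro: nonneg_Reals_add_I)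

text \<open>The sum of the |z_j|^2 is 1 on the sphere, so the identity already holds between the
  integrands; over the complex numbers the diagonal values determine the operators.\<close>

lemma moment_representation_spherical:
  fixes \<phi> :: "nat^'d \<Rightarrow> nat^'d \<Rightarrow> ('m::chilbert \<Rightarrow>\<^sub>L 'm)"
  assumes \<phi>: "\<And>\<alpha> \<beta>. \<phi> \<alpha> \<beta> \<in> bounded_operators"
    and F: "semispectral_measure unit_sphere_borel F" and rep: "moment_representation F \<phi>"
  shows "(\<Sum>j\<in>UNIV. \<phi> (\<alpha> + axis j 1) (\<beta> + axis j 1)) = \<phi> \<alpha> \<beta>"
proof (rule bounded_operators_eqI)
  show "(\<Sum>j\<in>UNIV. \<phi> (\<alpha> + axis j 1) (\<beta> + axis j 1)) \<in> bounded_operators"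
    by (intro bounded_operators_sum \<phi>)
  show "\<phi> \<alpha> \<beta> \<in> bounded_operators" by (rule \<phi>)
  fix x
  define D where "D = diagonal_measure unit_sphere_borel F x"
  have D: "finite_measure D" "sets D = sets unit_sphere_borel"
    by (simp_all add: D_def finite_diagonal_measure[OF F])
  have rep': "cinner (blinfun_apply (\<phi> \<alpha> \<beta>) x) x = (\<integral>z. sphere_monomial \<alpha> \<beta> z \<partial>D)" for \<alpha> \<beta>
    using rep unfolding moment_representation_iff[OF F \<phi>] D_def by blast
  have "cinner (blinfun_apply (\<Sum>j\<in>UNIV. \<phi> (\<alpha> + axis j 1) (\<beta> + axis j 1)) x) x =
      (\<Sum>j\<in>UNIV. \<integral>z. sphere_monomial (\<alpha> + axis j 1) (\<beta> + axis j 1) z \<partial>D)"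
    by (simp only: blinfun.sum_left cinner_sum_left rep')
  also have "\<dots> = (\<integral>z. (\<Sum>j\<in>UNIV. sphere_monomial (\<alpha> + axis j 1) (\<beta> + axis j 1) z) \<partial>D)"
    by (rule Bochner_Integration.integral_sum[symmetric])
      (intro integrable_sphere[OF D] continuous_on_sphere_monomial)
  also have "\<dots> = (\<integral>z. sphere_monomial \<alpha> \<beta> z \<partial>D)"
  proof (rule Bochner_Integration.integral_cong[OF refl])
    fix z assume "z \<in> space D"
    then have "norm z = 1" using sets_eq_imp_space_eq[OF D(2)] by simp
    then have 1: "(\<Sum>j\<in>UNIV. (cmod (z $ j))\<^sup>2) = 1" by (simp add: norm_vec_def L2_set_def)
    have "(\<Sum>j\<in>UNIV. sphere_monomial (\<alpha> + axis j 1) (\<beta> + axis j 1) z) =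
        (\<Sum>j\<in>UNIV. complex_of_real ((cmod (z $ j))\<^sup>2)) * sphere_monomial \<alpha> \<beta> z"
      unfolding sum_distrib_right sphere_monomial_Suc complex_norm_square
      by (simp add: mult_ac)
    then show "(\<Sum>j\<in>UNIV. sphere_monomial (\<alpha> + axis j 1) (\<beta> + axis j 1) z) = sphere_monomial \<alpha> \<beta> z"
      unfolding of_real_sum[symmetric] 1 by simp
  qed
  finally show "cinner (blinfun_apply (\<Sum>j\<in>UNIV. \<phi> (\<alpha> + axis j 1) (\<beta> + axis j 1)) x) x =
      cinner (blinfun_apply (\<phi> \<alpha> \<beta>) x) x"
    by (simp add: rep')
qed

text \<open>On simple functions \<open>s\<close> the quadratic form of the kernel \<open>\<integral> s\<^sup>\<alpha> (cnj s)\<^sup>\<beta> dF\<close> is a sum of values of the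
  positive operators \<open>F (s = v)\<close>; the general case follows by approximating the identity of the sphere.\<close>

lemma moment_representation_positive_definite:
  fixes \<phi> :: "nat^'d \<Rightarrow> nat^'d \<Rightarrow> ('m::chilbert \<Rightarrow>\<^sub>L 'm)"
  assumes \<phi>: "\<And>\<alpha> \<beta>. \<phi> \<alpha> \<beta> \<in> bounded_operators"
    and F: "semispectral_measure unit_sphere_borel F" and rep: "moment_representation F \<phi>"
  shows "positive_definite_kernel \<phi>"
  unfolding positive_definite_kernel_def
proof (intro allI impI)
  fix A :: "(nat^'d) set" and x :: "nat^'d \<Rightarrow> 'm" assume "finite A"
  let ?M = "unit_sphere_borel :: (complex^'d) measure"
  define D where "D x = diagonal_measure ?M F x" for x
  have D: "finite_measure (D x)" "sets (D x) = sets ?M" for x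
    by (simp_all add: D_def finite_diagonal_measure[OF F])
  have space: "space (D x) = sphere 0 1" for x using sets_eq_imp_space_eq[OF D(2)] by simp
  have rep': "cinner (blinfun_apply (\<phi> \<alpha> \<beta>) x) x = (\<integral>z. sphere_monomial \<alpha> \<beta> z \<partial>D x)" for \<alpha> \<beta> x
    using rep unfolding moment_representation_iff[OF F \<phi>] D_def by blast
  have "(\<lambda>z. z) \<in> borel_measurable ?M"
    unfolding unit_sphere_borel_def by (intro borel_measurable_continuous_on_restrict continuous_intros)
  then obtain s where "\<forall>n. simple_function ?M (s n)" "\<forall>z\<in>space ?M. (\<lambda>n. s n z) \<longlonglongrightarrow> z"
    "\<forall>n. \<forall>z\<in>space ?M. norm (s n z) \<le> 2 * norm z"
    using borel_measurable_implies_sequence_metric[of "\<lambda>z. z" ?M 0] by auto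
  \<comment> \<open>The approximants may leave the sphere, but |s n z| is at most 2 |z|, so they
    stay in the ball of radius 2, on which monomials are bounded.\<close>
  then have s: "simple_function ?M (s n)" "z \<in> sphere 0 1 \<Longrightarrow> (\<lambda>n. s n z) \<longlonglongrightarrow> z"
    "z \<in> sphere 0 1 \<Longrightarrow> s n z \<in> cball 0 2" for n z
    by auto
  have s': "simple_function (D x) (s n)" for x n
    using s(1) simple_function_cong_sets[OF D(2)] by blast
  have lim: "(\<lambda>n. \<integral>z. sphere_monomial \<alpha> \<beta> (s n z) \<partial>D x) \<longlonglongrightarrow> (\<integral>z. sphere_monomial \<alpha> \<beta> z \<partial>D x)" for \<alpha> \<beta> x
  proof -
    interpret finite_measure "D x" by (rule D)
    obtain B where B: "\<forall>z\<in>cball 0 2. norm (sphere_monomial \<alpha> \<beta> z) \<le> B"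
      using sphere_monomial_bound by blast
    show ?thesis
    proof (rule integral_dominated_convergence[where w = "\<lambda>_. B"])
      show "integrable (D x) (\<lambda>_. B)" by simp
      show "sphere_monomial \<alpha> \<beta> \<in> borel_measurable (D x)"
        using sphere_monomial_measurable measurable_cong_sets[OF D(2) refl] by blast
      show "(\<lambda>z. sphere_monomial \<alpha> \<beta> (s n z)) \<in> borel_measurable (D x)" for n
        by (rule borel_measurable_simple_function) (rule simple_function_compose1[OF s'])
      have cont: "isCont (sphere_monomial \<alpha> \<beta>) z" for z
        using continuous_on_sphere_monomial[of UNIV \<alpha> \<beta>] by (simp add: continuous_on_eq_continuous_at)
      show "AE z in D x. (\<lambda>n. sphere_monomial \<alpha> \<beta> (s n z)) \<longlonglongrightarrow> sphere_monomial \<alpha> \<beta> z"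
        by (rule AE_I2) (simp only: space isCont_tendsto_compose[OF cont s(2)])
      show "AE z in D x. norm (sphere_monomial \<alpha> \<beta> (s n z)) \<le> B" for n
      proof (rule AE_I2)
        fix z assume "z \<in> space (D x)"
        then have "s n z \<in> cball 0 2" by (intro s(3)) (simp only: space)
        then show "norm (sphere_monomial \<alpha> \<beta> (s n z)) \<le> B" using B by blast
      qed
    qed
  qed
  \<comment> \<open>The polarized integral with the monomial evaluated at \<open>s n\<close> in
    place of the identity; it converges to the corresponding value of the kernel.\<close>
  define J where "J n \<alpha> \<beta> = (\<Sum>k<4. \<i> ^ k * (\<integral>z. sphere_monomial \<alpha> \<beta> (s n z) \<partial>D (x \<alpha> + \<i> ^ k *\<^sub>C x \<beta>))) / 4"
    for n \<alpha> \<beta>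
  have J_lim: "(\<lambda>n. \<Sum>\<alpha>\<in>A. \<Sum>\<beta>\<in>A. J n \<alpha> \<beta>) \<longlonglongrightarrow> (\<Sum>\<alpha>\<in>A. \<Sum>\<beta>\<in>A. cinner (blinfun_apply (\<phi> \<alpha> \<beta>) (x \<alpha>)) (x \<beta>))"
  proof (intro tendsto_sum)
    fix \<alpha> \<beta>
    have "(\<lambda>n. J n \<alpha> \<beta>) \<longlonglongrightarrow> (\<Sum>k<4. \<i> ^ k * (\<integral>z. sphere_monomial \<alpha> \<beta> z \<partial>D (x \<alpha> + \<i> ^ k *\<^sub>C x \<beta>))) / 4"
      unfolding J_def by (intro tendsto_intros lim) simp
    then show "(\<lambda>n. J n \<alpha> \<beta>) \<longlonglongrightarrow> cinner (blinfun_apply (\<phi> \<alpha> \<beta>) (x \<alpha>)) (x \<beta>)"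
      unfolding rep'[symmetric] polarization(1)[OF \<phi>, symmetric] .
  qed
  have J_nonneg: "(\<Sum>\<alpha>\<in>A. \<Sum>\<beta>\<in>A. J n \<alpha> \<beta>) \<in> \<real>\<^sub>\<ge>\<^sub>0" for n
  proof -
    define V where "V = s n ` sphere 0 1"
    define E where "E v = s n -` {v} \<inter> sphere 0 1" for v
    have E: "E v \<in> sets ?M" for v using simple_functionD(2)[OF s(1)] by (simp add: E_def)
    define h where "h \<alpha> v = (\<Prod>j\<in>UNIV. (v $ j) ^ (\<alpha> $ j))" for \<alpha> :: "nat^'d" and v :: "complex^'d"
    have mono: "sphere_monomial \<alpha> \<beta> v = h \<alpha> v * cnj (h \<beta> v)" for \<alpha> \<beta> v
      by (simp add: sphere_monomial_def h_def)
    have J: "J n \<alpha> \<beta> = (\<Sum>v\<in>V. cinner (blinfun_apply (F (E v)) (h \<alpha> v *\<^sub>C x \<alpha>)) (h \<beta> v *\<^sub>C x \<beta>))" for \<alpha> \<beta>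
    proof -
      have "J n \<alpha> \<beta> = (\<Sum>k<4. \<i> ^ k * (\<Sum>v\<in>V. sphere_monomial \<alpha> \<beta> v * measure (D (x \<alpha> + \<i> ^ k *\<^sub>C x \<beta>)) (E v))) / 4"
        unfolding J_def integral_simple_function_compose[OF D(1) s', where g = "sphere_monomial \<alpha> \<beta>"]
        by (simp add: space V_def E_def)
      also have "\<dots> = (\<Sum>v\<in>V. sphere_monomial \<alpha> \<beta> v * ((\<Sum>k<4. \<i> ^ k * measure (D (x \<alpha> + \<i> ^ k *\<^sub>C x \<beta>)) (E v)) / 4))"
        unfolding sum_distrib_left sum_divide_distrib
        by (subst sum.swap) (simp add: mult_ac)
      also have "\<dots> = (\<Sum>v\<in>V. sphere_monomial \<alpha> \<beta> v * cinner (blinfun_apply (F (E v)) (x \<alpha>)) (x \<beta>))"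
        unfolding D_def measure_diagonal_measure[OF F E]
          polarization(1)[OF semispectral_bounded_operator[OF F E], symmetric] ..
      also have "\<dots> = (\<Sum>v\<in>V. cinner (blinfun_apply (F (E v)) (h \<alpha> v *\<^sub>C x \<alpha>)) (h \<beta> v *\<^sub>C x \<beta>))"
        using semispectral_bounded_operator[OF F E]
        by (simp add: mono bounded_operators_def cinner_scaleC_left cinner_scaleC_right mult_ac)
      finally show ?thesis .
    qed
    have "(\<Sum>\<alpha>\<in>A. \<Sum>\<beta>\<in>A. J n \<alpha> \<beta>) =
        (\<Sum>\<alpha>\<in>A. \<Sum>v\<in>V. \<Sum>\<beta>\<in>A. cinner (blinfun_apply (F (E v)) (h \<alpha> v *\<^sub>C x \<alpha>)) (h \<beta> v *\<^sub>C x \<beta>))"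
      unfolding J by (intro sum.cong refl sum.swap)
    also have "\<dots> = (\<Sum>v\<in>V. \<Sum>\<alpha>\<in>A. \<Sum>\<beta>\<in>A. cinner (blinfun_apply (F (E v)) (h \<alpha> v *\<^sub>C x \<alpha>)) (h \<beta> v *\<^sub>C x \<beta>))"
      by (rule sum.swap)
    \<comment> \<open>For fixed \<open>v\<close> the double sum is the quadratic form of the
      positive operator \<open>F (E v)\<close> at one vector.\<close>
    also have "\<dots> = (\<Sum>v\<in>V. cinner (blinfun_apply (F (E v)) (\<Sum>\<alpha>\<in>A. h \<alpha> v *\<^sub>C x \<alpha>)) (\<Sum>\<beta>\<in>A. h \<beta> v *\<^sub>C x \<beta>))"
      unfolding blinfun.sum_right cinner_sum_left by (simp only: cinner_sum_right)
    also have "\<dots> \<in> \<real>\<^sub>\<ge>\<^sub>0"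
      by (intro sum_in_nonneg_Reals semispectral_nonneg[OF F E])
    finally show ?thesis .
  qed
  show "(\<Sum>\<alpha>\<in>A. \<Sum>\<beta>\<in>A. cinner (blinfun_apply (\<phi> \<alpha> \<beta>) (x \<alpha>)) (x \<beta>)) \<in> \<real>\<^sub>\<ge>\<^sub>0"
    by (rule Lim_in_closed_set[OF closed_nonneg_Reals_complex _ _ J_lim]) (use J_nonneg in auto)
qed

lemma moment_representation_unique:
  fixes \<phi> :: "nat^'d \<Rightarrow> nat^'d \<Rightarrow> ('m::chilbert \<Rightarrow>\<^sub>L 'm)"
  assumes \<phi>: "\<And>\<alpha> \<beta>. \<phi> \<alpha> \<beta> \<in> bounded_operators"
    and F: "semispectral_measure unit_sphere_borel F" "moment_representation F \<phi>"
    and G: "semispectral_measure unit_sphere_borel G" "moment_representation G \<phi>"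
    and A: "A \<in> sets unit_sphere_borel"
  shows "F A = G A"
proof (rule bounded_operators_eqI)
  show "F A \<in> bounded_operators" "G A \<in> bounded_operators"
    using semispectral_bounded_operator[OF F(1) A] semispectral_bounded_operator[OF G(1) A] .
  fix x
  define \<mu> where "\<mu> b = diagonal_measure unit_sphere_borel (if b then F else G) x" for b
  have "(\<Sum>b\<in>UNIV. (if b then 1 else - 1) * complex_of_real (measure (\<mu> b) A)) = 0"
  proof (rule lincomb_measure_eq_zero[OF _ _ _ _ A])
    show "finite_measure (\<mu> b)" "sets (\<mu> b) = sets unit_sphere_borel" for b
      using finite_diagonal_measure[OF F(1)] finite_diagonal_measure[OF G(1)] by (simp_all add: \<mu>_def)
    show "(\<Sum>b\<in>UNIV. (if b then 1 else - 1) * (\<integral>z. sphere_monomial \<alpha> \<beta> z \<partial>\<mu> b)) = 0" for \<alpha> \<beta>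
      using F(2) G(2) unfolding moment_representation_iff[OF F(1) \<phi>] moment_representation_iff[OF G(1) \<phi>]
      by (simp add: UNIV_bool \<mu>_def)
  qed simp
  then show "cinner (blinfun_apply (F A) x) x = cinner (blinfun_apply (G A) x) x"
    unfolding measure_diagonal_measure[OF F(1) A, symmetric] measure_diagonal_measure[OF G(1) A, symmetric]
    by (simp add: UNIV_bool \<mu>_def)
qed

section \<open>Existence\<close>

lemma cinner_kernel_psd:
  fixes \<phi> :: "'i \<Rightarrow> 'i \<Rightarrow> ('m::chilbert \<Rightarrow>\<^sub>L 'm)"
  assumes \<phi>: "\<And>\<alpha> \<beta>. \<phi> \<alpha> \<beta> \<in> bounded_operators" and pd: "positive_definite_kernel \<phi>"
  shows "psd_kernel (\<lambda>\<alpha> \<beta>. cinner (blinfun_apply (\<phi> \<alpha> \<beta>) x) x)"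
  unfolding psd_kernel_def
proof (intro allI impI)
  fix A :: "'i set" and c :: "'i \<Rightarrow> complex" assume "finite A"
  from pd[unfolded positive_definite_kernel_def, rule_format, OF this, of "\<lambda>\<alpha>. c \<alpha> *\<^sub>C x"]
  have "(\<Sum>\<alpha>\<in>A. \<Sum>\<beta>\<in>A. cinner (blinfun_apply (\<phi> \<alpha> \<beta>) (c \<alpha> *\<^sub>C x)) (c \<beta> *\<^sub>C x)) \<in> \<real>\<^sub>\<ge>\<^sub>0" .
  moreover have "cinner (blinfun_apply (\<phi> \<alpha> \<beta>) (c \<alpha> *\<^sub>C x)) (c \<beta> *\<^sub>C x) =
      cinner (blinfun_apply (\<phi> \<alpha> \<beta>) x) x * c \<alpha> * cnj (c \<beta>)" for \<alpha> \<beta>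
    using \<phi>[of \<alpha> \<beta>] by (simp add: bounded_operators_def cinner_scaleC_left cinner_scaleC_right)
  ultimately show "(\<Sum>\<alpha>\<in>A. \<Sum>\<beta>\<in>A. cinner (blinfun_apply (\<phi> \<alpha> \<beta>) x) x * c \<alpha> * cnj (c \<beta>)) \<in> \<real>\<^sub>\<ge>\<^sub>0"
    by simp
qed

section \<open>Assembling the operators from the scalar measures\<close>

locale diagonal_moments =
  fixes \<phi> :: "nat^'d \<Rightarrow> nat^'d \<Rightarrow> ('m::chilbert \<Rightarrow>\<^sub>L 'm)" and \<mu> :: "'m \<Rightarrow> (complex^'d) measure"
  assumes bounded: "\<phi> \<alpha> \<beta> \<in> bounded_operators"
    and finite: "finite_measure (\<mu> x)" and sets [simp]: "sets (\<mu> x) = sets unit_sphere_borel"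
    and moment: "(\<integral>z. sphere_monomial \<alpha> \<beta> z \<partial>\<mu> x) = cinner (blinfun_apply (\<phi> \<alpha> \<beta>) x) x"
begin

text \<open>The measures \<open>\<mu> x\<close> are chosen independently for each \<open>x\<close>.
  Since moments determine measures, they nevertheless inherit every linear relation that the
  kernel's quadratic forms satisfy at all indices.\<close>

lemma lincomb_zero:
  assumes "A \<in> sets unit_sphere_borel"
    and "\<And>\<alpha> \<beta>. (\<Sum>j\<in>J. a j * cinner (blinfun_apply (\<phi> \<alpha> \<beta>) (w j)) (w j)) = 0"
  shows "(\<Sum>j\<in>J. a j * measure (\<mu> (w j)) A) = 0"
proof (cases "finite J")
  case True
  then show ?thesis
    using lincomb_measure_eq_zero[of J "\<lambda>j. \<mu> (w j)" a A] assms finite by (simp add: moment)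
qed simp

text \<open>By polarization this is \<open>\<langle>F(A) x, y\<rangle>\<close> for the measure \<open>F\<close> to be constructed.\<close>

definition form :: "(complex^'d) set \<Rightarrow> 'm \<Rightarrow> 'm \<Rightarrow> complex" where
  "form A x y = (\<Sum>k<4. \<i> ^ k * measure (\<mu> (x + \<i> ^ k *\<^sub>C y)) A) / 4"

text \<open>The sesquilinear counterpart: once every form is expanded by polarization, the relation
  is one between measures indexed by \<open>J \<times> {..<4}\<close>.\<close>

lemma form_lincomb_zero:
  assumes A: "A \<in> sets unit_sphere_borel"
    and eq: "\<And>\<alpha> \<beta>. (\<Sum>j\<in>J. a j * cinner (blinfun_apply (\<phi> \<alpha> \<beta>) (x j)) (y j)) = 0"
  shows "(\<Sum>j\<in>J. a j * form A (x j) (y j)) = 0"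
proof -
  have split: "(\<Sum>p\<in>J \<times> {..<4}. a (fst p) * \<i> ^ snd p * g (x (fst p) + \<i> ^ snd p *\<^sub>C y (fst p))) =
      4 * (\<Sum>j\<in>J. a j * ((\<Sum>k<4. \<i> ^ k * g (x j + \<i> ^ k *\<^sub>C y j)) / 4))" for g
  proof -
    have quarter: "4 * (\<Sum>j\<in>J. a j * (s j / 4)) = (\<Sum>j\<in>J. a j * s j)" for s
      by (simp add: sum_distrib_left)
    show ?thesis
      unfolding quarter
      using sum.cartesian_product[of "\<lambda>j k. a j * \<i> ^ k * g (x j + \<i> ^ k *\<^sub>C y j)" "{..<4}" J]
      by (simp add: split_beta sum_distrib_left mult.assoc)
  qed
  have "(\<Sum>p\<in>J \<times> {..<4}. a (fst p) * \<i> ^ snd p * measure (\<mu> (x (fst p) + \<i> ^ snd p *\<^sub>C y (fst p))) A) = 0"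
  proof (rule lincomb_zero[OF A])
    fix \<alpha> \<beta>
    show "(\<Sum>p\<in>J \<times> {..<4}. a (fst p) * \<i> ^ snd p * cinner (blinfun_apply (\<phi> \<alpha> \<beta>) (x (fst p) + \<i> ^ snd p *\<^sub>C y (fst p)))
        (x (fst p) + \<i> ^ snd p *\<^sub>C y (fst p))) = 0"
      using split[of "\<lambda>w. cinner (blinfun_apply (\<phi> \<alpha> \<beta>) w) w"]
      unfolding polarization(1)[OF bounded, symmetric] by (simp add: eq)
  qed
  then show ?thesis
    using split[of "\<lambda>w. complex_of_real (measure (\<mu> w) A)"] by (simp add: form_def)
qed

context
  fixes A :: "(complex^'d) set" assumes A: "A \<in> sets unit_sphere_borel"
begin

lemma form_add_left: "form A (x + x') y = form A x y + form A x' y"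
  using form_lincomb_zero[OF A, where J = "{..<3 :: nat}" and a = "\<lambda>j. if j = 0 then 1 else - 1"
      and x = "\<lambda>j. if j = 0 then x + x' else if j = 1 then x else x'" and y = "\<lambda>_. y"]
  by (simp add: eval_nat_numeral blinfun.add_right cinner_add_left diff_eq_eq add.commute)

lemma form_scale_left: "form A (c *\<^sub>C x) y = c * form A x y"
proof -
  have "cinner (blinfun_apply (\<phi> \<alpha> \<beta>) (c *\<^sub>C x)) y = c * cinner (blinfun_apply (\<phi> \<alpha> \<beta>) x) y" for \<alpha> \<beta>
    using bounded[of \<alpha> \<beta>] by (simp add: bounded_operators_def cinner_scaleC_left)
  then show ?thesis
    using form_lincomb_zero[OF A, where J = "{..<2 :: nat}" and a = "\<lambda>j. if j = 0 then 1 else - c"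
      and x = "\<lambda>j. if j = 0 then c *\<^sub>C x else x" and y = "\<lambda>_. y"]
    by (simp add: eval_nat_numeral)
qed

lemma form_self: "form A x x = measure (\<mu> x) A"
proof -
  have "(\<Sum>k<Suc 4. (if k < 4 then \<i> ^ k else - 4) * complex_of_real (measure (\<mu> (if k < 4 then x + \<i> ^ k *\<^sub>C x else x)) A)) = 0"
  proof (rule lincomb_zero[OF A])
    fix \<alpha> \<beta>
    have "(\<Sum>k<4. \<i> ^ k * cinner (blinfun_apply (\<phi> \<alpha> \<beta>) (x + \<i> ^ k *\<^sub>C x)) (x + \<i> ^ k *\<^sub>C x)) =
        4 * cinner (blinfun_apply (\<phi> \<alpha> \<beta>) x) x"
      using polarization(1)[OF bounded, of \<alpha> \<beta> x x] by (simp add: mult.commute)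
    then show "(\<Sum>k<Suc 4. (if k < 4 then \<i> ^ k else - 4) * cinner (blinfun_apply (\<phi> \<alpha> \<beta>)
        (if k < 4 then x + \<i> ^ k *\<^sub>C x else x)) (if k < 4 then x + \<i> ^ k *\<^sub>C x else x)) = 0"
      unfolding sum.lessThan_Suc by simp
  qed
  then show ?thesis unfolding sum.lessThan_Suc by (simp add: form_def)
qed

text \<open><\<phi>(\<alpha>,\<beta>) y, x> has two expansions, by the vectors y + i^k x and, with
  conjugate coefficients, by x + i^k y. Equating them is a linear relation over a disjoint union of
  index sets; as measures are real, the second expansion becomes the conjugate of
  \<open>form A x y\<close>.\<close>

lemma form_hermitian: "form A y x = cnj (form A x y)"
proof -
  let ?w = "\<lambda>p. (case p of Inl k \<Rightarrow> y + \<i> ^ k *\<^sub>C x | Inr k \<Rightarrow> x + \<i> ^ k *\<^sub>C y)"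
  let ?a = "\<lambda>p. (case p of Inl k \<Rightarrow> \<i> ^ k | Inr k \<Rightarrow> - cnj (\<i> ^ k))"
  have plus: "(\<Sum>p\<in>{..<4} <+> {..<4}. ?a p * g (?w p)) =
      4 * ((\<Sum>k<4. \<i> ^ k * g (y + \<i> ^ k *\<^sub>C x)) / 4) - 4 * ((\<Sum>k<4. cnj (\<i> ^ k) * g (x + \<i> ^ k *\<^sub>C y)) / 4)" for g
    by (simp add: sum.Plus sum_negf)
  have "(\<Sum>p\<in>{..<4} <+> {..<4}. ?a p * complex_of_real (measure (\<mu> (?w p)) A)) = 0"
  proof (rule lincomb_zero[OF A])
    fix \<alpha> \<beta>
    show "(\<Sum>p\<in>{..<4} <+> {..<4}. ?a p * cinner (blinfun_apply (\<phi> \<alpha> \<beta>) (?w p)) (?w p)) = 0"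
      unfolding plus[of "\<lambda>w. cinner (blinfun_apply (\<phi> \<alpha> \<beta>) w) w"] polarization[OF bounded, symmetric] by simp
  qed
  then show ?thesis
    unfolding plus[of "\<lambda>w. complex_of_real (measure (\<mu> w) A)"] by (simp add: form_def)
qed

lemma measure_le: "measure (\<mu> w) A \<le> norm (\<phi> 0 0) * (norm w)\<^sup>2"
proof -
  interpret finite_measure "\<mu> w" by (rule finite)
  have "measure (\<mu> w) A \<le> measure (\<mu> w) (space (\<mu> w))" by (rule bounded_measure)
  also have "complex_of_real \<dots> = cinner (blinfun_apply (\<phi> 0 0) w) w"
    using moment[where \<alpha> = 0 and \<beta> = 0 and x = w] by (simp add: scaleR_conv_of_real)
  then have "measure (\<mu> w) (space (\<mu> w)) \<le> cmod (cinner (blinfun_apply (\<phi> 0 0) w) w)"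
    by (metis norm_of_real abs_ge_self)
  also have "\<dots> \<le> norm (blinfun_apply (\<phi> 0 0) w) * norm w" by (rule Cauchy_Schwarz_cinner)
  also have "\<dots> \<le> (norm (\<phi> 0 0) * norm w) * norm w"
    by (intro mult_right_mono norm_blinfun) simp
  finally show ?thesis by (simp add: power2_eq_square mult.assoc)
qed

text \<open>For unit vectors the norm of x + i^k y is at most 2, so each of the four measures is at
  most 4 times the norm of \<phi>(0,0), and so is their average. Real homogeneity in both arguments
  reduces to unit vectors and turns the quadratic estimate into a product of norms.\<close>

lemma form_bound: "cmod (form A x y) \<le> 4 * norm (\<phi> 0 0) * norm x * norm y"
proof -
  have unit: "cmod (form A x y) \<le> 4 * norm (\<phi> 0 0)" if "norm x = 1" "norm y = 1" for x y
  proof -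
    have "cmod (\<Sum>k<4. \<i> ^ k * complex_of_real (measure (\<mu> (x + \<i> ^ k *\<^sub>C y)) A)) \<le> (\<Sum>k<(4::nat). 4 * norm (\<phi> 0 0))"
    proof (rule sum_norm_le)
      fix k :: nat
      have "norm (x + \<i> ^ k *\<^sub>C y) \<le> 2"
        using norm_triangle_ineq[of x "\<i> ^ k *\<^sub>C y"] that by (simp add: norm_scaleC norm_power)
      then have "(norm (x + \<i> ^ k *\<^sub>C y))\<^sup>2 \<le> 2\<^sup>2" by (rule power_mono) simp
      then have "norm (\<phi> 0 0) * (norm (x + \<i> ^ k *\<^sub>C y))\<^sup>2 \<le> norm (\<phi> 0 0) * 4"
        by (intro mult_left_mono) auto
      with measure_le[of "x + \<i> ^ k *\<^sub>C y"]
      show "cmod (\<i> ^ k * complex_of_real (measure (\<mu> (x + \<i> ^ k *\<^sub>C y)) A)) \<le> 4 * norm (\<phi> 0 0)"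
        by (simp add: norm_mult norm_power)
    qed
    then show ?thesis by (simp add: form_def norm_divide)
  qed
  have scale: "form A (r *\<^sub>R x) (t *\<^sub>R y) = of_real r * of_real t * form A x y" for r t x y
  proof -
    have 1: "form A (r *\<^sub>R x) y = of_real r * form A x y" for r x y
      using form_scale_left[of "of_real r" x y] by (simp add: scaleC_of_real)
    have "form A x (t *\<^sub>R y) = of_real t * form A x y" for x
      using 1[of t y x] form_hermitian[of x "t *\<^sub>R y"] form_hermitian[of x y] by simp
    then show ?thesis by (simp add: 1)
  qed
  show ?thesis
  proof (cases "x = 0 \<or> y = 0")
    case True
    then show ?thesis using scale[of 0 x 1 y] scale[of 1 x 0 y] by auto
  next
    case False
    have "form A x y = of_real (norm x) * of_real (norm y) * form A (x /\<^sub>R norm x) (y /\<^sub>R norm y)"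
      unfolding scale[symmetric] using False by simp
    then have "cmod (form A x y) = norm x * norm y * cmod (form A (x /\<^sub>R norm x) (y /\<^sub>R norm y))"
      by (simp add: norm_mult)
    also have "\<dots> \<le> norm x * norm y * (4 * norm (\<phi> 0 0))"
      using False by (intro mult_left_mono unit) auto
    finally show ?thesis by (simp add: mult_ac)
  qed
qed

lemma form_operator: "\<exists>T\<in>bounded_operators. \<forall>x y. cinner (blinfun_apply T x) y = form A x y"
  by (rule bounded_form_operator[OF form_add_left form_scale_left form_hermitian form_bound]) simp

end

definition operator_measure :: "(complex^'d) set \<Rightarrow> ('m \<Rightarrow>\<^sub>L 'm)" where
  "operator_measure A =
     (SOME T. T \<in> bounded_operators \<and> (\<forall>x y. cinner (blinfun_apply T x) y = form A x y))"

lemma operator_measure: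
  assumes "A \<in> sets unit_sphere_borel"
  shows "operator_measure A \<in> bounded_operators"
    "cinner (blinfun_apply (operator_measure A) x) y = form A x y"
proof -
  have "\<exists>T. T \<in> bounded_operators \<and> (\<forall>x y. cinner (blinfun_apply T x) y = form A x y)"
    using form_operator[OF assms] by blast
  from someI_ex[OF this]
  show "operator_measure A \<in> bounded_operators"
    "cinner (blinfun_apply (operator_measure A) x) y = form A x y"
    unfolding operator_measure_def by blast+
qed

lemma regular_form: "regular_complex_measure unit_sphere_borel (\<lambda>A. cinner (blinfun_apply (operator_measure A) x) y)"
  unfolding regular_complex_measure_def
proof (intro conjI ballI allI impI)
  let ?w = "\<lambda>k. x + \<i> ^ k *\<^sub>C y"
  show "complex_measure unit_sphere_borel (\<lambda>A. cinner (blinfun_apply (operator_measure A) x) y)"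
    unfolding complex_measure_def
  proof (intro allI impI)
    fix A :: "nat \<Rightarrow> (complex^'d) set"
    assume A: "range A \<subseteq> sets unit_sphere_borel" "disjoint_family A"
    have "(\<lambda>n. form (A n) x y) sums form (\<Union>n. A n) x y"
      unfolding form_def
    proof (intro sums_divide sums_sum sums_mult sums_of_real)
      fix k :: nat
      interpret finite_measure "\<mu> (?w k)" by (rule finite)
      show "(\<lambda>n. measure (\<mu> (?w k)) (A n)) sums measure (\<mu> (?w k)) (\<Union>n. A n)"
        using A by (intro finite_measure_UNION) auto
    qed
    moreover have "A n \<in> sets unit_sphere_borel" for n using A(1) by auto
    moreover from this have "(\<Union>n. A n) \<in> sets unit_sphere_borel" by auto
    ultimately show "(\<lambda>n. cinner (blinfun_apply (operator_measure (A n)) x) y) sums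
        cinner (blinfun_apply (operator_measure (\<Union>n. A n)) x) y"
      by (simp add: operator_measure)
  qed
  fix A :: "(complex^'d) set" and e :: real
  assume A: "A \<in> sets unit_sphere_borel" and "0 < e"
  have "\<exists>K U. compact K \<and> openin (top_of_set (sphere 0 1)) U \<and> K \<subseteq> A \<and> A \<subseteq> U \<and>
      (\<forall>C\<in>sets unit_sphere_borel. C \<subseteq> U - K \<longrightarrow> measure (\<mu> (?w k)) C < e)" for k
    by (rule regular_finite_measure[OF finite sets A \<open>0 < e\<close>])
  then obtain K U where KU: "\<And>k. compact (K k)" "\<And>k. openin (top_of_set (sphere 0 1)) (U k)"
    "\<And>k. K k \<subseteq> A" "\<And>k. A \<subseteq> U k"
    "\<And>k C. C \<in> sets unit_sphere_borel \<Longrightarrow> C \<subseteq> U k - K k \<Longrightarrow> measure (\<mu> (?w k)) C < e"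
    by metis
  \<comment> \<open>One pair has to serve all four measures: a finite union of compact sets and a
    finite intersection of relatively open sets. The average of four values below e is again below
    e.\<close>
  define K' where "K' = (\<Union>k<4::nat. K k)"
  define U' where "U' = (\<Inter>k<4::nat. U k)"
  have nonempty: "{..<4 :: nat} \<noteq> {}" by (rule ex_in_conv[THEN iffD1], rule exI[of _ 0]) simp
  have "cmod (cinner (blinfun_apply (operator_measure C) x) y) < e"
    if C: "C \<in> sets unit_sphere_borel" "C \<subseteq> U' - K'" for C
  proof -
    have "cmod (\<Sum>k<4. \<i> ^ k * complex_of_real (measure (\<mu> (?w k)) C)) \<le> (\<Sum>k<(4::nat). measure (\<mu> (?w k)) C)"
      by (rule sum_norm_le) (simp add: norm_mult norm_power)
    also have "\<dots> < (\<Sum>k<(4::nat). e)"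
    proof (rule sum_strict_mono)
      show "{..<4 :: nat} \<noteq> {}" by (rule nonempty)
      show "measure (\<mu> (?w k)) C < e" if "k \<in> {..<4}" for k
        using C that by (intro KU(5)) (auto simp: U'_def K'_def)
    qed simp
    finally show ?thesis by (simp add: operator_measure[OF C(1)] form_def norm_divide)
  qed
  moreover have "compact K'" unfolding K'_def by (intro compact_UN KU) simp
  moreover have "openin (top_of_set (sphere 0 1)) U'"
    unfolding U'_def by (intro openin_INT2 KU nonempty) simp
  moreover have "K' \<subseteq> A" "A \<subseteq> U'" using KU(3,4) by (auto simp: K'_def U'_def)
  ultimately show "\<exists>K U. compact K \<and> openin (top_of_set (space unit_sphere_borel)) U \<and> K \<subseteq> A \<and> A \<subseteq> U \<and>
      (\<forall>C\<in>sets unit_sphere_borel. C \<subseteq> U - K \<longrightarrow> cmod (cinner (blinfun_apply (operator_measure C) x) y) < e)"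
    by (intro exI[of _ K'] exI[of _ U']) simp
qed

lemma semispectral_operator_measure: "semispectral_measure unit_sphere_borel operator_measure"
  unfolding semispectral_measure_def
proof (intro conjI ballI allI impI regular_form)
  show "positive_operator (operator_measure A)" if "A \<in> sets unit_sphere_borel" for A
    using that by (simp add: positive_operator_def operator_measure form_self)
  fix A B :: "(complex^'d) set"
  assume AB: "A \<in> sets unit_sphere_borel" "B \<in> sets unit_sphere_borel" "A \<inter> B = {}"
  show "operator_measure (A \<union> B) = operator_measure A + operator_measure B"
  proof (rule bounded_operators_eqI)
    fix x
    interpret finite_measure "\<mu> x" by (rule finite)
    show "cinner (blinfun_apply (operator_measure (A \<union> B)) x) x =
        cinner (blinfun_apply (operator_measure A + operator_measure B) x) x"
      using AB finite_measure_Union[of A B]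
      by (simp add: operator_measure form_self blinfun.add_left cinner_add_left)
  qed (use AB in \<open>auto intro!: operator_measure bounded_operators_add\<close>)
qed

text \<open>By \<open>form_self\<close> the diagonal measures of the constructed set function are
  the given \<open>\<mu> x\<close>, whose moments are known.\<close>

lemma moment_representation_operator_measure: "moment_representation operator_measure \<phi>"
proof -
  have "diagonal_measure unit_sphere_borel operator_measure x = \<mu> x" for x
  proof (rule measure_eqI)
    interpret finite_measure "\<mu> x" by (rule finite)
    show "sets (diagonal_measure unit_sphere_borel operator_measure x) = sets (\<mu> x)" by simp
    show "emeasure (diagonal_measure unit_sphere_borel operator_measure x) A = emeasure (\<mu> x) A"
      if "A \<in> sets (diagonal_measure unit_sphere_borel operator_measure x)" for A
      using that by (simp add: emeasure_diagonal_measure[OF semispectral_operator_measure]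
          operator_measure form_self emeasure_eq_measure)
  qed
  then show ?thesis
    by (simp add: moment_representation_iff[OF semispectral_operator_measure bounded] moment)
qed

end

lemma moment_representation_exists:
  fixes \<phi> :: "nat^'d \<Rightarrow> nat^'d \<Rightarrow> ('m::chilbert \<Rightarrow>\<^sub>L 'm)"
  assumes \<phi>: "\<And>\<alpha> \<beta>. \<phi> \<alpha> \<beta> \<in> bounded_operators" and pd: "positive_definite_kernel \<phi>"
    and sph: "\<And>\<alpha> \<beta>. (\<Sum>j\<in>UNIV. \<phi> (\<alpha> + axis j 1) (\<beta> + axis j 1)) = \<phi> \<alpha> \<beta>"
  shows "\<exists>F. semispectral_measure unit_sphere_borel F \<and> moment_representation F \<phi>"
proof -
  have "\<exists>\<mu>. finite_measure \<mu> \<and> sets \<mu> = sets unit_sphere_borel \<and>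
      (\<forall>\<alpha> \<beta>. (\<integral>z. sphere_monomial \<alpha> \<beta> z \<partial>\<mu>) = cinner (blinfun_apply (\<phi> \<alpha> \<beta>) x) x)" for x
  proof -
    have "spherical (\<lambda>\<alpha> \<beta>. cinner (blinfun_apply (\<phi> \<alpha> \<beta>) x) x)"
      unfolding spherical_def shift_def
      by (simp only: cinner_sum_left[symmetric] blinfun.sum_left[symmetric] sph) simp
    from scalar_moment_problem[OF cinner_kernel_psd[OF \<phi> pd] this]
    show ?thesis by metis
  qed
  then obtain \<mu> where \<mu>: "\<And>x. finite_measure (\<mu> x)" "\<And>x. sets (\<mu> x) = sets unit_sphere_borel"
    "\<And>x \<alpha> \<beta>. (\<integral>z. sphere_monomial \<alpha> \<beta> z \<partial>\<mu> x) = cinner (blinfun_apply (\<phi> \<alpha> \<beta>) x) x"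
    by metis
  interpret diagonal_moments \<phi> \<mu> by (rule diagonal_moments.intro[OF \<phi> \<mu>])
  show ?thesis using semispectral_operator_measure moment_representation_operator_measure by blast
qed

theorem theorem5p1:
  fixes \<phi> :: "nat^'d \<Rightarrow> nat^'d \<Rightarrow> ('m::chilbert \<Rightarrow>\<^sub>L 'm)"
  assumes "\<And>\<alpha> \<beta>. \<phi> \<alpha> \<beta> \<in> bounded_operators"
  shows "((\<exists>F. semispectral_measure unit_sphere_borel F \<and> moment_representation F \<phi>) \<longleftrightarrow>
          positive_definite_kernel \<phi> \<and>
          (\<forall>\<alpha> \<beta>. (\<Sum>j\<in>UNIV. \<phi> (\<alpha> + axis j 1) (\<beta> + axis j 1)) = \<phi> \<alpha> \<beta>)) \<and>
         (\<forall>F G. semispectral_measure unit_sphere_borel F \<and> moment_representation F \<phi> \<and>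
                semispectral_measure unit_sphere_borel G \<and> moment_representation G \<phi> \<longrightarrow>
                (\<forall>A\<in>sets unit_sphere_borel. F A = G A))"
proof (intro conjI iffI allI impI ballI)
  assume "\<exists>F. semispectral_measure unit_sphere_borel F \<and> moment_representation F \<phi>"
  then obtain F where F: "semispectral_measure unit_sphere_borel F" "moment_representation F \<phi>" by blast
  show "positive_definite_kernel \<phi>" by (rule moment_representation_positive_definite[OF assms F])
  show "(\<Sum>j\<in>UNIV. \<phi> (\<alpha> + axis j 1) (\<beta> + axis j 1)) = \<phi> \<alpha> \<beta>" for \<alpha> \<beta>
    by (rule moment_representation_spherical[OF assms F])
next
  assume "positive_definite_kernel \<phi> \<and> (\<forall>\<alpha> \<beta>. (\<Sum>j\<in>UNIV. \<phi> (\<alpha> + axis j 1) (\<beta> + axis j 1)) = \<phi> \<alpha> \<beta>)"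
  then show "\<exists>F. semispectral_measure unit_sphere_borel F \<and> moment_representation F \<phi>"
    by (intro moment_representation_exists assms) auto
next
  fix F G :: "(complex^'d) set \<Rightarrow> ('m \<Rightarrow>\<^sub>L 'm)" and A :: "(complex^'d) set"
  assume "semispectral_measure unit_sphere_borel F \<and> moment_representation F \<phi> \<and>
    semispectral_measure unit_sphere_borel G \<and> moment_representation G \<phi>" "A \<in> sets unit_sphere_borel"
  then show "F A = G A" by (intro moment_representation_unique[OF assms]) auto
qed

end
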